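(* Let $\ell>0$, $B(x)=\operatorname{diag}(\beta_1(x),\dots,\beta_n(x))$ and $Q=(Q_{jk})\in L^1([0,\ell];\mathbb C^{n\times n})$, where the real-valued $\beta_k$ satisfy: $\beta_k,1/\beta_k\in L^\infty[0,\ell]$, each with constant nonzero sign; for some $n_-\in\{0,\dots,n\}$, $\beta_1\le\dots\le\beta_{n_-}<0<\beta_{n_-+1}\le\dots\le\beta_n$ on $[0,\ell]$; there is $\theta>0$ such that for each $k\le n-1$ either $\beta_k\equiv\beta_{k+1}$ or $\beta_k(x)+\theta<\beta_{k+1}(x)$ on $[0,\ell]$; and $Q_{jk}\equiv0$ whenever $\beta_j\equiv\beta_k$. Let the boundary conditions $Cy(0)+Dy(\ell)=0$ be regular, and let $\Lambda=\{\lambda_m\}_{m\in\mathbb Z}$ and $\Lambda_0=\{\lambda_m^0\}_{m\in\mathbb Z}$ be the sequences of zeros (counting multiplicity) of $\Delta_Q$ and $\Delta_0$, ordered so that $\lambda_m=\lambda_m^0+o(1)$ as $m\to\infty$. (i) For each $p\in\{1,\dots,n\}$, uniformly in $x\in[0,\ell]$, $$Y_p(x,\lambda_m)=Y_p^0(x,\lambda_m^0)+o(1)\quad\text{as }m\to\infty,\ m\in\mathbb Z;$$ in particular $\|Y_p(\cdot,\lambda_m)-Y_p^0(\cdot,\lambda_m^0)\|_{\mathfrak H}\to0$. (ii) If in addition the boundary conditions are strictly regular, then one can choose a normalized system of root vectors $\{f_m\}_{m\in\mathbb Z}$ of $L_U(Q)$ and a normalized system of root vectors $\{f_m^0\}_{m\in\mathbb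 Z}$ of $L_U(0)$ ($f_m$ corresponding to $\lambda_m$, $f_m^0$ to $\lambda_m^0$) such that $$\|f_m-f_m^0\|_{C([0,\ell];\mathbb C^n)}\to0\quad\text{as }m\to\infty,\ m\in\mathbb Z.$$ Moreover, for $|m|$ sufficiently large the eigenvalues $\lambda_m$ and $\lambda_m^0$ are simple and $f_m=\alpha_mY_{p_m}(\cdot,\lambda_m)$, $f_m^0=\alpha_m^0Y^0_{p_m}(\cdot,\lambda_m^0)$ for some $\alpha_m,\alpha_m^0\in\mathbb C\setminus\{0\}$ and $p_m\in\{1,\dots,n\}$.
   Context: $\rho_k(x)=\int_0^x\beta_k$, $b_k=\rho_k(\ell)$. $\mathfrak H=\bigoplus_kL^2_{|\beta_k|}[0,\ell]$, $(f,g)_{\mathfrak H}=\int_0^\ell\langle|B|f,g\rangle dx$. $L_U(Q)$ is the operator in $\mathfrak H$, $L_U(Q)y=-iB^{-1}(y'+Qy)$, on $\{y\in AC([0,\ell];\mathbb C^n):-iB^{-1}(y'+Qy)\in\mathfrak H,\ Cy(0)+Dy(\ell)=0\}$ ($C,D\in\mathbb C^{n\times n}$, $\operatorname{rank}(C\ D)=n$). $\Phi(x,\lambda)=(\Phi_1,\dots,\Phi_n)$ is the fundamental matrix of $-iB^{-1}(y'+Qy)=\lambda y$ with $\Phi(0,\lambda)=I_n$; $\Phi^0(x,\lambda)=\operatorname{diag}(e^{i\lambda\rho_k(x)})$ with columns $\Phi^0_k$. $A(\lambda)=C+D\Phi(\ell,\lambda)$, $A_0(\lambda)=C+D\Phi^0(\ell,\lambda)$,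 with adjugate matrices $(A_{jk}(\lambda))$, $(A^0_{jk}(\lambda))$; $\Delta_Q=\det A$, $\Delta_0=\det A_0$. $Y_p(x,\lambda)=\sum_{k=1}^nA_{kp}(\lambda)\Phi_k(x,\lambda)$ and $Y^0_p(x,\lambda)=\sum_kA^0_{kp}(\lambda)\Phi_k^0(x,\lambda)$. With $P_+=\operatorname{diag}(p_k^+)$, $p_k^+=1$ iff $b_k>0$, $P_-=I-P_+$: regular means $\det(CP_-+DP_+)\ne0\ne\det(CP_++DP_-)$; strictly regular means regular and the zeros of $\Delta_0$ (counting multiplicity) are asymptotically separated, i.e. for some $m_0$, $\delta>0$: $|\lambda^0_j-\lambda^0_k|>2\delta$ for $j\ne k$, $|j|,|k|>m_0$. A system of root vectors is a sequence obtained by taking, for each eigenvalue, a basis of its root subspace; it is normalized if all vectors have norm $1$ in $\mathfrak H$. *)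

theory Defs
  imports "HOL-Complex_Analysis.Complex_Analysis" "Jordan_Normal_Form.Determinant" "Jordan_Normal_Form.DL_Rank"
begin

text \<open>Conventions. Indices are 0-based: the paper's index k in 1..n is k-1 here, k < n.
  Vector functions on [0,l] are functions real => nat => complex (component k at point x is y x k);
  matrix functions are real => nat => nat => complex.
  beta k is the weight beta_(k+1); Q j k is the entry Q_(j+1)(k+1).\<close>

definition rho :: "(nat \<Rightarrow> real \<Rightarrow> real) \<Rightarrow> nat \<Rightarrow> real \<Rightarrow> real" where
  "rho \<beta> k x = integral {0..x} (\<beta> k)"

definition cnorm :: "nat \<Rightarrow> (nat \<Rightarrow> complex) \<Rightarrow> real" where
  "cnorm n v = sqrt (\<Sum>j<n. (cmod (v j))\<^sup>2)"

definition H_norm :: "nat \<Rightarrow> real \<Rightarrow> (nat \<Rightarrow> real \<Rightarrow> real) \<Rightarrow> (real \<Rightarrow> nat \<Rightarrow> complex) \<Rightarrow> real" where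
  "H_norm n l \<beta> f = sqrt (\<Sum>k<n. integral {0..l} (\<lambda>x. \<bar>\<beta> k x\<bar> * (cmod (f x k))\<^sup>2))"

definition in_H :: "nat \<Rightarrow> real \<Rightarrow> (nat \<Rightarrow> real \<Rightarrow> real) \<Rightarrow> (real \<Rightarrow> nat \<Rightarrow> complex) \<Rightarrow> bool" where
  "in_H n l \<beta> f \<longleftrightarrow> (\<forall>k<n. (\<lambda>x. f x k) \<in> borel_measurable (lebesgue_on {0..l}) \<and>
      (\<lambda>x. \<bar>\<beta> k x\<bar> * (cmod (f x k))\<^sup>2) integrable_on {0..l})"

definition H_eq :: "nat \<Rightarrow> real \<Rightarrow> (real \<Rightarrow> nat \<Rightarrow> complex) \<Rightarrow> (real \<Rightarrow> nat \<Rightarrow> complex) \<Rightarrow> bool" where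
  "H_eq n l f g \<longleftrightarrow> (AE x in lebesgue_on {0..l}. \<forall>k<n. f x k = g x k)"

text \<open>y is absolutely continuous on [0,l] and solves  -i B^{-1} (y' + Q y) = g  a.e., i.e.
  y' = i B g - Q y a.e.; written in the equivalent integrated form.\<close>
definition ac_solves :: "nat \<Rightarrow> real \<Rightarrow> (nat \<Rightarrow> real \<Rightarrow> real) \<Rightarrow> (nat \<Rightarrow> nat \<Rightarrow> real \<Rightarrow> complex)
     \<Rightarrow> (real \<Rightarrow> nat \<Rightarrow> complex) \<Rightarrow> (real \<Rightarrow> nat \<Rightarrow> complex) \<Rightarrow> bool" where
  "ac_solves n l \<beta> Q y g \<longleftrightarrow>
     (\<forall>j<n. continuous_on {0..l} (\<lambda>x. y x j)) \<and>
     (\<forall>j<n. \<forall>x\<in>{0..l}.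
        ((\<lambda>t. \<i> * complex_of_real (\<beta> j t) * g t j - (\<Sum>k<n. Q j k t * y t k)) has_integral (y x j - y 0 j)) {0..x})"

text \<open>Fundamental matrix Phi(x,lambda) of  -i B^{-1}(y' + Q y) = lambda y  with Phi(0,lambda) = I;
  entry (j,k) at x is Phi x j k; it is normalised to 0 outside [0,l] and outside the index range,
  so that it is uniquely determined.\<close>
definition is_fund :: "nat \<Rightarrow> real \<Rightarrow> (nat \<Rightarrow> real \<Rightarrow> real) \<Rightarrow> (nat \<Rightarrow> nat \<Rightarrow> real \<Rightarrow> complex)
     \<Rightarrow> complex \<Rightarrow> (real \<Rightarrow> nat \<Rightarrow> nat \<Rightarrow> complex) \<Rightarrow> bool" where
  "is_fund n l \<beta> Q \<mu> \<Phi> \<longleftrightarrow>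
     (\<forall>k<n. ac_solves n l \<beta> Q (\<lambda>x j. \<Phi> x j k) (\<lambda>x j. \<mu> * \<Phi> x j k)) \<and>
     (\<forall>j<n. \<forall>k<n. \<Phi> 0 j k = (if j = k then 1 else 0)) \<and>
     (\<forall>x j k. (x \<notin> {0..l} \<or> j \<ge> n \<or> k \<ge> n) \<longrightarrow> \<Phi> x j k = 0)"

definition fund :: "nat \<Rightarrow> real \<Rightarrow> (nat \<Rightarrow> real \<Rightarrow> real) \<Rightarrow> (nat \<Rightarrow> nat \<Rightarrow> real \<Rightarrow> complex)
     \<Rightarrow> complex \<Rightarrow> real \<Rightarrow> nat \<Rightarrow> nat \<Rightarrow> complex" where
  "fund n l \<beta> Q \<mu> = (THE \<Phi>. is_fund n l \<beta> Q \<mu> \<Phi>)"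

definition fund0 :: "(nat \<Rightarrow> real \<Rightarrow> real) \<Rightarrow> complex \<Rightarrow> real \<Rightarrow> nat \<Rightarrow> nat \<Rightarrow> complex" where
  "fund0 \<beta> \<mu> x j k = (if j = k then exp (\<i> * \<mu> * complex_of_real (rho \<beta> k x)) else 0)"

definition Amat :: "nat \<Rightarrow> real \<Rightarrow> (nat \<Rightarrow> real \<Rightarrow> real) \<Rightarrow> (nat \<Rightarrow> nat \<Rightarrow> real \<Rightarrow> complex)
     \<Rightarrow> complex Matrix.mat \<Rightarrow> complex Matrix.mat \<Rightarrow> complex \<Rightarrow> complex Matrix.mat" where
  "Amat n l \<beta> Q C D \<mu> = C + D * Matrix.mat n n (\<lambda>(j,k). fund n l \<beta> Q \<mu> l j k)"

definition A0mat :: "nat \<Rightarrow> real \<Rightarrow> (nat \<Rightarrow> real \<Rightarrow> real)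
     \<Rightarrow> complex Matrix.mat \<Rightarrow> complex Matrix.mat \<Rightarrow> complex \<Rightarrow> complex Matrix.mat" where
  "A0mat n l \<beta> C D \<mu> = C + D * Matrix.mat n n (\<lambda>(j,k). fund0 \<beta> \<mu> l j k)"

definition DeltaQ where "DeltaQ n l \<beta> Q C D \<mu> = Determinant.det (Amat n l \<beta> Q C D \<mu>)"
definition Delta0 where "Delta0 n l \<beta> C D \<mu> = Determinant.det (A0mat n l \<beta> C D \<mu>)"

definition Yvec :: "nat \<Rightarrow> real \<Rightarrow> (nat \<Rightarrow> real \<Rightarrow> real) \<Rightarrow> (nat \<Rightarrow> nat \<Rightarrow> real \<Rightarrow> complex)
     \<Rightarrow> complex Matrix.mat \<Rightarrow> complex Matrix.mat \<Rightarrow> nat \<Rightarrow> complex \<Rightarrow> real \<Rightarrow> nat \<Rightarrow> complex" where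
  "Yvec n l \<beta> Q C D p \<mu> x j = (\<Sum>k<n. adj_mat (Amat n l \<beta> Q C D \<mu>) $$ (k,p) * fund n l \<beta> Q \<mu> x j k)"

definition Y0vec :: "nat \<Rightarrow> real \<Rightarrow> (nat \<Rightarrow> real \<Rightarrow> real)
     \<Rightarrow> complex Matrix.mat \<Rightarrow> complex Matrix.mat \<Rightarrow> nat \<Rightarrow> complex \<Rightarrow> real \<Rightarrow> nat \<Rightarrow> complex" where
  "Y0vec n l \<beta> C D p \<mu> x j = (\<Sum>k<n. adj_mat (A0mat n l \<beta> C D \<mu>) $$ (k,p) * fund0 \<beta> \<mu> x j k)"

definition Pplus :: "nat \<Rightarrow> real \<Rightarrow> (nat \<Rightarrow> real \<Rightarrow> real) \<Rightarrow> complex Matrix.mat" where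
  "Pplus n l \<beta> = Matrix.mat n n (\<lambda>(j,k). if j = k \<and> rho \<beta> k l > 0 then 1 else 0)"

definition Pminus :: "nat \<Rightarrow> real \<Rightarrow> (nat \<Rightarrow> real \<Rightarrow> real) \<Rightarrow> complex Matrix.mat" where
  "Pminus n l \<beta> = 1\<^sub>m n - Pplus n l \<beta>"

definition regular_bc :: "nat \<Rightarrow> real \<Rightarrow> (nat \<Rightarrow> real \<Rightarrow> real) \<Rightarrow> complex Matrix.mat \<Rightarrow> complex Matrix.mat \<Rightarrow> bool" where
  "regular_bc n l \<beta> C D \<longleftrightarrow>
     Determinant.det (C * Pminus n l \<beta> + D * Pplus n l \<beta>) \<noteq> 0 \<and>
     Determinant.det (C * Pplus n l \<beta> + D * Pminus n l \<beta>) \<noteq> 0"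

definition enumerates_zeros :: "(complex \<Rightarrow> complex) \<Rightarrow> (int \<Rightarrow> complex) \<Rightarrow> bool" where
  "enumerates_zeros F lam \<longleftrightarrow>
     (\<forall>z. finite {m. lam m = z} \<and>
          card {m. lam m = z} = (if F z = 0 then nat (zorder F z) else 0))"

definition strictly_regular_bc :: "nat \<Rightarrow> real \<Rightarrow> (nat \<Rightarrow> real \<Rightarrow> real) \<Rightarrow> complex Matrix.mat \<Rightarrow> complex Matrix.mat
     \<Rightarrow> (int \<Rightarrow> complex) \<Rightarrow> bool" where
  "strictly_regular_bc n l \<beta> C D lam0 \<longleftrightarrow> regular_bc n l \<beta> C D \<and>
     (\<exists>m0 \<delta>. \<delta> > 0 \<and> (\<forall>j k. j \<noteq> k \<and> \<bar>j\<bar> > m0 \<and> \<bar>k\<bar> > m0 \<longrightarrow> cmod (lam0 j - lam0 k) > 2 * \<delta>))"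

text \<open>The operator L_U(Q): y is in its domain and L_U(Q) y = g (as an element of H).\<close>
definition op_LU :: "nat \<Rightarrow> real \<Rightarrow> (nat \<Rightarrow> real \<Rightarrow> real) \<Rightarrow> (nat \<Rightarrow> nat \<Rightarrow> real \<Rightarrow> complex)
     \<Rightarrow> complex Matrix.mat \<Rightarrow> complex Matrix.mat \<Rightarrow> (real \<Rightarrow> nat \<Rightarrow> complex) \<Rightarrow> (real \<Rightarrow> nat \<Rightarrow> complex) \<Rightarrow> bool" where
  "op_LU n l \<beta> Q C D y g \<longleftrightarrow> in_H n l \<beta> g \<and> ac_solves n l \<beta> Q y g \<and>
     (\<forall>i<n. (\<Sum>k<n. C $$ (i,k) * y 0 k + D $$ (i,k) * y l k) = 0)"

text \<open>Root vectors of L_U(Q) for mu: y in dom((L-mu)^k) and (L-mu)^k y = 0 for some k >= 1.\<close>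
definition root_vec :: "nat \<Rightarrow> real \<Rightarrow> (nat \<Rightarrow> real \<Rightarrow> real) \<Rightarrow> (nat \<Rightarrow> nat \<Rightarrow> real \<Rightarrow> complex)
     \<Rightarrow> complex Matrix.mat \<Rightarrow> complex Matrix.mat \<Rightarrow> complex \<Rightarrow> (real \<Rightarrow> nat \<Rightarrow> complex) \<Rightarrow> bool" where
  "root_vec n l \<beta> Q C D \<mu> y \<longleftrightarrow>
     (\<exists>k::nat. k \<ge> 1 \<and> (\<exists>ys::nat \<Rightarrow> real \<Rightarrow> nat \<Rightarrow> complex. ys 0 = y \<and>
        (\<forall>i<k. \<exists>g. op_LU n l \<beta> Q C D (ys i) g \<and>
                  H_eq n l (ys (Suc i)) (\<lambda>x j. g x j - \<mu> * ys i x j)) \<and>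
        H_eq n l (ys k) (\<lambda>x j. 0)))"

text \<open>f (indexed by Z, f m corresponding to lam m) is a normalized system of root vectors of L_U(Q):
  for every mu the vectors f m with lam m = mu form a basis of the root subspace of mu, and every f m
  has norm 1 in H.  Root vectors lie in the domain, so they are continuous on [0,l]; since the weights
  are a.e. positive, equality in H of such functions is equality on [0,l].\<close>
definition normalized_root_system :: "nat \<Rightarrow> real \<Rightarrow> (nat \<Rightarrow> real \<Rightarrow> real) \<Rightarrow> (nat \<Rightarrow> nat \<Rightarrow> real \<Rightarrow> complex)
     \<Rightarrow> complex Matrix.mat \<Rightarrow> complex Matrix.mat \<Rightarrow> (int \<Rightarrow> complex) \<Rightarrow> (int \<Rightarrow> real \<Rightarrow> nat \<Rightarrow> complex) \<Rightarrow> bool" where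
  "normalized_root_system n l \<beta> Q C D lam f \<longleftrightarrow>
     (\<forall>m. H_norm n l \<beta> (f m) = 1) \<and>
     (\<forall>\<mu>. finite {m. lam m = \<mu>} \<and>
        (\<forall>m\<in>{m. lam m = \<mu>}. root_vec n l \<beta> Q C D \<mu> (f m)) \<and>
        (\<forall>c::int \<Rightarrow> complex. (\<forall>x\<in>{0..l}. \<forall>j<n. (\<Sum>m\<in>{m. lam m = \<mu>}. c m * f m x j) = 0)
              \<longrightarrow> (\<forall>m\<in>{m. lam m = \<mu>}. c m = 0)) \<and>
        (\<forall>y. root_vec n l \<beta> Q C D \<mu> y \<longrightarrow>
              (\<exists>c::int \<Rightarrow> complex. \<forall>x\<in>{0..l}. \<forall>j<n. y x j = (\<Sum>m\<in>{m. lam m = \<mu>}. c m * f m x j))))"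

end

theory Submission
  imports Defs
begin

text \<open>
  Writing the entries of the fundamental matrix as \<open>exp (i \<lambda> \<rho>\<^sub>j)\<close> times a slowly varying factor turns the
  equation into a Volterra system with kernel \<open>- Q\<^sub>j\<^sub>k exp (- i \<lambda> (\<rho>\<^sub>j - \<rho>\<^sub>k))\<close>, which has, by separation of the
  weights and the Riemann--Lebesgue lemma, a primitive tending uniformly to 0 in horizontal strips. Solutions
  of such a system are equicontinuous, hence the factor tends to the identity. By regularity the zeros
  of \<open>\<Delta>\<^sub>0\<close> lie in a strip and tend to infinity; as the adjugate is polynomial in the entries, (i) follows.

  For (ii), the Taylor coefficients of the fundamental matrix in \<open>\<lambda>\<close> identify the root subspace at \<open>\<mu>\<close> with
  the polar parts \<open>c\<close> for which \<open>A c\<close> is regular at \<open>\<mu>\<close>, a space whose dimension is the order of \<open>det A\<close> (induction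
  on this order, splitting off one factor by a column operation); so normalized root systems exist.
  Strict regularity makes almost all zeros simple. By normal families and Hurwitz' theorem \<open>\<Delta>\<^sub>0'\<close> is bounded
  away from 0 at them, so by Jacobi's formula some column of the adjugate of \<open>A\<^sub>0\<close>, and with it the norm of some
  \<open>Y\<^sup>0\<^sub>p\<close>, is bounded below; normalizing \<open>Y\<^sub>p\<close> and \<open>Y\<^sup>0\<^sub>p\<close> then preserves the convergence in (i).
\<close>

section \<open>Calculus for indefinite integrals\<close>

text \<open>The data are merely integrable, so differential equations are read as integral
  equations, and the product and chain rules have to be proved for indefinite integrals: the defect
  of such a rule has increments bounded by the square of those of a continuous monotone function,
  which forces it to be constant. Horizontal strips enter because only there are the exponentials
  \<open>exp (- \<i> * \<mu> * (rho \<beta> j - rho \<beta> k))\<close> bounded uniformly in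
  \<open>\<mu>\<close>. Between equal weights the kernel would not oscillate, whence the assumption
  that \<open>Q\<close> vanishes there. Root subspaces must be described exactly at every eigenvalue
  and not only asymptotically: finitely many zeros may be multiple even under strict regularity, and
  the enumeration counts orders of zeros while a root system counts dimensions. That these numbers
  agree is the algebraic core of (ii). Normalization divides by norms, hence the lower bound on a
  column of the adjugate; the column may vary with the index, but the same one serves both
  operators.\<close>

lemma quad_increment_const:
  fixes H :: "real \<Rightarrow> 'a::real_normed_vector" and G :: "real \<Rightarrow> real"
  assumes "a \<le> b" and cont: "continuous_on {a..b} G"
    and mono: "\<And>x y. a \<le> x \<Longrightarrow> x \<le> y \<Longrightarrow> y \<le> b \<Longrightarrow> G x \<le> G y"
    and quad: "\<And>x y. a \<le> x \<Longrightarrow> x \<le> y \<Longrightarrow> y \<le> b \<Longrightarrow> norm (H y - H x) \<le> C * (G y - G x)\<^sup>2"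
  shows "H b = H a"
proof -
  have *: "norm (H y - H x) \<le> C / 2 ^ k * (G y - G x)\<^sup>2"
    if "a \<le> x" "x \<le> y" "y \<le> b" for k x y
    using that
  proof (induction k arbitrary: x y)
    case 0
    then show ?case using quad by simp
  next
    case (Suc k)
    \<comment> \<open>The increment of \<open>G\<close> is halved, not the interval. Each half
      contributes a quarter of the square, so every round gains a factor 2, and iteration squeezes
      the increment of \<open>H\<close> to 0.\<close>
    have "\<exists>m. x \<le> m \<and> m \<le> y \<and> G m = (G x + G y) / 2"
      using mono[of x y] Suc.prems
      by (intro IVT') (auto intro: continuous_on_subset[OF cont])
    then obtain m where m: "x \<le> m" "m \<le> y" "G m = (G x + G y) / 2" by blast
    have "norm (H y - H x) \<le> norm (H y - H m) + norm (H m - H x)"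
      using norm_triangle_ineq[of "H y - H m" "H m - H x"] by simp
    also have "\<dots> \<le> C / 2 ^ k * (G y - G m)\<^sup>2 + C / 2 ^ k * (G m - G x)\<^sup>2"
      by (rule add_mono; rule Suc.IH) (use Suc.prems m in auto)
    also have "\<dots> = C / 2 ^ Suc k * (G y - G x)\<^sup>2"
      unfolding m by (simp add: field_simps power2_eq_square)
    finally show ?case .
  qed
  have "(\<lambda>k. C * (G b - G a)\<^sup>2 * (1 / 2) ^ k) \<longlonglongrightarrow> C * (G b - G a)\<^sup>2 * 0"
    by (intro tendsto_intros LIMSEQ_realpow_zero) auto
  moreover have "norm (H b - H a) \<le> C * (G b - G a)\<^sup>2 * (1 / 2) ^ k" for k
    using *[of a b k] \<open>a \<le> b\<close> by (simp add: field_simps power_divide)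
  ultimately have "norm (H b - H a) \<le> C * (G b - G a)\<^sup>2 * 0"
    by (intro LIMSEQ_le_const) auto
  then show ?thesis by simp
qed

section \<open>Elementary estimates for indefinite integrals\<close>

lemma absint_mult_cont:
  fixes u V :: "real \<Rightarrow> 'a::{euclidean_space,real_normed_field}"
  assumes u: "u absolutely_integrable_on {a..b}" and V: "continuous_on {a..b} V"
  shows "(\<lambda>t. u t * V t) absolutely_integrable_on {a..b}"
proof -
  have bil: "bilinear ((*) :: 'a \<Rightarrow> _)"
    by (simp add: bilinear_conv_bounded_bilinear bounded_bilinear_mult)
  have "(\<lambda>t. V t * u t) absolutely_integrable_on {a..b}"
    by (rule absolutely_integrable_bounded_measurable_product[OF bil _ _ _ u])
       (use V in \<open>auto intro!: continuous_imp_measurable_on_sets_lebesgue compact_imp_bounded compact_continuous_image\<close>)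
  then show ?thesis by (simp add: mult.commute)
qed

lemma absint_norm:
  fixes u :: "real \<Rightarrow> 'a::euclidean_space"
  assumes "u absolutely_integrable_on S"
  shows "(\<lambda>t. norm (u t)) absolutely_integrable_on S"
  using absolutely_integrable_norm[OF assms] by (simp add: o_def)

lemma absint_subinterval:
  fixes u :: "real \<Rightarrow> 'a::euclidean_space"
  assumes "u absolutely_integrable_on {a..b}" "a \<le> x" "y \<le> b"
  shows "u absolutely_integrable_on {x..y}"
  using assms by (meson absolutely_integrable_on_subinterval atLeastatMost_subset_iff interval_cbox)

lemma indef_cont:
  fixes u :: "real \<Rightarrow> 'a::euclidean_space"
  assumes "u absolutely_integrable_on {a..b}"
  shows "continuous_on {a..b} (\<lambda>x. integral {a..x} u)"
  using assms by (intro indefinite_integral_continuous_1) (simp add: absolutely_integrable_on_def)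

lemma integral_diff_interval:
  fixes u :: "real \<Rightarrow> 'a::euclidean_space"
  assumes "u absolutely_integrable_on {a..b}" "a \<le> x" "x \<le> y" "y \<le> b"
  shows "integral {a..y} u - integral {a..x} u = integral {x..y} u"
proof -
  have "u integrable_on {a..y}"
    using absint_subinterval[OF assms(1), of a y] assms by (auto simp: absolutely_integrable_on_def)
  then show ?thesis
    using Henstock_Kurzweil_Integration.integral_combine[of a x y u] assms by (simp add: algebra_simps)
qed

lemma integral_norm_le:
  fixes u :: "real \<Rightarrow> 'a::euclidean_space"
  assumes "u absolutely_integrable_on {a..b}"
  shows "norm (integral {a..b} u) \<le> integral {a..b} (\<lambda>t. norm (u t))"
  using assms by (intro integral_norm_bound_integral) (auto simp: absolutely_integrable_on_def)

lemma integral_norm_mono: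
  fixes u :: "real \<Rightarrow> 'a::euclidean_space"
  assumes "u absolutely_integrable_on {a..b}" "a \<le> x" "x \<le> y" "y \<le> b"
  shows "integral {a..x} (\<lambda>t. norm (u t)) \<le> integral {a..y} (\<lambda>t. norm (u t))"
proof -
  have "(\<lambda>t. norm (u t)) absolutely_integrable_on {a..b}"
    using assms by (simp add: absint_norm)
  from integral_diff_interval[OF this assms(2-4)]
  have "integral {a..y} (\<lambda>t. norm (u t)) - integral {a..x} (\<lambda>t. norm (u t)) = integral {x..y} (\<lambda>t. norm (u t))" .
  moreover have "0 \<le> integral {x..y} (\<lambda>t. norm (u t))"
    by (rule Henstock_Kurzweil_Integration.integral_nonneg)
       (use absint_subinterval[OF assms(1,2,4)] in \<open>auto simp: absolutely_integrable_on_def\<close>)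
  ultimately show ?thesis by linarith
qed

lemma norm_diff_triple: "norm (x - y - z) \<le> norm x + norm y + norm (z :: 'a::real_normed_vector)"
  using norm_triangle_ineq4[of "x - y" z] norm_triangle_ineq4[of x y] by linarith

lemma integral_product_bound:
  fixes u W :: "real \<Rightarrow> 'a::{euclidean_space,real_normed_field}"
  assumes u: "u absolutely_integrable_on {a..b}" and W: "continuous_on {a..b} W"
    and B: "\<And>t. t \<in> {a..b} \<Longrightarrow> norm (W t) \<le> B" "B \<ge> 0"
  shows "norm (integral {a..b} (\<lambda>t. u t * W t)) \<le> B * integral {a..b} (\<lambda>t. norm (u t))"
proof -
  have "norm (integral {a..b} (\<lambda>t. u t * W t)) \<le> integral {a..b} (\<lambda>t. B * norm (u t))"
  proof (rule integral_norm_bound_integral)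
    show "(\<lambda>t. u t * W t) integrable_on {a..b}"
      using absint_mult_cont[OF u W] by (simp add: absolutely_integrable_on_def)
    show "(\<lambda>t. B * norm (u t)) integrable_on {a..b}"
      using u by (intro integrable_on_mult_right) (auto simp: absolutely_integrable_on_def)
    show "norm (u t * W t) \<le> B * norm (u t)" if "t \<in> {a..b}" for t
      using mult_left_mono[OF B(1)[OF that], of "norm (u t)"] by (simp add: norm_mult mult.commute)
  qed
  then show ?thesis by simp
qed

text \<open>The defect \<open>H\<close> of the product rule has over \<open>{x..y}\<close> the
  increment (U y - U x) (V y - V x) minus the integrals of u (V - V x) and v (U - U x). Each of the
  three is at most the product of the integrals of |u| and |v|, hence quadratic in the increment of
  \<open>G\<close>, and \<open>quad_increment_const\<close> applies.\<close>

lemma ac_product: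
  fixes u v U V :: "real \<Rightarrow> 'a::{euclidean_space,real_normed_field}"
  assumes ab: "a \<le> b" and u: "u absolutely_integrable_on {a..b}" and v: "v absolutely_integrable_on {a..b}"
    and U: "\<And>x. x \<in> {a..b} \<Longrightarrow> U x = U a + integral {a..x} u"
    and V: "\<And>x. x \<in> {a..b} \<Longrightarrow> V x = V a + integral {a..x} v"
  shows "((\<lambda>t. u t * V t + v t * U t) has_integral U b * V b - U a * V a) {a..b}"
proof -
  have cU: "continuous_on {a..b} U"
    by (subst continuous_on_cong[OF refl U]) (auto intro!: continuous_intros indef_cont u)
  have cV: "continuous_on {a..b} V"
    by (subst continuous_on_cong[OF refl V]) (auto intro!: continuous_intros indef_cont v)
  define g where "g = (\<lambda>t. norm (u t) + norm (v t))"
  define G where "G = (\<lambda>x. integral {a..x} g)"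
  have nu: "(\<lambda>t. norm (u t)) absolutely_integrable_on {a..b}" and nv: "(\<lambda>t. norm (v t)) absolutely_integrable_on {a..b}"
    using u v by (auto intro: absint_norm)
  have g: "g absolutely_integrable_on {a..b}"
    unfolding g_def by (intro set_integral_add nu nv)
  have w: "(\<lambda>t. u t * V t + v t * U t) absolutely_integrable_on {a..b}"
    by (intro set_integral_add absint_mult_cont u v cU cV)
  define H where "H = (\<lambda>x. U x * V x - integral {a..x} (\<lambda>t. u t * V t + v t * U t))"
  have dG: "G y - G x = integral {x..y} (\<lambda>t. norm (u t)) + integral {x..y} (\<lambda>t. norm (v t))"
    and pos: "0 \<le> integral {x..y} (\<lambda>t. norm (u t))" "0 \<le> integral {x..y} (\<lambda>t. norm (v t))"
    if xy: "a \<le> x" "x \<le> y" "y \<le> b" for x y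
  proof -
    have "(\<lambda>t. norm (u t)) integrable_on {x..y}" "(\<lambda>t. norm (v t)) integrable_on {x..y}"
      using absint_subinterval[OF nu] absint_subinterval[OF nv] xy by (auto simp: absolutely_integrable_on_def)
    moreover from this show "0 \<le> integral {x..y} (\<lambda>t. norm (u t))" "0 \<le> integral {x..y} (\<lambda>t. norm (v t))"
      by (auto intro!: Henstock_Kurzweil_Integration.integral_nonneg)
    ultimately show "G y - G x = integral {x..y} (\<lambda>t. norm (u t)) + integral {x..y} (\<lambda>t. norm (v t))"
      unfolding G_def integral_diff_interval[OF g xy] unfolding g_def
      by (simp add: Henstock_Kurzweil_Integration.integral_add)
  qed
  have dU: "norm (U y - U x) \<le> integral {x..y} (\<lambda>t. norm (u t))"
    and dV: "norm (V y - V x) \<le> integral {x..y} (\<lambda>t. norm (v t))"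
    if xy: "a \<le> x" "x \<le> y" "y \<le> b" for x y
  proof -
    have "U y - U x = integral {x..y} u" "V y - V x = integral {x..y} v"
      using U[of x] U[of y] V[of x] V[of y] integral_diff_interval[OF u xy] integral_diff_interval[OF v xy] xy by auto
    then show "norm (U y - U x) \<le> integral {x..y} (\<lambda>t. norm (u t))" "norm (V y - V x) \<le> integral {x..y} (\<lambda>t. norm (v t))"
      using integral_norm_le[OF absint_subinterval[OF u]] integral_norm_le[OF absint_subinterval[OF v]] xy by auto
  qed
  have "H b = H a"
  proof (rule quad_increment_const[OF ab])
    show "continuous_on {a..b} G" unfolding G_def by (rule indef_cont[OF g])
    show "G x \<le> G y" if "a \<le> x" "x \<le> y" "y \<le> b" for x y
      using dG[OF that] pos[OF that] by linarith
    show "norm (H y - H x) \<le> 3 * (G y - G x)\<^sup>2" if xy: "a \<le> x" "x \<le> y" "y \<le> b" for x y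
    proof -
      define I J where "I = integral {x..y} (\<lambda>t. norm (u t))" and "J = integral {x..y} (\<lambda>t. norm (v t))"
      have IJ: "0 \<le> I" "0 \<le> J" using pos[OF xy] by (auto simp: I_def J_def)
      have u': "u absolutely_integrable_on {x..y}" and v': "v absolutely_integrable_on {x..y}"
        using absint_subinterval u v xy by blast+
      have cU': "continuous_on {x..y} U" and cV': "continuous_on {x..y} V"
        using continuous_on_subset[OF cU] continuous_on_subset[OF cV] xy by auto
      have ii: "(\<lambda>t. u t * V t) integrable_on {x..y}" "(\<lambda>t. v t * U t) integrable_on {x..y}"
        "(\<lambda>t. u t * V x) integrable_on {x..y}" "(\<lambda>t. v t * U x) integrable_on {x..y}"
        using absint_mult_cont[OF u' cV'] absint_mult_cont[OF v' cU'] 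
          absint_mult_cont[OF u' continuous_on_const] absint_mult_cont[OF v' continuous_on_const]
        by (auto simp: absolutely_integrable_on_def)
      have iu: "U y - U x = integral {x..y} u" and iv: "V y - V x = integral {x..y} v"
        using U[of x] U[of y] V[of x] V[of y] integral_diff_interval[OF u xy] integral_diff_interval[OF v xy] xy by auto
      have e1: "integral {x..y} (\<lambda>t. u t * (V t - V x)) = integral {x..y} (\<lambda>t. u t * V t) - (U y - U x) * V x"
        using ii by (simp add: right_diff_distrib Henstock_Kurzweil_Integration.integral_diff iu)
      have e2: "integral {x..y} (\<lambda>t. v t * (U t - U x)) = integral {x..y} (\<lambda>t. v t * U t) - (V y - V x) * U x"
        using ii by (simp add: right_diff_distrib Henstock_Kurzweil_Integration.integral_diff iv)
      have "H y - H x = U y * V y - U x * V x - integral {x..y} (\<lambda>t. u t * V t + v t * U t)"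
        unfolding H_def using integral_diff_interval[OF w xy] by (simp add: algebra_simps)
      also have "\<dots> = (U y - U x) * (V y - V x) - integral {x..y} (\<lambda>t. u t * (V t - V x)) - integral {x..y} (\<lambda>t. v t * (U t - U x))"
        unfolding e1 e2 using ii by (simp add: Henstock_Kurzweil_Integration.integral_add algebra_simps)
      finally have eq: "H y - H x = \<dots>" .
      have b1: "norm ((U y - U x) * (V y - V x)) \<le> I * J"
        unfolding norm_mult I_def J_def using dU[OF xy] dV[OF xy] pos[OF xy] by (intro mult_mono) auto
      have mon: "integral {x..t} (\<lambda>t. norm (u t)) \<le> I" "integral {x..t} (\<lambda>t. norm (v t)) \<le> J" if "t \<in> {x..y}" for t
        unfolding I_def J_def using integral_norm_mono[OF u'] integral_norm_mono[OF v'] that by auto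
      have b2: "norm (integral {x..y} (\<lambda>t. u t * (V t - V x))) \<le> J * I"
        unfolding I_def
      proof (rule integral_product_bound[OF u'])
        fix t assume t: "t \<in> {x..y}"
        then have "norm (V t - V x) \<le> integral {x..t} (\<lambda>t. norm (v t))" using dV[of x t] xy by auto
        then show "norm (V t - V x) \<le> J" using mon[OF t] by linarith
      qed (auto intro!: continuous_intros cV' IJ)
      have b3: "norm (integral {x..y} (\<lambda>t. v t * (U t - U x))) \<le> I * J"
        unfolding J_def
      proof (rule integral_product_bound[OF v'])
        fix t assume t: "t \<in> {x..y}"
        then have "norm (U t - U x) \<le> integral {x..t} (\<lambda>t. norm (u t))" using dU[of x t] xy by auto
        then show "norm (U t - U x) \<le> I" using mon[OF t] by linarith
      qed (auto intro!: continuous_intros cU' IJ)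
      have "norm (H y - H x) \<le> 3 * (I * J)"
        unfolding eq by (intro order_trans[OF norm_diff_triple]) (use b1 b2 b3 in \<open>simp add: algebra_simps\<close>)
      also have "\<dots> \<le> 3 * (I + J)\<^sup>2"
        using IJ by (simp add: power2_eq_square algebra_simps)
      finally show ?thesis unfolding dG[OF xy] I_def J_def .
    qed
  qed
  then have "integral {a..b} (\<lambda>t. u t * V t + v t * U t) = U b * V b - U a * V a"
    by (simp add: H_def algebra_simps)
  then show ?thesis
    using w by (metis absolutely_integrable_on_def integrable_integral)
qed

text \<open>The increments of \<open>E\<close> minus the integral of \<open>u * E\<close> contain
  only the second-order Taylor remainder of exp and an integral of \<open>u\<close> against an
  increment of \<open>E\<close>; both are quadratic in the variation of \<open>U\<close>. The
  constant \<open>M\<close> bounds exp on the disc of radius \<open>G b\<close>, where all values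
  and increments of \<open>U\<close> lie.\<close>

lemma ac_exp:
  fixes u :: "real \<Rightarrow> complex"
  assumes ab: "a \<le> b" and u: "u absolutely_integrable_on {a..b}"
  defines "U \<equiv> \<lambda>x. integral {a..x} u"
  shows "((\<lambda>t. u t * exp (U t)) has_integral exp (U b) - 1) {a..b}"
proof -
  have cU: "continuous_on {a..b} U" unfolding U_def by (rule indef_cont[OF u])
  define E where "E = (\<lambda>x. exp (U x))"
  have cE: "continuous_on {a..b} E" unfolding E_def by (intro continuous_intros cU)
  define G where "G = (\<lambda>x. integral {a..x} (\<lambda>t. norm (u t)))"
  have nu: "(\<lambda>t. norm (u t)) absolutely_integrable_on {a..b}" using u by (auto intro: absint_norm)
  have w: "(\<lambda>t. u t * E t) absolutely_integrable_on {a..b}"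
    by (intro absint_mult_cont u cE)
  define H where "H = (\<lambda>x. E x - integral {a..x} (\<lambda>t. u t * E t))"
  have monoG: "G x \<le> G y" if "a \<le> x" "x \<le> y" "y \<le> b" for x y
    unfolding G_def using integral_norm_mono[OF u that] .
  have dU: "norm (U y - U x) \<le> G y - G x" if xy: "a \<le> x" "x \<le> y" "y \<le> b" for x y
    unfolding U_def G_def integral_diff_interval[OF u xy] integral_diff_interval[OF nu xy]
    using xy by (intro integral_norm_le absint_subinterval[OF u]) auto
  have Gb: "0 \<le> G x" "G x \<le> G b" if "x \<in> {a..b}" for x
    using monoG[of a x] monoG[of x b] that by (auto simp: G_def)
  define M where "M = exp (G b)"
  have M1: "M \<ge> 1" unfolding M_def using Gb[of b] ab by simp
  have EM: "norm (E x) \<le> M" if "x \<in> {a..b}" for x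
  proof -
    have "norm (U x) \<le> G b" using dU[of a x] Gb[OF that] that by (auto simp: U_def G_def)
    then show ?thesis unfolding E_def M_def using complex_Re_le_cmod[of "U x"] by (simp del: complex_Re_le_cmod)
  qed
  have T: "norm (exp z - 1) \<le> M * norm z" "norm (exp z - 1 - z) \<le> M * (norm z)\<^sup>2"
    if "norm z \<le> G b" for z :: complex
  proof -
    have "exp \<bar>Re z\<bar> \<le> M" unfolding M_def using abs_Re_le_cmod[of z] that by simp
    then have "exp \<bar>Re z\<bar> * norm z ^ Suc k / fact k \<le> M * norm z ^ Suc k / 1" for k :: nat
      by (intro frac_le mult_right_mono mult_nonneg_nonneg) (use M1 in auto)
    from order_trans[OF Taylor_exp[of z 0] this[of 0]] order_trans[OF Taylor_exp[of z 1] this[of 1]]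
    show "norm (exp z - 1) \<le> M * norm z" "norm (exp z - 1 - z) \<le> M * (norm z)\<^sup>2"
      by (auto simp: power2_eq_square algebra_simps)
  qed
  have "H b = H a"
  proof (rule quad_increment_const[OF ab])
    show "continuous_on {a..b} G" unfolding G_def by (rule indef_cont[OF nu])
    show "G x \<le> G y" if "a \<le> x" "x \<le> y" "y \<le> b" for x y by (rule monoG[OF that])
    show "norm (H y - H x) \<le> (2 * M\<^sup>2) * (G y - G x)\<^sup>2" if xy: "a \<le> x" "x \<le> y" "y \<le> b" for x y
    proof -
      define I where "I = G y - G x"
      have I0: "0 \<le> I" using monoG[OF xy] by (simp add: I_def)
      have I1: "I = integral {x..y} (\<lambda>t. norm (u t))"
        unfolding I_def G_def integral_diff_interval[OF nu xy] ..
      have IG: "I \<le> G b" unfolding I_def using Gb[of x] Gb[of y] xy by auto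
      have u': "u absolutely_integrable_on {x..y}" using absint_subinterval u xy by blast
      have cE': "continuous_on {x..y} E" using continuous_on_subset[OF cE] xy by auto
      have ii: "(\<lambda>t. u t * E t) integrable_on {x..y}" "(\<lambda>t. u t * E x) integrable_on {x..y}"
        using absint_mult_cont[OF u' cE'] absint_mult_cont[OF u' continuous_on_const]
        by (auto simp: absolutely_integrable_on_def)
      have iu: "U y - U x = integral {x..y} u" unfolding U_def using integral_diff_interval[OF u xy] .
      have Ey: "E t = E x * exp (U t - U x)" for t
        unfolding E_def by (simp add: exp_add[symmetric])
      have A: "integral {x..y} (\<lambda>t. u t * (E t - E x)) = integral {x..y} (\<lambda>t. u t * E t) - (U y - U x) * E x"
        using ii by (simp add: right_diff_distrib Henstock_Kurzweil_Integration.integral_diff iu)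
      have B: "H y - H x = E y - E x - integral {x..y} (\<lambda>t. u t * E t)"
        unfolding H_def using integral_diff_interval[OF w xy] by (simp add: algebra_simps)
      have C: "E y - E x - (U y - U x) * E x = E x * (exp (U y - U x) - 1 - (U y - U x))"
        unfolding Ey[of y] by (simp add: right_diff_distrib mult.commute)
      have eq: "H y - H x = E x * (exp (U y - U x) - 1 - (U y - U x)) - integral {x..y} (\<lambda>t. u t * (E t - E x))"
        unfolding A B C[symmetric] by simp
      have dUI: "norm (U t - U x) \<le> I" if "t \<in> {x..y}" for t
        using dU[of x t] monoG[of t y] that xy by (auto simp: I_def)
      have "norm (E x * (exp (U y - U x) - 1 - (U y - U x))) \<le> M * (M * I\<^sup>2)"
        unfolding norm_mult
      proof (rule mult_mono)
        show "norm (E x) \<le> M" using EM xy by auto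
        have "norm (exp (U y - U x) - 1 - (U y - U x)) \<le> M * (norm (U y - U x))\<^sup>2"
          using dUI[of y] IG xy by (intro T) auto
        also have "\<dots> \<le> M * I\<^sup>2" using dUI[of y] xy M1 by (intro mult_left_mono power_mono) auto
        finally show "norm (exp (U y - U x) - 1 - (U y - U x)) \<le> M * I\<^sup>2" .
      qed (use M1 in auto)
      moreover have "norm (integral {x..y} (\<lambda>t. u t * (E t - E x))) \<le> (M * (M * I)) * I"
      proof (rule integral_product_bound[OF u', folded I1])
        fix t assume t: "t \<in> {x..y}"
        have "E t - E x = E x * (exp (U t - U x) - 1)" unfolding Ey[of t] by (simp only: right_diff_distrib mult_1_right)
        then have "norm (E t - E x) = norm (E x) * norm (exp (U t - U x) - 1)" by (simp add: norm_mult)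
        also have "\<dots> \<le> M * (M * I)"
        proof (rule mult_mono)
          show "norm (E x) \<le> M" using EM xy by auto
          have "norm (exp (U t - U x) - 1) \<le> M * norm (U t - U x)"
            using dUI[OF t] IG by (intro T) auto
          also have "\<dots> \<le> M * I" using dUI[OF t] M1 by (intro mult_left_mono) auto
          finally show "norm (exp (U t - U x) - 1) \<le> M * I" .
        qed (use M1 in auto)
        finally show "norm (E t - E x) \<le> M * (M * I)" .
      qed (use M1 I0 in \<open>auto intro!: continuous_intros cE'\<close>)
      ultimately have "norm (H y - H x) \<le> M * (M * I\<^sup>2) + (M * (M * I)) * I"
        unfolding eq by (intro order_trans[OF norm_triangle_ineq4] add_mono)
      also have "\<dots> = (2 * M\<^sup>2) * I\<^sup>2" by (simp add: power2_eq_square)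
      finally show ?thesis unfolding I_def .
    qed
  qed
  then have "integral {a..b} (\<lambda>t. u t * E t) = E b - 1"
    by (simp add: H_def E_def U_def algebra_simps)
  then show ?thesis
    using w unfolding E_def by (metis absolutely_integrable_on_def integrable_integral)
qed

section \<open>Linear Volterra systems\<close>

lemma power_over_fact_LIMSEQ: "(\<lambda>m. (z::real) ^ m / fact m) \<longlonglongrightarrow> 0"
  using summable_LIMSEQ_zero[OF summable_exp[of z]] by (simp add: divide_inverse mult.commute)

lemma fact_Suc_cancel: "c / fact (Suc i) * (real (Suc i) * z) = c * z / fact i"
proof -
  have "real (Suc i) \<noteq> 0" by linarith
  then show ?thesis unfolding fact_Suc by (simp add: divide_simps del: of_nat_Suc)
qed

locale volterra =
  fixes n :: nat and l :: real and K :: "nat \<Rightarrow> nat \<Rightarrow> real \<Rightarrow> complex"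
  assumes l: "0 \<le> l" and K: "\<And>j k. j < n \<Longrightarrow> k < n \<Longrightarrow> K j k absolutely_integrable_on {0..l}"
begin

text \<open>The sum of all entries dominates every row sum and so controls \<open>T\<close> in the
  sup norm over components. Its primitive \<open>N\<close> is the scale on which iterates of
  \<open>T\<close> are measured.\<close>

definition kap :: "real \<Rightarrow> real" where "kap t = (\<Sum>j<n. \<Sum>k<n. cmod (K j k t))"
definition N :: "real \<Rightarrow> real" where "N x = integral {0..x} kap"
definition T :: "(real \<Rightarrow> nat \<Rightarrow> complex) \<Rightarrow> real \<Rightarrow> nat \<Rightarrow> complex" where
  "T v x j = integral {0..x} (\<lambda>t. \<Sum>k<n. K j k t * v t k)"

definition cont :: "(real \<Rightarrow> nat \<Rightarrow> complex) \<Rightarrow> bool" where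
  "cont v \<longleftrightarrow> (\<forall>k<n. continuous_on {0..l} (\<lambda>x. v x k))"

lemma kap_nonneg: "0 \<le> kap t"
  unfolding kap_def by (intro sum_nonneg) auto

lemma kap_int: "kap absolutely_integrable_on {0..l}"
  unfolding kap_def by (intro absolutely_integrable_sum absint_norm K) auto

lemma N_mono: "0 \<le> x \<Longrightarrow> x \<le> y \<Longrightarrow> y \<le> l \<Longrightarrow> N x \<le> N y"
  unfolding N_def using integral_norm_mono[OF kap_int, of x y] kap_nonneg by simp

lemma N_0 [simp]: "N 0 = 0" by (simp add: N_def)

lemma N_nonneg: "0 \<le> x \<Longrightarrow> x \<le> l \<Longrightarrow> 0 \<le> N x"
  using N_mono[of 0 x] by simp

lemma N_cont: "continuous_on {0..l} N"
  unfolding N_def by (rule indef_cont[OF kap_int])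

text \<open>The chain rule for powers of \<open>N\<close>; for an integrable density it is built up
  from the product rule, one factor at a time.\<close>

lemma kap_power:
  assumes x: "x \<in> {0..l}"
  shows "((\<lambda>t. real (Suc m) * (kap t * N t ^ m)) has_integral N x ^ Suc m) {0..x}"
  using x
proof (induction m arbitrary: x)
  case 0
  have "kap integrable_on {0..x}"
    using absint_subinterval[OF kap_int, of 0 x] 0 by (auto simp: absolutely_integrable_on_def)
  then show ?case by (simp add: N_def integrable_integral)
next
  case (Suc m)
  have sub: "{0..x} \<subseteq> {0..l}" using Suc.prems by auto
  have k: "kap absolutely_integrable_on {0..x}"
    using absint_subinterval[OF kap_int, of 0 x] Suc.prems by auto
  have kN: "(\<lambda>t. kap t * N t ^ m) absolutely_integrable_on {0..x}"
    by (intro absint_mult_cont k continuous_intros continuous_on_subset[OF N_cont sub])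
  then have kN': "(\<lambda>t. real (Suc m) * (kap t * N t ^ m)) absolutely_integrable_on {0..x}"
    by (rule set_integrable_mult_right)
  have "((\<lambda>t. kap t * N t ^ Suc m + real (Suc m) * (kap t * N t ^ m) * N t) has_integral
          N x * N x ^ Suc m - N 0 * N 0 ^ Suc m) {0..x}"
  proof (rule ac_product[OF _ k kN'])
    show "N y = N 0 + integral {0..y} kap" for y by (simp add: N_def)
    show "N y ^ Suc m = N 0 ^ Suc m + integral {0..y} (\<lambda>t. real (Suc m) * (kap t * N t ^ m))"
      if "y \<in> {0..x}" for y
      using integral_unique[OF Suc.IH[of y]] that Suc.prems by simp
  qed (use Suc.prems in auto)
  then show ?case by (simp add: algebra_simps)
qed

lemma T_integrand: "cont v \<Longrightarrow> j < n \<Longrightarrow> (\<lambda>t. \<Sum>k<n. K j k t * v t k) absolutely_integrable_on {0..l}"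
  by (intro absolutely_integrable_sum absint_mult_cont K) (auto simp: cont_def)

lemma T_cont: "cont v \<Longrightarrow> cont (T v)"
  unfolding cont_def T_def using indef_cont[OF T_integrand[unfolded cont_def]] by auto

lemma T_has_integral: "cont v \<Longrightarrow> j < n \<Longrightarrow> x \<in> {0..l} \<Longrightarrow>
   ((\<lambda>t. \<Sum>k<n. K j k t * v t k) has_integral T v x j) {0..x}"
  unfolding T_def
  by (intro integrable_integral)
     (use absint_subinterval[OF T_integrand, of v j 0 x] in \<open>auto simp: absolutely_integrable_on_def\<close>)

lemma kap_bound:
  assumes "j < n" "\<And>k. k < n \<Longrightarrow> norm (w k) \<le> B" "0 \<le> B"
  shows "norm (\<Sum>k<n. K j k t * w k) \<le> kap t * B"
proof -
  have "norm (\<Sum>k<n. K j k t * w k) \<le> (\<Sum>k<n. norm (K j k t) * B)"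
    by (intro sum_norm_le) (auto simp: norm_mult intro!: mult_left_mono assms)
  also have "\<dots> = (\<Sum>k<n. norm (K j k t)) * B" by (simp add: sum_distrib_right)
  also have "(\<Sum>k<n. norm (K j k t)) \<le> kap t"
    unfolding kap_def by (rule member_le_sum[where f = "\<lambda>j. \<Sum>k<n. norm (K j k t)"]) (use assms in \<open>auto intro!: sum_nonneg\<close>)
  finally show ?thesis using assms by (simp add: mult_right_mono)
qed

text \<open>Integrating \<open>kap * N ^ m\<close> raises power and factorial together, so iterates
  of \<open>T\<close> decay like \<open>N ^ m / fact m\<close> whatever the size of the
  kernel.\<close>

lemma T_bound:
  assumes v: "cont v" and S: "0 \<le> S"
    and b: "\<And>t k. t \<in> {0..l} \<Longrightarrow> k < n \<Longrightarrow> norm (v t k) \<le> S * N t ^ m / fact m"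
    and x: "x \<in> {0..l}" and j: "j < n"
  shows "norm (T v x j) \<le> S * N x ^ Suc m / fact (Suc m)"
proof -
  have N0: "0 \<le> N t" if "t \<in> {0..x}" for t using N_nonneg[of t] x that by auto
  have hi: "((\<lambda>t. S / fact (Suc m) * (real (Suc m) * (kap t * N t ^ m))) has_integral S / fact (Suc m) * N x ^ Suc m) {0..x}"
    by (intro has_integral_mult_right kap_power x)
  have "norm (T v x j) \<le> integral {0..x} (\<lambda>t. S / fact (Suc m) * (real (Suc m) * (kap t * N t ^ m)))"
    unfolding T_def
  proof (rule integral_norm_bound_integral)
    show "(\<lambda>t. \<Sum>k<n. K j k t * v t k) integrable_on {0..x}"
      using T_has_integral[OF v j x] by blast
    show "(\<lambda>t. S / fact (Suc m) * (real (Suc m) * (kap t * N t ^ m))) integrable_on {0..x}"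
      using hi by blast
    fix t assume t: "t \<in> {0..x}"
    have "norm (\<Sum>k<n. K j k t * v t k) \<le> kap t * (S * N t ^ m / fact m)"
      by (rule kap_bound[OF j]) (use t x b S N0[OF t] in auto)
    also have "\<dots> = S / fact (Suc m) * (real (Suc m) * (kap t * N t ^ m))"
      unfolding fact_Suc_cancel by simp
    finally show "norm (\<Sum>k<n. K j k t * v t k) \<le> \<dots>" .
  qed
  also have "\<dots> = S / fact (Suc m) * N x ^ Suc m" using hi by (rule integral_unique)
  finally show ?thesis by simp
qed

lemma T_diff: "cont v \<Longrightarrow> cont w \<Longrightarrow> j < n \<Longrightarrow> x \<in> {0..l} \<Longrightarrow> T (\<lambda>t k. v t k - w t k) x j = T v x j - T w x j"
  using has_integral_diff[OF T_has_integral[of v j x] T_has_integral[of w j x]]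
  by (auto simp: T_def algebra_simps sum_subtractf dest!: integral_unique)

lemma T_cong: "(\<And>t k. t \<in> {0..x} \<Longrightarrow> k < n \<Longrightarrow> v t k = w t k) \<Longrightarrow> T v x j = T w x j"
  unfolding T_def by (intro Henstock_Kurzweil_Integration.integral_cong sum.cong) auto

lemma cont_bounded:
  assumes "cont v"
  obtains S where "0 \<le> S" "\<And>t k. t \<in> {0..l} \<Longrightarrow> k < n \<Longrightarrow> norm (v t k) \<le> S"
proof -
  have "\<exists>S. \<forall>t\<in>{0..l}. norm (v t k) \<le> S" if "k < n" for k
  proof -
    have "compact ((\<lambda>x. v x k) ` {0..l})"
      using assms that by (intro compact_continuous_image) (auto simp: cont_def)
    then show ?thesis using compact_imp_bounded bounded_iff by (metis image_eqI)
  qed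
  then obtain S where S: "\<And>k t. k < n \<Longrightarrow> t \<in> {0..l} \<Longrightarrow> norm (v t k) \<le> S k" by metis
  show ?thesis
  proof (rule that[of "\<Sum>k<n. \<bar>S k\<bar>"])
    fix t k assume "t \<in> {0..l}" "k < n"
    then have "norm (v t k) \<le> \<bar>S k\<bar>" using S by fastforce
    also have "\<dots> \<le> (\<Sum>k<n. \<bar>S k\<bar>)" by (rule member_le_sum) (use \<open>k < n\<close> in auto)
    finally show "norm (v t k) \<le> (\<Sum>k<n. \<bar>S k\<bar>)" .
  qed (auto intro!: sum_nonneg)
qed

lemma exp_partial: "0 \<le> (z::real) \<Longrightarrow> (\<Sum>i<m. z ^ i / fact i) \<le> exp z"
proof -
  assume z: "0 \<le> z"
  have s: "(\<lambda>n. z ^ n / fact n) sums exp z"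
    using exp_converges[of z] by (simp add: scaleR_conv_of_real divide_inverse mult.commute)
  show ?thesis
    using sum_le_suminf[OF sums_summable[OF s], of "{..<m}"] sums_unique[OF s] z by simp
qed

text \<open>The Neumann series of \<open>T\<close> applied to \<open>g\<close>: the factorial bounds
  make it converge uniformly on \<open>{0..l}\<close>, so the sum is continuous and \<open>T\<close>
  may be applied termwise.\<close>

lemma solution:
  assumes g: "cont g"
  obtains y where "cont y" "\<And>x j. x \<in> {0..l} \<Longrightarrow> j < n \<Longrightarrow> y x j = g x j + T y x j"
proof -
  obtain S where S: "0 \<le> S" "\<And>t k. t \<in> {0..l} \<Longrightarrow> k < n \<Longrightarrow> norm (g t k) \<le> S"
    using cont_bounded[OF g] by blast
  define d where "d m = (T ^^ m) g" for m
  have d0: "d 0 = g" and dS: "d (Suc m) = T (d m)" for m by (auto simp: d_def)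
  have dc: "cont (d m)" for m by (induction m) (auto simp: d0 dS g T_cont)
  have db: "norm (d m t k) \<le> S * N t ^ m / fact m" if "t \<in> {0..l}" "k < n" for t k m
    using that
  proof (induction m arbitrary: t k)
    case 0
    then show ?case using S by (simp add: d0)
  next
    case (Suc m)
    then show ?case unfolding dS by (intro T_bound dc S) auto
  qed
  have db': "norm (d m t k) \<le> S * (N l ^ m / fact m)" if "t \<in> {0..l}" "k < n" for t k m
  proof -
    have "S * N t ^ m / fact m \<le> S * N l ^ m / fact m"
      using that S N_mono[of t l] N_nonneg[of t] by (intro divide_right_mono mult_left_mono power_mono) auto
    then show ?thesis using db[OF that, of m] by simp
  qed
  have su: "summable (\<lambda>m. S * (N l ^ m / fact m))"
    using summable_exp[of "N l"] by (intro summable_mult) (simp add: divide_inverse mult.commute)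
  define s where "s m x j = (\<Sum>i<m. d i x j)" for m x j
  define y where "y x j = (\<Sum>i. d i x j)" for x j
  have ul: "uniform_limit {0..l} (\<lambda>m x. s m x j) (\<lambda>x. y x j) sequentially" if "j < n" for j
    unfolding s_def y_def by (rule Weierstrass_m_test[OF _ su]) (use db' that in auto)
  have sc: "cont (s m)" for m
    using dc unfolding cont_def s_def by (auto intro!: continuous_on_sum)
  have yc: "cont y"
    unfolding cont_def
  proof (intro allI impI)
    fix k assume "k < n"
    show "continuous_on {0..l} (\<lambda>x. y x k)"
      by (rule uniform_limit_theorem[OF _ ul[OF \<open>k < n\<close>]]) (use sc \<open>k < n\<close> in \<open>auto simp: cont_def\<close>)
  qed
  have sT: "s (Suc m) x j = g x j + T (s m) x j" if "x \<in> {0..l}" "j < n" for m x j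
  proof -
    have "T (s m) x j = (\<Sum>i<m. T (d i) x j)"
    proof -
      have "((\<lambda>t. \<Sum>i<m. \<Sum>k<n. K j k t * d i t k) has_integral (\<Sum>i<m. T (d i) x j)) {0..x}"
        by (intro has_integral_sum T_has_integral dc that) auto
      also have "(\<lambda>t. \<Sum>i<m. \<Sum>k<n. K j k t * d i t k) = (\<lambda>t. \<Sum>k<n. K j k t * s m t k)"
        unfolding s_def sum_distrib_left by (subst sum.swap) simp
      finally show ?thesis unfolding T_def by (rule integral_unique)
    qed
    then show ?thesis by (simp add: s_def sum.lessThan_Suc_shift d0 dS del: sum.lessThan_Suc)
  qed
  have eq: "y x j = g x j + T y x j" if xj: "x \<in> {0..l}" "j < n" for x j
  proof -
    have lim: "(\<lambda>m. s m x j) \<longlonglongrightarrow> y x j"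
      using tendsto_uniform_limitI[OF ul[OF xj(2)] xj(1)] .
    have "(\<lambda>m. T (s m) x j) \<longlonglongrightarrow> T y x j"
    proof (rule LIMSEQ_I)
      fix e :: real assume e: "e > 0"
      define e' where "e' = e / (N l + 1)"
      have Nl: "0 \<le> N l" using N_nonneg[of l] l by auto
      have e': "e' > 0" using e Nl by (simp add: e'_def)
      have "\<forall>\<^sub>F m in sequentially. \<forall>k\<in>{..<n}. \<forall>t\<in>{0..l}. dist (s m t k) (y t k) < e'"
        by (intro eventually_ball_finite) (use ul e' in \<open>auto simp: uniform_limit_iff\<close>)
      then obtain M where M: "\<And>m k t. m \<ge> M \<Longrightarrow> k < n \<Longrightarrow> t \<in> {0..l} \<Longrightarrow> norm (s m t k - y t k) < e'"
        unfolding eventually_sequentially dist_norm by (metis lessThan_iff)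
      have "norm (T (s m) x j - T y x j) < e" if m: "m \<ge> M" for m
      proof -
        \<comment> \<open>\<open>T_bound\<close> with \<open>m = 0\<close> bounds \<open>T\<close>
          by \<open>N\<close> times the uniform distance, which carries the limit through
          \<open>T\<close>.\<close>
        have "norm (T (\<lambda>t k. s m t k - y t k) x j) \<le> e' * N x ^ Suc 0 / fact (Suc 0)"
        proof (rule T_bound)
          show "cont (\<lambda>t k. s m t k - y t k)"
            using sc yc unfolding cont_def by (auto intro: continuous_on_diff)
        qed (use e' M[OF m] xj in \<open>auto intro: less_imp_le\<close>)
        also have "\<dots> \<le> e' * N l" using N_mono[of x l] xj e' by auto
        also have "\<dots> < e" using e Nl by (simp add: e'_def field_simps)
        finally show ?thesis using T_diff[OF sc yc] xj by simp
      qed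
      then show "\<exists>M. \<forall>m\<ge>M. norm (T (s m) x j - T y x j) < e" by blast
    qed
    then have "(\<lambda>m. s (Suc m) x j) \<longlonglongrightarrow> g x j + T y x j"
      unfolding sT[OF xj] by (intro tendsto_intros)
    with lim show ?thesis using LIMSEQ_Suc LIMSEQ_unique by blast
  qed
  from that[OF yc eq] show ?thesis .
qed

text \<open>Gronwall's inequality by iteration: substituting the equation into itself
  \<open>m\<close> times leaves \<open>G\<close> times a partial sum of the exponential series and a
  remainder \<open>S * N x ^ m / fact m\<close>. The bound \<open>S\<close> comes from continuity of
  \<open>y\<close> alone and disappears in the limit. Uniqueness will be the case
  \<open>G = 0\<close>.\<close>

lemma a_priori_bound:
  assumes y: "cont y" and g: "cont g" and eq: "\<And>x j. x \<in> {0..l} \<Longrightarrow> j < n \<Longrightarrow> y x j = g x j + T y x j"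
    and G: "0 \<le> G" "\<And>x j. x \<in> {0..l} \<Longrightarrow> j < n \<Longrightarrow> norm (g x j) \<le> G"
    and xj: "x \<in> {0..l}" "j < n"
  shows "norm (y x j) \<le> G * exp (N l)"
proof -
  obtain S where S: "0 \<le> S" "\<And>t k. t \<in> {0..l} \<Longrightarrow> k < n \<Longrightarrow> norm (y t k) \<le> S"
    using cont_bounded[OF y] by blast
  have b: "norm (y t k) \<le> G * (\<Sum>i<m. N t ^ i / fact i) + S * N t ^ m / fact m" if "t \<in> {0..l}" "k < n" for t k m
    using that
  proof (induction m arbitrary: t k)
    case 0
    then show ?case using S by simp
  next
    case (Suc m)
    have N0: "0 \<le> N u" if "u \<in> {0..t}" for u using N_nonneg[of u] Suc.prems that by auto
    let ?B = "\<lambda>u. G * (\<Sum>i<m. N u ^ i / fact i) + S * N u ^ m / fact m"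
    have hi0: "((\<lambda>u. c / fact (Suc i) * (real (Suc i) * (kap u * N u ^ i))) has_integral c / fact (Suc i) * N t ^ Suc i) {0..t}" for i c
      by (intro has_integral_mult_right kap_power Suc)
    have hi: "((\<lambda>u. (\<Sum>i<m. G * (kap u * N u ^ i) / fact i) + S * (kap u * N u ^ m) / fact m) has_integral
        (\<Sum>i<m. G / fact (Suc i) * N t ^ Suc i) + S / fact (Suc m) * N t ^ Suc m) {0..t}"
      by (intro has_integral_add has_integral_sum hi0[unfolded fact_Suc_cancel]) auto
    have "norm (T y t k) \<le> integral {0..t} (\<lambda>u. (\<Sum>i<m. G * (kap u * N u ^ i) / fact i) + S * (kap u * N u ^ m) / fact m)"
      unfolding T_def
    proof (rule integral_norm_bound_integral)
      show "(\<lambda>u. \<Sum>i<n. K k i u * y u i) integrable_on {0..t}"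
        using T_has_integral[OF y] Suc.prems by blast
      show "(\<lambda>u. (\<Sum>i<m. G * (kap u * N u ^ i) / fact i) + S * (kap u * N u ^ m) / fact m) integrable_on {0..t}"
        using hi by blast
      fix u assume u: "u \<in> {0..t}"
      have "norm (\<Sum>i<n. K k i u * y u i) \<le> kap u * ?B u"
        by (rule kap_bound) (use Suc u S G N0[OF u] in \<open>auto intro!: add_nonneg_nonneg mult_nonneg_nonneg sum_nonneg\<close>)
      also have "\<dots> = (\<Sum>i<m. G * (kap u * N u ^ i) / fact i) + S * (kap u * N u ^ m) / fact m"
        by (simp add: sum_distrib_left algebra_simps)
      finally show "norm (\<Sum>i<n. K k i u * y u i) \<le> \<dots>" .
    qed
    also have "\<dots> = (\<Sum>i<m. G / fact (Suc i) * N t ^ Suc i) + S / fact (Suc m) * N t ^ Suc m"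
      using hi by (rule integral_unique)
    finally have "norm (T y t k) \<le> \<dots>" .
    moreover have "norm (y t k) \<le> G + norm (T y t k)"
      using eq[OF Suc.prems] G(2)[OF Suc.prems] norm_triangle_ineq[of "g t k" "T y t k"] by simp
    moreover have "G * (\<Sum>i<Suc m. N t ^ i / fact i) = G + (\<Sum>i<m. G / fact (Suc i) * N t ^ Suc i)"
      by (subst sum.lessThan_Suc_shift) (simp add: sum_distrib_left distrib_left del: fact_Suc power_Suc)
    ultimately show ?case by (simp del: fact_Suc power_Suc)
  qed
  have Nx: "0 \<le> N x" "N x \<le> N l" using N_nonneg[of x] N_mono[of x l] xj by auto
  have "norm (y x j) \<le> G * exp (N l) + S * (N x ^ m / fact m)" for m
  proof -
    have "(\<Sum>i<m. N x ^ i / fact i) \<le> exp (N l)"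
      using exp_partial[OF Nx(1), of m] Nx(2) by (meson exp_le_cancel_iff order_trans)
    then have "G * (\<Sum>i<m. N x ^ i / fact i) \<le> G * exp (N l)" using G by (intro mult_left_mono)
    then show ?thesis using b[OF xj, of m] by simp
  qed
  moreover have "(\<lambda>m. G * exp (N l) + S * (N x ^ m / fact m)) \<longlonglongrightarrow> G * exp (N l) + S * 0"
    by (intro tendsto_add tendsto_mult tendsto_const power_over_fact_LIMSEQ)
  ultimately have "norm (y x j) \<le> G * exp (N l) + S * 0"
    by (intro LIMSEQ_le_const) auto
  then show ?thesis by simp
qed

end

section \<open>A Riemann--Lebesgue lemma in horizontal strips\<close>

lemma AE_lebesgue_on_negligible:
  assumes "AE x in lebesgue_on S. P x" "S \<in> sets lebesgue"
  obtains N where "negligible N" "\<And>x. x \<in> S - N \<Longrightarrow> P x"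
proof -
  have "AE x in lebesgue. x \<in> S \<longrightarrow> P x"
    using assms by (subst (asm) AE_restrict_space_iff) auto
  then obtain N where "N \<in> null_sets lebesgue" "{x. \<not> (x \<in> S \<longrightarrow> P x)} \<subseteq> N"
    by (auto simp: completion.AE_iff_null_sets eventually_ae_filter)
  then show ?thesis
    by (intro that[of N]) (auto simp: negligible_iff_null_sets)
qed

text \<open>The radial retraction onto the closed disc of radius \<open>r\<close>. The
  \<open>max\<close> keeps the denominator positive, so for \<open>r > 0\<close> it is continuous
  everywhere.\<close>

definition radial_cap :: "real \<Rightarrow> complex \<Rightarrow> complex" where
  "radial_cap r z = complex_of_real (r / max r (norm z)) * z"

lemma radial_cap_cont: "r > 0 \<Longrightarrow> continuous_on S (radial_cap r)"
  unfolding radial_cap_def by (intro continuous_intros) auto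

lemma radial_cap_le: "r > 0 \<Longrightarrow> norm (radial_cap r z) \<le> r" "r > 0 \<Longrightarrow> norm (radial_cap r z) \<le> norm z"
  unfolding radial_cap_def by (auto simp: norm_mult norm_divide max_def field_simps mult_le_cancel_left)

lemma radial_cap_id: "norm z \<le> r \<Longrightarrow> r > 0 \<Longrightarrow> radial_cap r z = z"
  unfolding radial_cap_def by (simp add: max_def)

text \<open>Two truncations permit dominated convergence twice: \<open>f k\<close> caps
  \<open>g\<close> and is dominated by \<open>g\<close>, and the continuous functions
  \<open>h i\<close> converging to \<open>f k\<close> off a null set are capped at the same height,
  which gives them a constant bound.\<close>

lemma absint_approx_continuous:
  fixes g :: "real \<Rightarrow> complex"
  assumes g: "g absolutely_integrable_on {a..b}" and e: "e > 0"
  obtains \<phi> where "continuous_on UNIV \<phi>" "integral {a..b} (\<lambda>t. norm (g t - \<phi> t)) < e"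
proof -
  let ?S = "{a..b}"
  have S: "?S \<in> sets lebesgue" by auto
  have gm: "g \<in> borel_measurable (lebesgue_on ?S)"
    using absolutely_integrable_imp_borel_measurable[OF g S] .
  define f where "f k = (\<lambda>t. radial_cap (real (Suc k)) (g t))" for k
  have fm: "f k \<in> borel_measurable (lebesgue_on ?S)" for k
    unfolding f_def by (intro measurable_compose[OF gm] borel_measurable_continuous_onI radial_cap_cont) simp
  have ng: "(\<lambda>t. norm (g t)) integrable_on ?S"
    using absint_norm[OF g] by (simp add: absolutely_integrable_on_def)
  have fi: "f k absolutely_integrable_on ?S" for k
    by (rule measurable_bounded_by_integrable_imp_absolutely_integrable[OF fm S ng])
       (simp add: f_def radial_cap_le)
  have "(\<lambda>k. integral ?S (\<lambda>t. norm (g t - f k t))) \<longlonglongrightarrow> integral ?S (\<lambda>t. 0::real)"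
  proof (rule dominated_convergence(2))
    show "(\<lambda>t. norm (g t - f k t)) integrable_on ?S" for k
      using absint_norm[OF set_integral_diff(1)[OF g fi[of k]]] by (simp add: absolutely_integrable_on_def)
    show "(\<lambda>t. 2 * norm (g t)) integrable_on ?S" using ng by (rule integrable_on_mult_right)
    show "norm (norm (g t - f k t)) \<le> 2 * norm (g t)" for k t
      using norm_triangle_ineq4[of "g t" "f k t"] radial_cap_le(2)[of "real (Suc k)" "g t"] by (simp add: f_def)
    show "(\<lambda>k. norm (g t - f k t)) \<longlonglongrightarrow> 0" for t
    proof (rule tendsto_eventually)
      show "\<forall>\<^sub>F k in sequentially. norm (g t - f k t) = 0"
        using eventually_ge_at_top[of "nat \<lceil>norm (g t)\<rceil>"]
        by eventually_elim (auto simp: f_def radial_cap_id)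
    qed
  qed
  then have "\<forall>\<^sub>F k in sequentially. integral ?S (\<lambda>t. norm (g t - f k t)) < e / 2"
    using e by (intro order_tendstoD) auto
  then obtain k where k: "integral ?S (\<lambda>t. norm (g t - f k t)) < e / 2"
    unfolding eventually_sequentially by auto
  have "f k measurable_on ?S" using fm S by (simp add: measurable_on_iff_borel_measurable)
  then obtain N h where N: "negligible N" and hc: "\<And>i. continuous_on UNIV (h i)"
    and hl: "\<And>x. x \<notin> N \<Longrightarrow> (\<lambda>i. h i x) \<longlonglongrightarrow> (if x \<in> ?S then f k x else 0)"
    unfolding measurable_on_def by blast
  let ?r = "real (Suc k)"
  define \<phi> where "\<phi> i = (\<lambda>t. radial_cap ?r (h i t))" for i
  have pc: "continuous_on A (\<phi> i)" for i A
    unfolding \<phi>_def by (rule continuous_on_compose2[OF radial_cap_cont[of ?r UNIV]]) (auto intro: continuous_on_subset[OF hc])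
  have pi: "\<phi> i absolutely_integrable_on ?S" for i
    using absolutely_integrable_continuous_real[OF pc] .
  have dabs: "(\<lambda>t. norm (f k t - \<phi> i t)) integrable_on ?S" for i
    using absint_norm[OF set_integral_diff(1)[OF fi pi]] by (simp add: absolutely_integrable_on_def)
  have "(\<lambda>i. integral ?S (\<lambda>t. if t \<in> N then 0 else norm (f k t - \<phi> i t))) \<longlonglongrightarrow> integral ?S (\<lambda>t. 0::real)"
  proof (rule dominated_convergence(2))
    show "(\<lambda>t. if t \<in> N then 0 else norm (f k t - \<phi> i t)) integrable_on ?S" for i
      by (rule integrable_spike[OF dabs N]) auto
    show "(\<lambda>t. 2 * ?r) integrable_on ?S" by auto
    show "norm (if t \<in> N then 0 else norm (f k t - \<phi> i t)) \<le> 2 * ?r" for i t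
      using norm_triangle_ineq4[of "f k t" "\<phi> i t"] radial_cap_le(1)[of ?r "g t"] radial_cap_le(1)[of ?r "h i t"]
      by (auto simp: f_def \<phi>_def)
    show "(\<lambda>i. if t \<in> N then 0 else norm (f k t - \<phi> i t)) \<longlonglongrightarrow> 0" if "t \<in> ?S" for t
    proof (cases "t \<in> N")
      case False
      have "isCont (radial_cap ?r) (f k t)"
        using radial_cap_cont[of ?r UNIV] by (simp add: continuous_on_eq_continuous_at)
      then have "(\<lambda>i. \<phi> i t) \<longlonglongrightarrow> radial_cap ?r (f k t)"
        unfolding \<phi>_def using hl[OF False] that by (intro isCont_tendsto_compose[of _ "radial_cap ?r"]) auto
      moreover have "radial_cap ?r (f k t) = f k t"
        by (rule radial_cap_id) (auto simp: f_def radial_cap_le)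
      ultimately have "(\<lambda>i. norm (f k t - \<phi> i t)) \<longlonglongrightarrow> norm (f k t - f k t)" by (intro tendsto_intros) simp
      then show ?thesis using False by simp
    qed simp
  qed
  then have "\<forall>\<^sub>F i in sequentially. integral ?S (\<lambda>t. if t \<in> N then 0 else norm (f k t - \<phi> i t)) < e / 2"
    using e by (intro order_tendstoD) auto
  then obtain i where i: "integral ?S (\<lambda>t. if t \<in> N then 0 else norm (f k t - \<phi> i t)) < e / 2"
    unfolding eventually_sequentially by auto
  have "integral ?S (\<lambda>t. norm (f k t - \<phi> i t)) = integral ?S (\<lambda>t. if t \<in> N then 0 else norm (f k t - \<phi> i t))"
    by (rule integral_spike[OF N]) auto
  with i have i': "integral ?S (\<lambda>t. norm (f k t - \<phi> i t)) < e / 2" by simp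
  have gi: "(\<lambda>t. norm (g t - f k t)) integrable_on ?S"
    using absint_norm[OF set_integral_diff(1)[OF g fi[of k]]] by (simp add: absolutely_integrable_on_def)
  have "integral ?S (\<lambda>t. norm (g t - \<phi> i t)) \<le> integral ?S (\<lambda>t. norm (g t - f k t) + norm (f k t - \<phi> i t))"
  proof (rule integral_le)
    show "(\<lambda>t. norm (g t - \<phi> i t)) integrable_on ?S"
      using absint_norm[OF set_integral_diff(1)[OF g pi[of i]]] by (simp add: absolutely_integrable_on_def)
    show "norm (g t - \<phi> i t) \<le> norm (g t - f k t) + norm (f k t - \<phi> i t)" for t
      using norm_triangle_ineq[of "g t - f k t" "f k t - \<phi> i t"] by simp
  qed (intro integrable_add gi dabs)
  also have "\<dots> < e"
    using k i' gi dabs[of i] by (simp add: Henstock_Kurzweil_Integration.integral_add)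
  finally show ?thesis using that[of "\<phi> i"] pc by blast
qed

text \<open>A kernel with small primitive integrates to something small against any function with a
  given modulus of continuity: freeze the function on each cell of a partition.\<close>

lemma small_primitive_bound:
  fixes E u :: "real \<Rightarrow> complex"
  assumes l: "l > 0" and E: "E absolutely_integrable_on {0..l}" and u: "continuous_on {0..l} u"
    and M: "\<And>t. t \<in> {0..l} \<Longrightarrow> norm (u t) \<le> M"
    and osc: "\<And>s t. s \<in> {0..l} \<Longrightarrow> t \<in> {0..l} \<Longrightarrow> \<bar>s - t\<bar> \<le> l / real N \<Longrightarrow> norm (u s - u t) \<le> \<omega>"
    and prim: "\<And>x. x \<in> {0..l} \<Longrightarrow> norm (integral {0..x} E) \<le> \<eta>"
    and N: "N > 0" and x: "x \<in> {0..l}"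
  shows "norm (integral {0..x} (\<lambda>t. E t * u t)) \<le> 2 * real N * \<eta> * M + \<omega> * integral {0..l} (\<lambda>t. norm (E t))"
proof -
  have M0: "M \<ge> 0" using M[of 0] l norm_ge_zero[of "u 0"] by (smt (verit) atLeastAtMost_iff)
  have eta0: "\<eta> \<ge> 0" using prim[of 0] l by auto
  have om0: "\<omega> \<ge> 0" using osc[of 0 0] l by auto
  have nE: "(\<lambda>t. norm (E t)) absolutely_integrable_on {0..l}" using E by (rule absint_norm)
  have Eu: "(\<lambda>t. E t * u t) absolutely_integrable_on {0..l}" by (rule absint_mult_cont[OF E u])
  \<comment> \<open>Induction on the number of cells that reach \<open>x\<close>; the last one may
    be cut short. Its frozen part costs twice \<open>\<eta>\<close>, because the integral over a
    cell is a difference of two primitives.\<close>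
  have step: "norm (integral {0..x} (\<lambda>t. E t * u t)) \<le> 2 * real i * \<eta> * M + \<omega> * integral {0..x} (\<lambda>t. norm (E t))"
    if "x \<in> {0..real i * (l / real N)}" "x \<le> l" for i x
    using that
  proof (induction i arbitrary: x)
    case 0
    then show ?case by simp
  next
    case (Suc i)
    define a where "a = real i * (l / real N)"
    have a0: "a \<ge> 0" using l by (simp add: a_def)
    show ?case
    proof (cases "x \<le> a")
      case True
      then have "norm (integral {0..x} (\<lambda>t. E t * u t)) \<le> 2 * real i * \<eta> * M + \<omega> * integral {0..x} (\<lambda>t. norm (E t))"
        using Suc by (intro Suc.IH) (auto simp: a_def)
      also have "\<dots> \<le> 2 * real (Suc i) * \<eta> * M + \<omega> * integral {0..x} (\<lambda>t. norm (E t))"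
        using eta0 M0 by (intro add_right_mono mult_right_mono) auto
      finally show ?thesis .
    next
      case False
      then have ax: "a \<le> x" by simp
      have al: "a \<le> l" using ax Suc.prems by simp
      have xl: "x \<le> l" using Suc.prems by simp
      have len: "x - a \<le> l / real N" using Suc.prems by (simp add: a_def algebra_simps add_divide_distrib)
      have d1: "integral {0..x} (\<lambda>t. E t * u t) = integral {0..a} (\<lambda>t. E t * u t) + integral {a..x} (\<lambda>t. E t * u t)"
        using integral_diff_interval[OF Eu a0 ax xl] by (simp add: algebra_simps)
      have d2: "integral {0..x} (\<lambda>t. norm (E t)) = integral {0..a} (\<lambda>t. norm (E t)) + integral {a..x} (\<lambda>t. norm (E t))"
        using integral_diff_interval[OF nE a0 ax xl] by (simp add: algebra_simps)
      have E': "E absolutely_integrable_on {a..x}" using absint_subinterval[OF E a0 xl] .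
      have u': "continuous_on {a..x} u" using continuous_on_subset[OF u] a0 xl by auto
      have i1: "(\<lambda>t. E t * u t) integrable_on {a..x}" "(\<lambda>t. E t * u a) integrable_on {a..x}"
        using absint_mult_cont[OF E' u'] absint_mult_cont[OF E' continuous_on_const] by (auto simp: absolutely_integrable_on_def)
      have d3: "integral {a..x} (\<lambda>t. E t * u t) = integral {a..x} (\<lambda>t. E t * (u t - u a)) + integral {a..x} E * u a"
        using i1 by (simp add: right_diff_distrib Henstock_Kurzweil_Integration.integral_diff)
      have b1: "norm (integral {a..x} (\<lambda>t. E t * (u t - u a))) \<le> \<omega> * integral {a..x} (\<lambda>t. norm (E t))"
        by (rule integral_product_bound[OF E'])
           (use osc a0 al xl len ax om0 in \<open>auto intro!: continuous_intros u' osc\<close>)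
      have b2: "norm (integral {a..x} E) \<le> 2 * \<eta>"
        unfolding integral_diff_interval[OF E a0 ax xl, symmetric]
        using prim[of a] prim[of x] a0 al ax xl norm_triangle_ineq4[of "integral {0..x} E" "integral {0..a} E"] by auto
      have "norm (integral {a..x} E * u a) \<le> 2 * \<eta> * M"
        unfolding norm_mult using b2 M[of a] a0 al eta0 by (intro mult_mono) auto
      moreover have "norm (integral {0..a} (\<lambda>t. E t * u t)) \<le> 2 * real i * \<eta> * M + \<omega> * integral {0..a} (\<lambda>t. norm (E t))"
        using a0 al by (intro Suc.IH) (auto simp: a_def)
      ultimately have "norm (integral {0..x} (\<lambda>t. E t * u t)) \<le>
          (2 * real i * \<eta> * M + \<omega> * integral {0..a} (\<lambda>t. norm (E t))) + (\<omega> * integral {a..x} (\<lambda>t. norm (E t)) + 2 * \<eta> * M)"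
        unfolding d1 d3 by (intro order_trans[OF norm_triangle_ineq] add_mono b1)
      also have "\<dots> = 2 * real (Suc i) * \<eta> * M + \<omega> * integral {0..x} (\<lambda>t. norm (E t))"
        unfolding d2 by (simp add: algebra_simps)
      finally show ?thesis .
    qed
  qed
  have "norm (integral {0..x} (\<lambda>t. E t * u t)) \<le> 2 * real N * \<eta> * M + \<omega> * integral {0..x} (\<lambda>t. norm (E t))"
    using x N by (intro step) auto
  also have "\<dots> \<le> 2 * real N * \<eta> * M + \<omega> * integral {0..l} (\<lambda>t. norm (E t))"
    using integral_norm_mono[OF E, of x l] x om0 by (intro add_left_mono mult_left_mono) auto
  finally show ?thesis .
qed

text \<open>Clipping \<open>s\<close> at height \<open>M\<close> turns the bound that holds almost
  everywhere into one that holds everywhere.\<close>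

lemma integrable_on_bounded_measurable:
  fixes s :: "real \<Rightarrow> real"
  assumes m: "s \<in> borel_measurable (lebesgue_on {a..b})" and b: "AE x in lebesgue_on {a..b}. \<bar>s x\<bar> \<le> M"
  shows "s absolutely_integrable_on {a..b}"
proof -
  obtain N where N: "negligible N" "\<And>x. x \<in> {a..b} - N \<Longrightarrow> \<bar>s x\<bar> \<le> M"
    using AE_lebesgue_on_negligible[OF b] by auto
  define s' where "s' x = max (- M) (min M (s x))" for x
  have M0: "s' x = s x" if "x \<in> {a..b} - N" for x using N(2)[OF that] by (auto simp: s'_def)
  have "s' \<in> borel_measurable (lebesgue_on {a..b})" unfolding s'_def using m by measurable
  then have "s' absolutely_integrable_on {a..b}"
    by (rule measurable_bounded_by_integrable_imp_absolutely_integrable[where g = "\<lambda>_. \<bar>M\<bar>"]) (auto simp: s'_def)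
  then show ?thesis by (rule absolutely_integrable_spike[OF _ N(1)]) (use M0 in auto)
qed

text \<open>As \<open>s\<close> stays away from 0, \<open>q\<close> can be written as
  \<open>g * s\<close> with \<open>g\<close> integrable. The factor \<open>s\<close> times the
  exponential is, up to \<open>- \<i> * \<mu>\<close>, the derivative of the exponential, so its
  primitive is of order \<open>1 / cmod \<mu>\<close> where the exponential is bounded. Replacing
  \<open>g\<close> by a continuous \<open>\<phi>\<close> then leads to the situation of
  \<open>small_primitive_bound\<close>.\<close>

lemma riemann_lebesgue_strip:
  fixes s :: "real \<Rightarrow> real" and q :: "real \<Rightarrow> complex"
  assumes l: "l > 0" and sm: "s \<in> borel_measurable (lebesgue_on {0..l})"
    and sM: "AE x in lebesgue_on {0..l}. \<bar>s x\<bar> \<le> M"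
    and th: "\<theta> > 0" "AE x in lebesgue_on {0..l}. \<theta> \<le> \<bar>s x\<bar>"
    and q: "q absolutely_integrable_on {0..l}" and e: "e > 0"
  shows "\<exists>R. \<forall>\<mu>. \<bar>Im \<mu>\<bar> \<le> h \<and> R \<le> cmod \<mu> \<longrightarrow>
     (\<forall>x\<in>{0..l}. norm (integral {0..x} (\<lambda>t. q t * exp (- \<i> * \<mu> * complex_of_real (integral {0..t} s)))) < e)"
proof -
  define M' where "M' = max M 1"
  have M': "M' > 0" by (simp add: M'_def)
  have si: "s absolutely_integrable_on {0..l}" by (rule integrable_on_bounded_measurable[OF sm sM])
  obtain N1 where N1: "negligible N1" "\<And>x. x \<in> {0..l} - N1 \<Longrightarrow> \<bar>s x\<bar> \<le> M"
    using AE_lebesgue_on_negligible[OF sM] by auto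
  obtain N2 where N2: "negligible N2" "\<And>x. x \<in> {0..l} - N2 \<Longrightarrow> \<theta> \<le> \<bar>s x\<bar>"
    using AE_lebesgue_on_negligible[OF th(2)] by auto
  define g where "g = (\<lambda>t. q t / complex_of_real (s t))"
  have gm: "g \<in> borel_measurable (lebesgue_on {0..l})"
    unfolding g_def using absolutely_integrable_imp_borel_measurable[OF q] sm by (intro borel_measurable_divide) auto
  \<comment> \<open>Setting the quotient to 0 on the null set where \<open>s\<close> is small makes
    \<open>norm (q t) / \<theta>\<close> a bound at every point.\<close>
  define gt where "gt = (\<lambda>t. complex_of_real (if \<theta> \<le> \<bar>s t\<bar> then 1 else 0) * g t)"
  have "gt \<in> borel_measurable (lebesgue_on {0..l})"
    unfolding gt_def using gm sm by measurable
  then have gti: "gt absolutely_integrable_on {0..l}"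
  proof (rule measurable_bounded_by_integrable_imp_absolutely_integrable)
    show "(\<lambda>t. (1/\<theta>) * norm (q t)) integrable_on {0..l}"
      using absint_norm[OF q] by (intro integrable_on_mult_right) (simp add: absolutely_integrable_on_def)
    show "norm (gt t) \<le> (1/\<theta>) * norm (q t)" for t
      using th(1) by (auto simp: gt_def g_def norm_divide norm_mult divide_simps mult_left_mono)
  qed auto
  define sc where "sc t = complex_of_real (s t)" for t
  have sci: "sc absolutely_integrable_on {0..l}"
    unfolding sc_def using absolutely_integrable_linear[OF si bounded_linear_of_real] by (simp add: o_def)
  define \<sigma> where "\<sigma> t = integral {0..t} s" for t
  have s\<sigma>: "complex_of_real (\<sigma> t) = integral {0..t} sc" if "t \<in> {0..l}" for t
    unfolding \<sigma>_def sc_def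
    using integral_linear[where h = complex_of_real, OF _ bounded_linear_of_real, of s "{0..t}"] absint_subinterval[OF si, of 0 t] that
    by (simp add: o_def absolutely_integrable_on_def)
  have \<sigma>b: "\<bar>\<sigma> t\<bar> \<le> M' * l" if t: "t \<in> {0..l}" for t
  proof -
    have "\<bar>\<sigma> t\<bar> \<le> integral {0..t} (\<lambda>t. \<bar>s t\<bar>)"
      unfolding \<sigma>_def using integral_norm_le[OF absint_subinterval[OF si, of 0 t]] t by simp
    also have "\<dots> = integral {0..t} (\<lambda>t. if t \<in> N1 then 0 else \<bar>s t\<bar>)"
      by (rule integral_spike[OF N1(1)]) auto
    also have "\<dots> \<le> integral {0..t} (\<lambda>t. M')"
    proof (rule integral_le)
      have "(\<lambda>t. \<bar>s t\<bar>) integrable_on {0..t}"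
        using absint_norm[OF absint_subinterval[OF si, of 0 t]] t by (auto simp: absolutely_integrable_on_def)
      then show "(\<lambda>t. if t \<in> N1 then 0 else \<bar>s t\<bar>) integrable_on {0..t}"
        by (rule integrable_spike[OF _ N1(1)]) auto
      show "(if u \<in> N1 then 0 else \<bar>s u\<bar>) \<le> M'" if "u \<in> {0..t}" for u
        using N1(2)[of u] that t M' by (auto simp: M'_def)
    qed auto
    also have "\<dots> \<le> M' * l" using t M' by simp
    finally show ?thesis .
  qed
  define B where "B = exp (\<bar>h\<bar> * (M' * l))"
  have B: "B \<ge> 1" unfolding B_def using M' l by simp
  define X where "X \<mu> t = exp (- \<i> * \<mu> * complex_of_real (\<sigma> t))" for \<mu> t
  have XB: "norm (X \<mu> t) \<le> B" if "\<bar>Im \<mu>\<bar> \<le> h" "t \<in> {0..l}" for \<mu> t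
  proof -
    have "Im \<mu> * \<sigma> t \<le> \<bar>Im \<mu>\<bar> * \<bar>\<sigma> t\<bar>" by (metis abs_ge_self abs_mult)
    also have "\<dots> \<le> \<bar>h\<bar> * (M' * l)" using that \<sigma>b[OF that(2)] by (intro mult_mono) auto
    finally show ?thesis unfolding X_def B_def by (simp add: norm_exp_eq_Re)
  qed
  have \<sigma>c: "continuous_on {0..l} \<sigma>" unfolding \<sigma>_def by (rule indef_cont[OF si])
  have Xc: "continuous_on {0..l} (X \<mu>)" for \<mu>
    unfolding X_def by (intro continuous_intros \<sigma>c)
  define L where "L = integral {0..l} (\<lambda>t. norm (sc t))"
  have L0: "L \<ge> 0" unfolding L_def
    using absint_norm[OF sci] by (intro Henstock_Kurzweil_Integration.integral_nonneg) (auto simp: absolutely_integrable_on_def)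
  obtain \<phi> where \<phi>: "continuous_on UNIV \<phi>" "integral {0..l} (\<lambda>t. norm (gt t - \<phi> t)) < e / (4 * B * M')"
    using absint_approx_continuous[OF gti, of "e / (4 * B * M')"] e B M' by auto
  have \<phi>c: "continuous_on {0..l} \<phi>" using \<phi>(1) continuous_on_subset by blast
  have "uniformly_continuous_on {0..l} \<phi>" using \<phi>c compact_uniformly_continuous compact_Icc by blast
  \<comment> \<open>The kernel \<open>E\<close> below has an integral of modulus at most
    \<open>B * L\<close>, so this oscillation of \<open>\<phi>\<close> costs at most
    \<open>e / 4\<close>.\<close>
  moreover define \<omega> where "\<omega> = e / (4 * B * (L + 1))"
  have om: "\<omega> > 0" using e B L0 by (simp add: \<omega>_def)
  ultimately obtain d where d: "d > 0" "\<And>s t. s \<in> {0..l} \<Longrightarrow> t \<in> {0..l} \<Longrightarrow> dist s t < d \<Longrightarrow> dist (\<phi> s) (\<phi> t) < \<omega>"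
    unfolding uniformly_continuous_on_def by (metis dist_commute)
  obtain N where N: "N > 0" "l / real N < d"
  proof -
    obtain N where "l / d < real N" using reals_Archimedean2 by blast
    moreover have "0 < l / d" using l d(1) by simp
    ultimately have "0 < real N" by linarith
    with \<open>l / d < real N\<close> show ?thesis using d(1) by (intro that[of N]) (auto simp: field_simps)
  qed
  have "compact (\<phi> ` {0..l})" by (intro compact_continuous_image \<phi>c compact_Icc)
  then obtain P where P: "\<And>t. t \<in> {0..l} \<Longrightarrow> norm (\<phi> t) \<le> P"
    using compact_imp_bounded bounded_iff by (metis image_eqI)
  have P0: "P \<ge> 0" using P[of 0] l norm_ge_zero[of "\<phi> 0"] by (smt (verit) atLeastAtMost_iff)
  \<comment> \<open>Beyond this radius the term coming from a primitive of size
    \<open>(B + 1) / cmod \<mu>\<close> is below \<open>e / 4\<close>. The maximum with 1 keeps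
    \<open>\<mu>\<close> off 0, and the added 1 makes the bound strict.\<close>
  define R where "R = max 1 (8 * real N * (B + 1) * (P + 1) / e + 1)"
  show ?thesis
  proof (rule exI[of _ R], intro allI impI ballI)
    fix \<mu> x assume mu: "\<bar>Im \<mu>\<bar> \<le> h \<and> R \<le> cmod \<mu>" and x: "x \<in> {0..l}"
    have mu0: "\<mu> \<noteq> 0" and mu1: "cmod \<mu> > 0" using mu by (auto simp: R_def)
    have X\<mu>: "norm (X \<mu> t) \<le> B" if "t \<in> {0..l}" for t using XB mu that by auto
    define E where "E t = sc t * X \<mu> t" for t
    have Ei: "E absolutely_integrable_on {0..l}" unfolding E_def by (intro absint_mult_cont sci Xc)
    have prim: "norm (integral {0..y} E) \<le> (B + 1) / cmod \<mu>" if y: "y \<in> {0..l}" for y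
    proof -
      have c: "(\<lambda>t. - \<i> * \<mu> * sc t) absolutely_integrable_on {0..y}"
        using absint_subinterval[OF sci, of 0 y] y by (intro set_integrable_mult_right) auto
      have i: "integral {0..t} (\<lambda>t. - \<i> * \<mu> * sc t) = - \<i> * \<mu> * complex_of_real (\<sigma> t)" if "t \<in> {0..y}" for t
        using s\<sigma>[of t] that y by simp
      have "((\<lambda>t. - \<i> * \<mu> * sc t * exp (integral {0..t} (\<lambda>t. - \<i> * \<mu> * sc t))) has_integral exp (integral {0..y} (\<lambda>t. - \<i> * \<mu> * sc t)) - 1) {0..y}"
        using ac_exp[OF _ c] y by auto
      then have "((\<lambda>t. - \<i> * \<mu> * E t) has_integral X \<mu> y - 1) {0..y}"
        by (rule has_integral_eq_rhs[OF has_integral_eq, rotated]) (use i y s\<sigma>[of y] in \<open>auto simp: E_def X_def\<close>)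
      then have "integral {0..y} (\<lambda>t. - \<i> * \<mu> * E t) = X \<mu> y - 1" by (rule integral_unique)
      then have "norm (- \<i> * \<mu> * integral {0..y} E) = norm (X \<mu> y - 1)" by simp
      also have "\<dots> \<le> B + 1" using X\<mu>[OF y] norm_triangle_ineq4[of "X \<mu> y" 1] by simp
      finally show ?thesis using mu1 by (simp add: norm_mult field_simps)
    qed
    have Eint: "integral {0..l} (\<lambda>t. norm (E t)) \<le> B * L"
    proof -
      have "integral {0..l} (\<lambda>t. norm (E t)) \<le> integral {0..l} (\<lambda>t. B * norm (sc t))"
      proof (rule integral_le)
        show "(\<lambda>t. norm (E t)) integrable_on {0..l}" using absint_norm[OF Ei] by (simp add: absolutely_integrable_on_def)
        show "(\<lambda>t. B * norm (sc t)) integrable_on {0..l}"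
          using absint_norm[OF sci] by (intro integrable_on_mult_right) (simp add: absolutely_integrable_on_def)
        show "norm (E t) \<le> B * norm (sc t)" if "t \<in> {0..l}" for t
          unfolding E_def norm_mult using mult_left_mono[OF X\<mu>[OF that], of "norm (sc t)"] by (simp add: mult.commute)
      qed
      then show ?thesis by (simp add: L_def)
    qed
    have I2: "norm (integral {0..x} (\<lambda>t. E t * \<phi> t)) \<le> 2 * real N * ((B + 1) / cmod \<mu>) * P + \<omega> * integral {0..l} (\<lambda>t. norm (E t))"
      by (rule small_primitive_bound[OF l Ei \<phi>c P _ prim N(1) x])
         (use d(2) N(2) in \<open>auto simp: dist_norm intro!: less_imp_le\<close>)
    have "2 * real N * ((B + 1) / cmod \<mu>) * P \<le> 2 * real N * (B + 1) * (P + 1) / cmod \<mu>"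
      using B P0 mu1 by (simp add: divide_right_mono mult_left_mono)
    also have "\<dots> < e / 4"
    proof -
      have "8 * real N * (B + 1) * (P + 1) / e < cmod \<mu>" using mu by (simp add: R_def)
      then show ?thesis using e mu1 by (simp add: field_simps)
    qed
    finally have t1: "2 * real N * ((B + 1) / cmod \<mu>) * P < e / 4" .
    have "\<omega> * integral {0..l} (\<lambda>t. norm (E t)) \<le> \<omega> * (B * (L + 1))"
      using Eint om B L0 by (intro mult_left_mono) (auto simp: algebra_simps)
    also have "\<dots> = e / 4"
    proof -
      have "B \<noteq> 0" "L + 1 \<noteq> 0" using B L0 by auto
      then show ?thesis by (simp add: \<omega>_def divide_simps)
    qed
    finally have t2: "\<omega> * integral {0..l} (\<lambda>t. norm (E t)) \<le> e / 4" .
    have di: "(\<lambda>t. gt t - \<phi> t) absolutely_integrable_on {0..l}"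
      by (intro set_integral_diff gti absolutely_integrable_continuous_real \<phi>c)
    \<comment> \<open>The error of replacing \<open>gt\<close> by \<open>\<phi>\<close>: outside the
      two null sets it equals \<open>X \<mu> t * sc t * (gt t - \<phi> t)\<close>.\<close>
    define v where "v = (\<lambda>t. q t * X \<mu> t - E t * \<phi> t)"
    have vi: "v absolutely_integrable_on {0..x}"
    proof (rule absint_subinterval)
      show "v absolutely_integrable_on {0..l}"
        unfolding v_def by (intro set_integral_diff absint_mult_cont q Xc Ei \<phi>c)
    qed (use x in auto)
    have dxi: "(\<lambda>t. (gt t - \<phi> t)) absolutely_integrable_on {0..x}"
      using absint_subinterval[OF di] x by auto
    have "norm (integral {0..x} v) \<le> integral {0..x} (\<lambda>t. norm (v t))"
      by (rule integral_norm_le[OF vi])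
    also have "\<dots> = integral {0..x} (\<lambda>t. if t \<in> N1 \<union> N2 then 0 else norm (v t))"
      by (rule integral_spike[of "N1 \<union> N2"]) (use N1 N2 in auto)
    also have "\<dots> \<le> integral {0..x} (\<lambda>t. (B * M') * norm (gt t - \<phi> t))"
    proof (rule integral_le)
      have "(\<lambda>t. norm (v t)) integrable_on {0..x}" using absint_norm[OF vi] by (simp add: absolutely_integrable_on_def)
      then show "(\<lambda>t. if t \<in> N1 \<union> N2 then 0 else norm (v t)) integrable_on {0..x}"
        by (rule integrable_spike[of _ _ "N1 \<union> N2"]) (use N1 N2 in auto)
      show "(\<lambda>t. (B * M') * norm (gt t - \<phi> t)) integrable_on {0..x}"
        using absint_norm[OF dxi] by (intro integrable_on_mult_right) (simp add: absolutely_integrable_on_def)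
      fix t assume t: "t \<in> {0..x}"
      show "(if t \<in> N1 \<union> N2 then 0 else norm (v t)) \<le> (B * M') * norm (gt t - \<phi> t)"
      proof (cases "t \<in> N1 \<union> N2")
        case False
        have st: "\<theta> \<le> \<bar>s t\<bar>" "\<bar>s t\<bar> \<le> M'" using N1(2)[of t] N2(2)[of t] False t x by (auto simp: M'_def)
        have "v t = X \<mu> t * sc t * (gt t - \<phi> t)"
        proof -
          have "sc t \<noteq> 0" using st(1) th(1) by (auto simp: sc_def)
          then have "q t = gt t * sc t" using st(1) by (simp add: gt_def g_def sc_def)
          then show ?thesis by (simp add: v_def E_def algebra_simps)
        qed
        then have "norm (v t) = norm (X \<mu> t) * \<bar>s t\<bar> * norm (gt t - \<phi> t)" by (simp add: norm_mult sc_def)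
        also have "\<dots> \<le> B * M' * norm (gt t - \<phi> t)"
          using X\<mu>[of t] st t x B by (intro mult_right_mono mult_mono) auto
        finally show ?thesis using False by simp
      qed (use B M' in auto)
    qed
    also have "\<dots> = (B * M') * integral {0..x} (\<lambda>t. norm (gt t - \<phi> t))" by simp
    also have "\<dots> \<le> (B * M') * integral {0..l} (\<lambda>t. norm (gt t - \<phi> t))"
      using integral_norm_mono[OF di, of x l] x B M' by (intro mult_left_mono) auto
    also have "\<dots> < (B * M') * (e / (4 * B * M'))"
      using \<phi>(2) B M' by (intro mult_strict_left_mono) auto
    also have "\<dots> = e / 4" using B M' by simp
    finally have t3: "norm (integral {0..x} v) < e / 4" .
    have eq: "integral {0..x} (\<lambda>t. q t * X \<mu> t) = integral {0..x} v + integral {0..x} (\<lambda>t. E t * \<phi> t)"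
    proof -
      have "(\<lambda>t. q t * X \<mu> t) integrable_on {0..x}" "(\<lambda>t. E t * \<phi> t) integrable_on {0..x}"
        using absint_subinterval[OF absint_mult_cont[OF q Xc], of 0 x] absint_subinterval[OF absint_mult_cont[OF Ei \<phi>c], of 0 x] x
        by (auto simp: absolutely_integrable_on_def)
      then show ?thesis by (simp add: v_def Henstock_Kurzweil_Integration.integral_diff)
    qed
    have "norm (integral {0..x} (\<lambda>t. q t * X \<mu> t)) < e"
    proof -
      have "norm (integral {0..x} (\<lambda>t. E t * \<phi> t)) < e / 4 + e / 4"
        using I2 add_less_le_mono[OF t1 t2] by (rule le_less_trans)
      with t3 have "norm (integral {0..x} v) + norm (integral {0..x} (\<lambda>t. E t * \<phi> t)) < e / 4 + (e / 4 + e / 4)"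
        by (rule add_strict_mono)
      then show ?thesis
        unfolding eq using e by (intro le_less_trans[OF norm_triangle_ineq]) simp
    qed
    then show "norm (integral {0..x} (\<lambda>t. q t * exp (- \<i> * \<mu> * complex_of_real (integral {0..t} s)))) < e"
      by (simp add: X_def \<sigma>_def)
  qed
qed

section \<open>The first-order system and its fundamental matrix\<close>

lemma absint_of_real: "s absolutely_integrable_on S \<Longrightarrow> (\<lambda>t. complex_of_real (s t)) absolutely_integrable_on S"
  using absolutely_integrable_linear[OF _ bounded_linear_of_real, of S s] by (simp add: o_def)

lemma integral_of_real_complex:
  "s integrable_on S \<Longrightarrow> integral S (\<lambda>t. complex_of_real (s t)) = complex_of_real (integral S s)"
  using integral_linear[where h = complex_of_real, OF _ bounded_linear_of_real, of s S] by (simp add: o_def)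

section \<open>Reduction of the differential system to a Volterra equation\<close>

locale dirac =
  fixes n :: nat and l :: real and \<beta> :: "nat \<Rightarrow> real \<Rightarrow> real"
    and Q :: "nat \<Rightarrow> nat \<Rightarrow> real \<Rightarrow> complex"
  assumes l_pos: "l > 0"
    and beta_meas: "\<forall>k<n. \<beta> k \<in> borel_measurable (lebesgue_on {0..l})"
    and beta_bdd: "\<forall>k<n. \<exists>M. AE x in lebesgue_on {0..l}. \<bar>\<beta> k x\<bar> \<le> M"
    and beta_inv_bdd: "\<forall>k<n. \<exists>M. AE x in lebesgue_on {0..l}. \<bar>1 / \<beta> k x\<bar> \<le> M"
    and beta_sign: "\<forall>k<n. (AE x in lebesgue_on {0..l}. \<beta> k x < 0) \<or> (AE x in lebesgue_on {0..l}. \<beta> k x > 0)"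
    and Q_L1: "\<forall>j<n. \<forall>k<n. Q j k absolutely_integrable_on {0..l}"
begin

lemma beta_int: "k < n \<Longrightarrow> \<beta> k absolutely_integrable_on {0..l}"
  using beta_meas beta_bdd integrable_on_bounded_measurable by blast

lemma betac_int: "k < n \<Longrightarrow> (\<lambda>t. complex_of_real (\<beta> k t)) absolutely_integrable_on {0..l}"
  by (intro absint_of_real beta_int)

definition Bl :: real where "Bl = (\<Sum>k<n. integral {0..l} (\<lambda>t. \<bar>\<beta> k t\<bar>))"

lemma Bl_ge: "k < n \<Longrightarrow> integral {0..l} (\<lambda>t. \<bar>\<beta> k t\<bar>) \<le> Bl" and Bl_nonneg: "0 \<le> Bl"
proof -
  have nn: "0 \<le> integral {0..l} (\<lambda>t. \<bar>\<beta> k t\<bar>)" if "k < n" for k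
    using absint_norm[OF beta_int[OF that]] by (intro Henstock_Kurzweil_Integration.integral_nonneg) (auto simp: absolutely_integrable_on_def)
  then show "0 \<le> Bl" unfolding Bl_def by (intro sum_nonneg) auto
  show "k < n \<Longrightarrow> integral {0..l} (\<lambda>t. \<bar>\<beta> k t\<bar>) \<le> Bl"
    unfolding Bl_def by (rule member_le_sum[where f = "\<lambda>k. integral {0..l} (\<lambda>t. \<bar>\<beta> k t\<bar>)"]) (use nn in auto)
qed

text \<open>The system with right-hand side \<open>\<mu> * y + h\<close>, solved for the derivative,
  has this matrix as its coefficient: the spectral parameter sits on the diagonal of the Volterra
  kernel.\<close>

definition ker :: "complex \<Rightarrow> nat \<Rightarrow> nat \<Rightarrow> real \<Rightarrow> complex" where
  "ker \<mu> j k t = (if j = k then \<i> * \<mu> * complex_of_real (\<beta> j t) else 0) - Q j k t"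

sublocale V: volterra n l "ker \<mu>" for \<mu>
proof
  show "0 \<le> l" using l_pos by simp
  show "ker \<mu> j k absolutely_integrable_on {0..l}" if "j < n" "k < n" for j k
  proof -
    have "(\<lambda>t. if j = k then \<i> * \<mu> * complex_of_real (\<beta> j t) else 0) absolutely_integrable_on {0..l}"
      using betac_int[OF that(1)] by (cases "j = k") (auto intro!: set_integrable_mult_right)
    then show ?thesis unfolding ker_def using Q_L1 that by (intro set_integral_diff) auto
  qed
qed

abbreviation "cont \<equiv> V.cont"

text \<open>The free term that a right-hand side \<open>h\<close> adds to the Volterra
  equation.\<close>

definition Bint :: "(real \<Rightarrow> nat \<Rightarrow> complex) \<Rightarrow> real \<Rightarrow> nat \<Rightarrow> complex" where
  "Bint h x j = integral {0..x} (\<lambda>t. \<i> * complex_of_real (\<beta> j t) * h t j)"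

lemma Bint_integrand: "cont h \<Longrightarrow> j < n \<Longrightarrow> (\<lambda>t. \<i> * complex_of_real (\<beta> j t) * h t j) absolutely_integrable_on {0..l}"
  by (intro absint_mult_cont set_integrable_mult_right betac_int) (auto simp: V.cont_def)

lemma Bint_has_integral: "cont h \<Longrightarrow> j < n \<Longrightarrow> x \<in> {0..l} \<Longrightarrow>
   ((\<lambda>t. \<i> * complex_of_real (\<beta> j t) * h t j) has_integral Bint h x j) {0..x}"
  unfolding Bint_def
  by (intro integrable_integral)
     (use absint_subinterval[OF Bint_integrand, of h j 0 x] in \<open>auto simp: absolutely_integrable_on_def\<close>)

lemma Bint_cont: "cont h \<Longrightarrow> cont (Bint h)"
  unfolding V.cont_def Bint_def using indef_cont[OF Bint_integrand[unfolded V.cont_def]] by auto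

lemma Bint_bound:
  assumes h: "cont h" and H: "0 \<le> H" "\<And>t j. t \<in> {0..l} \<Longrightarrow> j < n \<Longrightarrow> norm (h t j) \<le> H"
    and x: "x \<in> {0..l}" and j: "j < n"
  shows "norm (Bint h x j) \<le> Bl * H"
proof -
  have b: "(\<lambda>t. \<i> * complex_of_real (\<beta> j t)) absolutely_integrable_on {0..l}"
    by (intro set_integrable_mult_right betac_int j)
  have "norm (Bint h x j) \<le> H * integral {0..x} (\<lambda>t. norm (\<i> * complex_of_real (\<beta> j t)))"
    unfolding Bint_def
    by (rule integral_product_bound)
       (use absint_subinterval[OF b, of 0 x] x j h H in \<open>auto simp: V.cont_def intro: continuous_on_subset\<close>)
  also have "\<dots> \<le> H * integral {0..l} (\<lambda>t. norm (\<i> * complex_of_real (\<beta> j t)))"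
    using integral_norm_mono[OF b, of x l] x H by (intro mult_left_mono) auto
  also have "\<dots> = H * integral {0..l} (\<lambda>t. \<bar>\<beta> j t\<bar>)" by (simp add: norm_mult)
  also have "\<dots> \<le> H * Bl" by (intro mult_left_mono Bl_ge j H)
  finally show ?thesis by (simp add: mult.commute)
qed

lemma ac_solves_cont: "ac_solves n l \<beta> Q y g \<Longrightarrow> cont y"
  by (simp add: ac_solves_def V.cont_def)

lemma T_plus_Bint_integrand:
  assumes "j < n"
  shows "(\<Sum>k<n. ker \<mu> j k t * y t k) + \<i> * complex_of_real (\<beta> j t) * h t j =
     \<i> * complex_of_real (\<beta> j t) * (\<mu> * y t j + h t j) - (\<Sum>k<n. Q j k t * y t k)"
proof -
  have "(\<Sum>k<n. ker \<mu> j k t * y t k) =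
      (\<Sum>k<n. if j = k then \<i> * \<mu> * complex_of_real (\<beta> j t) * y t j else 0) - (\<Sum>k<n. Q j k t * y t k)"
    unfolding ker_def sum_subtractf[symmetric] by (intro sum.cong) (auto simp: algebra_simps)
  then show ?thesis using assms by (simp add: algebra_simps)
qed

text \<open>The bridge to the Volterra theory, which supplies existence, uniqueness and bounds; the
  free term is the initial value plus \<open>Bint h\<close>.\<close>

lemma ac_solves_iff:
  assumes h: "cont h"
  shows "ac_solves n l \<beta> Q y (\<lambda>x j. \<mu> * y x j + h x j) \<longleftrightarrow>
     cont y \<and> (\<forall>x\<in>{0..l}. \<forall>j<n. y x j = y 0 j + Bint h x j + V.T \<mu> y x j)"
proof (cases "cont y")
  case y: True
  have hi: "((\<lambda>t. \<i> * complex_of_real (\<beta> j t) * (\<mu> * y t j + h t j) - (\<Sum>k<n. Q j k t * y t k))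
      has_integral V.T \<mu> y x j + Bint h x j) {0..x}" if "j < n" "x \<in> {0..l}" for j x
    using has_integral_add[OF V.T_has_integral[OF y that] Bint_has_integral[OF h that]]
    unfolding T_plus_Bint_integrand[OF that(1)] .
  have eq: "((\<lambda>t. \<i> * complex_of_real (\<beta> j t) * (\<mu> * y t j + h t j) - (\<Sum>k<n. Q j k t * y t k))
      has_integral y x j - y 0 j) {0..x} \<longleftrightarrow> y x j = y 0 j + Bint h x j + V.T \<mu> y x j"
    if "j < n" "x \<in> {0..l}" for j x
  proof
    assume "((\<lambda>t. \<i> * complex_of_real (\<beta> j t) * (\<mu> * y t j + h t j) - (\<Sum>k<n. Q j k t * y t k)) has_integral y x j - y 0 j) {0..x}"
    from has_integral_unique[OF this hi[OF that]] show "y x j = y 0 j + Bint h x j + V.T \<mu> y x j"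
      by (simp add: algebra_simps)
  next
    assume "y x j = y 0 j + Bint h x j + V.T \<mu> y x j"
    then have "y x j - y 0 j = V.T \<mu> y x j + Bint h x j" by (simp add: algebra_simps)
    then show "((\<lambda>t. \<i> * complex_of_real (\<beta> j t) * (\<mu> * y t j + h t j) - (\<Sum>k<n. Q j k t * y t k)) has_integral y x j - y 0 j) {0..x}"
      using hi[OF that] by simp
  qed
  show ?thesis using y eq unfolding ac_solves_def V.cont_def by blast
qed (auto simp: ac_solves_def V.cont_def)

lemma ac_solves_cong:
  assumes "ac_solves n l \<beta> Q y g"
    and "\<And>x j. x \<in> {0..l} \<Longrightarrow> j < n \<Longrightarrow> y' x j = y x j" "\<And>x j. x \<in> {0..l} \<Longrightarrow> j < n \<Longrightarrow> g' x j = g x j"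
  shows "ac_solves n l \<beta> Q y' g'"
  unfolding ac_solves_def
proof (intro conjI allI impI ballI)
  fix j assume j: "j < n"
  show "continuous_on {0..l} (\<lambda>x. y' x j)"
    using assms(1) j by (subst continuous_on_cong[OF refl assms(2)]) (auto simp: ac_solves_def)
  fix x assume x: "x \<in> {0..l}"
  have "((\<lambda>t. \<i> * complex_of_real (\<beta> j t) * g t j - (\<Sum>k<n. Q j k t * y t k)) has_integral (y x j - y 0 j)) {0..x}"
    using assms(1) x j by (auto simp: ac_solves_def)
  then show "((\<lambda>t. \<i> * complex_of_real (\<beta> j t) * g' t j - (\<Sum>k<n. Q j k t * y' t k)) has_integral (y' x j - y' 0 j)) {0..x}"
    by (rule has_integral_eq_rhs[OF has_integral_eq, rotated])
       (use x j assms in \<open>auto intro!: arg_cong2[of _ _ _ _ "(-)"] sum.cong\<close>)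
qed

text \<open>The operator has its values in a space of classes modulo null sets; the integrated
  equation does not see the difference.\<close>

lemma ac_solves_AE:
  assumes "ac_solves n l \<beta> Q y g" "H_eq n l g g'"
  shows "ac_solves n l \<beta> Q y g'"
proof -
  obtain N where N: "negligible N" "\<And>x. x \<in> {0..l} - N \<Longrightarrow> \<forall>k<n. g x k = g' x k"
    using AE_lebesgue_on_negligible[OF assms(2)[unfolded H_eq_def]] by auto
  show ?thesis
    unfolding ac_solves_def
  proof (intro conjI allI impI ballI)
    fix j assume j: "j < n"
    show "continuous_on {0..l} (\<lambda>x. y x j)" using assms(1) j by (auto simp: ac_solves_def)
    fix x assume x: "x \<in> {0..l}"
    have "((\<lambda>t. \<i> * complex_of_real (\<beta> j t) * g t j - (\<Sum>k<n. Q j k t * y t k)) has_integral (y x j - y 0 j)) {0..x}"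
      using assms(1) x j by (auto simp: ac_solves_def)
    then show "((\<lambda>t. \<i> * complex_of_real (\<beta> j t) * g' t j - (\<Sum>k<n. Q j k t * y t k)) has_integral (y x j - y 0 j)) {0..x}"
      by (rule has_integral_spike[OF N(1), rotated]) (use N(2) x j in auto)
  qed
qed

lemma ac_solves_sum:
  assumes "finite I" "\<And>i. i \<in> I \<Longrightarrow> ac_solves n l \<beta> Q (y i) (g i)"
  shows "ac_solves n l \<beta> Q (\<lambda>x j. \<Sum>i\<in>I. c i * y i x j) (\<lambda>x j. \<Sum>i\<in>I. c i * g i x j)"
  unfolding ac_solves_def
proof (intro conjI allI impI ballI)
  fix j assume j: "j < n"
  show "continuous_on {0..l} (\<lambda>x. \<Sum>i\<in>I. c i * y i x j)"
    using assms j by (intro continuous_intros) (auto simp: ac_solves_def)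
  fix x assume x: "x \<in> {0..l}"
  have "((\<lambda>t. \<Sum>i\<in>I. c i * (\<i> * complex_of_real (\<beta> j t) * g i t j - (\<Sum>k<n. Q j k t * y i t k)))
     has_integral (\<Sum>i\<in>I. c i * (y i x j - y i 0 j))) {0..x}"
    using assms x j by (intro has_integral_sum has_integral_mult_right) (auto simp: ac_solves_def)
  moreover have "(\<Sum>i\<in>I. c i * (\<i> * complex_of_real (\<beta> j t) * g i t j - (\<Sum>k<n. Q j k t * y i t k))) =
     \<i> * complex_of_real (\<beta> j t) * (\<Sum>i\<in>I. c i * g i t j) - (\<Sum>k<n. Q j k t * (\<Sum>i\<in>I. c i * y i t k))" for t
  proof -
    have "(\<Sum>i\<in>I. c i * (\<Sum>k<n. Q j k t * y i t k)) = (\<Sum>k<n. Q j k t * (\<Sum>i\<in>I. c i * y i t k))"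
      unfolding sum_distrib_left by (subst sum.swap) (simp add: algebra_simps)
    then show ?thesis
      by (simp add: right_diff_distrib sum_subtractf sum_distrib_left mult.assoc mult.left_commute)
  qed
  ultimately show "((\<lambda>t. \<i> * complex_of_real (\<beta> j t) * (\<Sum>i\<in>I. c i * g i t j) - (\<Sum>k<n. Q j k t * (\<Sum>i\<in>I. c i * y i t k)))
     has_integral (\<Sum>i\<in>I. c i * y i x j) - (\<Sum>i\<in>I. c i * y i 0 j)) {0..x}"
    by (simp add: right_diff_distrib sum_subtractf)
qed

lemma ac_solves_diff:
  assumes "ac_solves n l \<beta> Q y g" "ac_solves n l \<beta> Q y' g'"
  shows "ac_solves n l \<beta> Q (\<lambda>x j. y x j - y' x j) (\<lambda>x j. g x j - g' x j)"
  using ac_solves_sum[of "{True, False}" "\<lambda>b. if b then y else y'" "\<lambda>b. if b then g else g'" "\<lambda>b. if b then 1 else -1"] assms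
  by simp

section \<open>The Cauchy problem and its dependence on the spectral parameter\<close>

definition Kc :: "complex \<Rightarrow> real" where "Kc \<mu> = exp (V.N \<mu> l)"

lemma Kc_pos: "Kc \<mu> > 0" by (simp add: Kc_def)

lemma ac_bound:
  assumes ac: "ac_solves n l \<beta> Q y (\<lambda>x j. \<mu> * y x j + h x j)" and h: "cont h"
    and G: "0 \<le> G" "\<And>x j. x \<in> {0..l} \<Longrightarrow> j < n \<Longrightarrow> norm (y 0 j + Bint h x j) \<le> G"
    and xj: "x \<in> {0..l}" "j < n"
  shows "norm (y x j) \<le> G * Kc \<mu>"
  unfolding Kc_def
proof (rule V.a_priori_bound[OF _ _ _ G xj])
  show "cont y" using ac by (rule ac_solves_cont)
  show "cont (\<lambda>x j. y 0 j + Bint h x j)"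
    using Bint_cont[OF h] unfolding V.cont_def by (auto intro: continuous_intros)
  show "y x j = y 0 j + Bint h x j + V.T \<mu> y x j" if "x \<in> {0..l}" "j < n" for x j
    using ac that unfolding ac_solves_iff[OF h] by blast
qed

lemma cont_zero: "cont (\<lambda>x j. 0)" by (simp add: V.cont_def)

lemma ac_unique:
  assumes "ac_solves n l \<beta> Q y (\<lambda>x j. \<mu> * y x j + h x j)" "ac_solves n l \<beta> Q y' (\<lambda>x j. \<mu> * y' x j + h' x j)"
    and "\<And>x j. x \<in> {0..l} \<Longrightarrow> j < n \<Longrightarrow> h x j = h' x j" "\<And>j. j < n \<Longrightarrow> y 0 j = y' 0 j"
    and xj: "x \<in> {0..l}" "j < n"
  shows "y x j = y' x j"
proof -
  have "ac_solves n l \<beta> Q (\<lambda>x j. y x j - y' x j) (\<lambda>x j. \<mu> * (y x j - y' x j) + 0)"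
    by (rule ac_solves_cong[OF ac_solves_diff[OF assms(1,2)]]) (use assms(3) in \<open>auto simp: algebra_simps\<close>)
  then have "norm (y x j - y' x j) \<le> 0 * Kc \<mu>"
    by (rule ac_bound[OF _ cont_zero _ _ xj]) (use assms(4) in \<open>auto simp: Bint_def\<close>)
  then show ?thesis by simp
qed

lemma ac_exists:
  assumes h: "cont h"
  shows "\<exists>y. ac_solves n l \<beta> Q y (\<lambda>x j. \<mu> * y x j + h x j) \<and> (\<forall>j<n. y 0 j = a j)"
proof -
  have "cont (\<lambda>x j. a j + Bint h x j)"
    using Bint_cont[OF h] unfolding V.cont_def by (auto intro: continuous_intros)
  then obtain y where y: "cont y" "\<And>x j. x \<in> {0..l} \<Longrightarrow> j < n \<Longrightarrow> y x j = a j + Bint h x j + V.T \<mu> y x j"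
    using V.solution by blast
  have y0: "y 0 j = a j" if "j < n" for j using y(2)[of 0 j] that l_pos by (simp add: Bint_def V.T_def)
  have "\<forall>x\<in>{0..l}. \<forall>j<n. y x j = y 0 j + Bint h x j + V.T \<mu> y x j"
  proof (intro ballI allI impI)
    fix x j assume "x \<in> {0..l}" "j < n"
    then show "y x j = y 0 j + Bint h x j + V.T \<mu> y x j" unfolding y0[OF \<open>j < n\<close>] by (rule y(2))
  qed
  then show ?thesis using y(1) y0 ac_solves_iff[OF h] by blast
qed

text \<open>The choice is determined only on \<open>{0..l}\<close> and for components below
  \<open>n\<close>; equalities between solutions are therefore always restricted to this
  range.\<close>

definition sol :: "complex \<Rightarrow> (nat \<Rightarrow> complex) \<Rightarrow> (real \<Rightarrow> nat \<Rightarrow> complex) \<Rightarrow> real \<Rightarrow> nat \<Rightarrow> complex" where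
  "sol \<mu> a h = (SOME y. ac_solves n l \<beta> Q y (\<lambda>x j. \<mu> * y x j + h x j) \<and> (\<forall>j<n. y 0 j = a j))"

lemma sol:
  assumes "cont h"
  shows "ac_solves n l \<beta> Q (sol \<mu> a h) (\<lambda>x j. \<mu> * sol \<mu> a h x j + h x j)" "j < n \<Longrightarrow> sol \<mu> a h 0 j = a j"
  using someI_ex[OF ac_exists[OF assms, of \<mu> a]] unfolding sol_def by auto

text \<open>\<open>Phi \<mu> i\<close> is the \<open>i\<close>-th Taylor coefficient of the fundamental matrix at \<open>\<mu>\<close>.\<close>

primrec Phi :: "complex \<Rightarrow> nat \<Rightarrow> real \<Rightarrow> nat \<Rightarrow> nat \<Rightarrow> complex" where
  "Phi \<mu> 0 = (\<lambda>x j k. sol \<mu> (\<lambda>j. if j = k then 1 else 0) (\<lambda>x j. 0) x j)"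
| "Phi \<mu> (Suc i) = (\<lambda>x j k. sol \<mu> (\<lambda>j. 0) (\<lambda>x j. Phi \<mu> i x j k) x j)"

lemma Phi_cont: "cont (\<lambda>x j. Phi \<mu> i x j k)"
  by (induction i) (auto intro!: ac_solves_cont sol cont_zero)

lemma Phi_ac_0: "ac_solves n l \<beta> Q (\<lambda>x j. Phi \<mu> 0 x j k) (\<lambda>x j. \<mu> * Phi \<mu> 0 x j k)"
  using sol(1)[OF cont_zero] by simp

lemma Phi_ac_Suc:
  "ac_solves n l \<beta> Q (\<lambda>x j. Phi \<mu> (Suc i) x j k) (\<lambda>x j. \<mu> * Phi \<mu> (Suc i) x j k + Phi \<mu> i x j k)"
  using sol(1)[OF Phi_cont] by simp

lemma Phi_at_0: "j < n \<Longrightarrow> Phi \<mu> i 0 j k = (if i = 0 \<and> j = k then 1 else 0)"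
  by (cases i) (auto simp: sol cont_zero Phi_cont)

text \<open>Each coefficient solves the system with zero initial value and the preceding coefficient
  as inhomogeneity, which costs a factor \<open>Bl * Kc \<mu>\<close>. Geometric growth gives a
  positive radius of convergence.\<close>

lemma Phi_bound:
  assumes "x \<in> {0..l}" "j < n"
  shows "norm (Phi \<mu> i x j k) \<le> Kc \<mu> * (Bl * Kc \<mu>) ^ i"
  using assms
proof (induction i arbitrary: x j)
  case 0
  have "norm (Phi \<mu> 0 x j k) \<le> 1 * Kc \<mu>"
    by (rule ac_bound[of _ _ "\<lambda>x j. 0"]) (use 0 Phi_ac_0[of \<mu> k] cont_zero Phi_at_0[of _ \<mu> 0] in \<open>auto simp: Bint_def\<close>)
  then show ?case by simp
next
  case (Suc i)
  have "norm (Phi \<mu> (Suc i) x j k) \<le> (Bl * (Kc \<mu> * (Bl * Kc \<mu>) ^ i)) * Kc \<mu>"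
  proof (rule ac_bound[OF Phi_ac_Suc Phi_cont _ _ Suc.prems])
    show "0 \<le> Bl * (Kc \<mu> * (Bl * Kc \<mu>) ^ i)" using Kc_pos[of \<mu>] Bl_nonneg by simp
    show "norm (Phi \<mu> (Suc i) 0 j k + Bint (\<lambda>x j. Phi \<mu> i x j k) x j) \<le> Bl * (Kc \<mu> * (Bl * Kc \<mu>) ^ i)"
      if "x \<in> {0..l}" "j < n" for x j
      using that Kc_pos[of \<mu>] Bl_nonneg Suc.IH Phi_at_0[of j \<mu> "Suc i"]
      by (auto simp del: Phi.simps intro!: Bint_bound Phi_cont)
  qed
  then show ?case by (simp add: algebra_simps)
qed

text \<open>\<open>Phi \<mu> 0\<close>, extended by 0, has the required Cauchy data; uniqueness of
  the Cauchy problem and the zero normalization make it the only candidate for the definite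
  description.\<close>

lemma fund_eq:
  "fund n l \<beta> Q \<mu> = (\<lambda>x j k. if x \<in> {0..l} \<and> j < n \<and> k < n then Phi \<mu> 0 x j k else 0)" (is "_ = ?F")
  unfolding fund_def
proof (rule the_equality)
  show "is_fund n l \<beta> Q \<mu> ?F"
    unfolding is_fund_def
  proof (intro conjI allI impI)
    fix k assume "k < n"
    then show "ac_solves n l \<beta> Q (\<lambda>x j. ?F x j k) (\<lambda>x j. \<mu> * ?F x j k)"
      by (intro ac_solves_cong[OF Phi_ac_0[of \<mu> k]]) auto
  qed (use l_pos Phi_at_0[of _ \<mu> 0] in \<open>auto simp del: Phi.simps\<close>)
next
  fix F assume F: "is_fund n l \<beta> Q \<mu> F"
  show "F = ?F"
  proof (intro ext)
    fix x j k
    show "F x j k = ?F x j k"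
    proof (cases "x \<in> {0..l} \<and> j < n \<and> k < n")
      case True
      have "F x j k = Phi \<mu> 0 x j k"
        by (rule ac_unique[of "\<lambda>x j. F x j k" \<mu> "\<lambda>x j. 0" "\<lambda>x j. Phi \<mu> 0 x j k" "\<lambda>x j. 0"])
           (use F True Phi_ac_0[of \<mu> k] Phi_at_0[of _ \<mu> 0] in \<open>auto simp: is_fund_def simp del: Phi.simps\<close>)
      then show ?thesis using True by simp
    next
      case False
      then have "F x j k = 0" using F unfolding is_fund_def by (metis not_le)
      then show ?thesis using False by auto
    qed
  qed
qed

lemma fund_ac: "ac_solves n l \<beta> Q (\<lambda>x j. fund n l \<beta> Q \<mu> x j k) (\<lambda>x j. \<mu> * fund n l \<beta> Q \<mu> x j k)"
proof (cases "k < n")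
  case True
  then show ?thesis by (intro ac_solves_cong[OF Phi_ac_0[of \<mu> k]]) (auto simp: fund_eq)
next
  case False
  then show ?thesis by (simp add: fund_eq ac_solves_def)
qed

lemma fund_at_0: "j < n \<Longrightarrow> k < n \<Longrightarrow> fund n l \<beta> Q \<mu> 0 j k = (if j = k then 1 else 0)"
  using l_pos Phi_at_0[of j \<mu> 0] by (simp add: fund_eq del: Phi.simps)

text \<open>The difference between \<open>fund\<close> and the partial sum \<open>S m\<close> solves
  the system for \<open>\<mu> + z\<close> with zero initial value and the single inhomogeneity
  \<open>z ^ Suc m * Phi \<mu> m\<close>, since all other terms telescope. Its size is therefore at
  most a multiple of \<open>q ^ Suc m\<close>.\<close>

lemma fund_sums:
  assumes z: "cmod z * (Bl * Kc \<mu>) < 1" and x: "x \<in> {0..l}" and jk: "j < n" "k < n"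
  shows "(\<lambda>i. Phi \<mu> i x j k * z ^ i) sums fund n l \<beta> Q (\<mu> + z) x j k"
proof -
  let ?F = "fund n l \<beta> Q (\<mu> + z)"
  define S where "S m x j = (\<Sum>i\<le>m. z ^ i * Phi \<mu> i x j k)" for m x j
  define q where "q = cmod z * (Bl * Kc \<mu>)"
  have q0: "0 \<le> q" unfolding q_def using Bl_nonneg Kc_pos[of \<mu>] by simp
  have SS: "ac_solves n l \<beta> Q (S m) (\<lambda>x j. \<mu> * S m x j + (\<Sum>i<m. z ^ Suc i * Phi \<mu> i x j k))" for m
  proof -
    have "ac_solves n l \<beta> Q (\<lambda>x j. \<Sum>i\<le>m. z ^ i * Phi \<mu> i x j k)
       (\<lambda>x j. \<Sum>i\<le>m. z ^ i * (\<mu> * Phi \<mu> i x j k + (if i = 0 then 0 else Phi \<mu> (i - 1) x j k)))"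
    proof (rule ac_solves_sum)
      fix i show "ac_solves n l \<beta> Q (\<lambda>x j. Phi \<mu> i x j k) (\<lambda>x j. \<mu> * Phi \<mu> i x j k + (if i = 0 then 0 else Phi \<mu> (i - 1) x j k))"
        using Phi_ac_0[of \<mu> k] Phi_ac_Suc[of \<mu> "i - 1" k] by (cases i) (auto simp del: Phi.simps)
    qed simp
    then show ?thesis unfolding S_def
    proof (rule ac_solves_cong)
      fix x j
      have "(\<Sum>i\<le>m. z ^ i * (if i = 0 then 0 else Phi \<mu> (i - 1) x j k)) = (\<Sum>i<m. z ^ Suc i * Phi \<mu> i x j k)"
        by (subst sum.atMost_shift) simp
      then show "\<mu> * (\<Sum>i\<le>m. z ^ i * Phi \<mu> i x j k) + (\<Sum>i<m. z ^ Suc i * Phi \<mu> i x j k) =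
        (\<Sum>i\<le>m. z ^ i * (\<mu> * Phi \<mu> i x j k + (if i = 0 then 0 else Phi \<mu> (i - 1) x j k)))"
        by (simp add: distrib_left sum.distrib sum_distrib_left mult.left_commute)
    qed simp
  qed
  have RR: "ac_solves n l \<beta> Q (\<lambda>x j. ?F x j k - S m x j) (\<lambda>x j. (\<mu> + z) * (?F x j k - S m x j) + z ^ Suc m * Phi \<mu> m x j k)" for m
  proof (rule ac_solves_cong[OF ac_solves_diff[OF fund_ac SS]])
    fix x j
    have "z * S m x j = (\<Sum>i<m. z ^ Suc i * Phi \<mu> i x j k) + z ^ Suc m * Phi \<mu> m x j k"
      unfolding S_def sum_distrib_left by (simp add: lessThan_Suc_atMost[symmetric] mult.assoc)
    then show "(\<mu> + z) * (?F x j k - S m x j) + z ^ Suc m * Phi \<mu> m x j k =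
      (\<mu> + z) * ?F x j k - (\<mu> * S m x j + (\<Sum>i<m. z ^ Suc i * Phi \<mu> i x j k))"
      by (simp add: algebra_simps)
  qed simp
  have S0: "S m 0 j = (if j = k then 1 else 0)" if "j < n" for m j
    unfolding S_def using that by (simp add: Phi_at_0 if_distrib[of "(*) _"] del: Phi.simps cong: if_cong)
  have b: "norm (?F x j k - S m x j) \<le> q ^ Suc m * Kc (\<mu> + z)" for m
  proof (rule ac_bound[OF RR _ _ _ x jk(1)])
    show c: "cont (\<lambda>x j. z ^ Suc m * Phi \<mu> m x j k)"
      using Phi_cont[of \<mu> m k] unfolding V.cont_def by (auto intro!: continuous_intros simp del: Phi.simps)
    fix y i assume yi: "y \<in> {0..l}" "i < n"
    have "norm (Bint (\<lambda>x j. z ^ Suc m * Phi \<mu> m x j k) y i) \<le> Bl * (cmod z ^ Suc m * (Kc \<mu> * (Bl * Kc \<mu>) ^ m))"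
      using Kc_pos[of \<mu>] Bl_nonneg
      by (intro Bint_bound[OF c _ _ yi]) (auto simp: norm_mult norm_power simp del: Phi.simps intro!: mult_left_mono Phi_bound)
    also have "\<dots> = q ^ Suc m" by (simp add: q_def power_mult_distrib algebra_simps)
    finally show "norm (?F 0 i k - S m 0 i + Bint (\<lambda>x j. z ^ Suc m * Phi \<mu> m x j k) y i) \<le> q ^ Suc m"
      using yi jk by (simp add: S0 fund_at_0)
  qed (use q0 in simp)
  have "(\<lambda>m. q ^ Suc m * Kc (\<mu> + z)) \<longlonglongrightarrow> 0 * Kc (\<mu> + z)"
    by (intro tendsto_mult tendsto_const LIMSEQ_Suc LIMSEQ_realpow_zero) (use q0 z in \<open>auto simp: q_def\<close>)
  then have "(\<lambda>m. q ^ Suc m * Kc (\<mu> + z)) \<longlonglongrightarrow> 0" by simp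
  then have lim0: "(\<lambda>m. ?F x j k - S m x j) \<longlonglongrightarrow> 0"
    by (rule Lim_null_comparison[rotated]) (use b in simp)
  have "(\<lambda>m. S m x j) \<longlonglongrightarrow> ?F x j k"
    using tendsto_diff[OF tendsto_const[of "?F x j k"] lim0] by simp
  then show ?thesis unfolding sums_def_le S_def by (simp add: mult.commute del: Phi.simps)
qed

definition Phifps :: "complex \<Rightarrow> real \<Rightarrow> nat \<Rightarrow> nat \<Rightarrow> complex fps" where
  "Phifps \<mu> x j k = Abs_fps (\<lambda>i. Phi \<mu> i x j k)"

lemma fund_has_fps_expansion:
  assumes "x \<in> {0..l}" "j < n" "k < n"
  shows "(\<lambda>z. fund n l \<beta> Q (\<mu> + z) x j k) has_fps_expansion Phifps \<mu> x j k"
proof -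
  define r where "r = 1 / (Bl * Kc \<mu> + 1)"
  have BK: "0 \<le> Bl * Kc \<mu>" using Bl_nonneg Kc_pos[of \<mu>] by simp
  have r: "r > 0" using BK by (simp add: r_def)
  have s: "(\<lambda>i. fps_nth (Phifps \<mu> x j k) i * z ^ i) sums fund n l \<beta> Q (\<mu> + z) x j k" if "norm z < r" for z
  proof -
    have "cmod z * (Bl * Kc \<mu> + 1) < 1" using that BK by (simp add: r_def field_simps)
    then have "cmod z * (Bl * Kc \<mu>) < 1" using norm_ge_zero[of z] unfolding distrib_left by linarith
    then show ?thesis using fund_sums assms by (simp add: Phifps_def del: Phi.simps)
  qed
  have "fps_conv_radius (Phifps \<mu> x j k) \<ge> norm (complex_of_real (r/2))"
    unfolding fps_conv_radius_def
    by (rule conv_radius_geI) (use s[of "complex_of_real (r/2)"] r in \<open>auto simp: sums_iff\<close>)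
  then have "fps_conv_radius (Phifps \<mu> x j k) > 0"
    using r by (auto intro: less_le_trans[rotated])
  moreover have "eventually (\<lambda>z. eval_fps (Phifps \<mu> x j k) z = fund n l \<beta> Q (\<mu> + z) x j k) (nhds 0)"
  proof -
    have "eventually (\<lambda>z. z \<in> ball 0 r) (nhds (0::complex))" using r by (intro eventually_nhds_in_open) auto
    then show ?thesis
    proof eventually_elim
      case (elim z)
      then show ?case using s[of z] by (simp add: eval_fps_def sums_iff)
    qed
  qed
  ultimately show ?thesis unfolding has_fps_expansion_def by blast
qed

text \<open>Boundedness of \<open>1 / \<beta> k\<close> keeps the weight away from 0, and its
  constant sign excludes cancellation on every subinterval.\<close>

lemma beta_abs_integral_pos:
  assumes k: "k < n" and ab: "0 \<le> a" "a < b" "b \<le> l"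
  shows "0 < integral {a..b} (\<lambda>t. \<bar>\<beta> k t\<bar>)"
    and "norm (integral {a..b} (\<lambda>t. complex_of_real (\<beta> k t))) = integral {a..b} (\<lambda>t. \<bar>\<beta> k t\<bar>)"
proof -
  obtain M where M: "AE x in lebesgue_on {0..l}. \<bar>1 / \<beta> k x\<bar> \<le> M" using beta_inv_bdd k by blast
  obtain N where N: "negligible N" "\<And>x. x \<in> {0..l} - N \<Longrightarrow> \<bar>1 / \<beta> k x\<bar> \<le> M"
    using AE_lebesgue_on_negligible[OF M] by auto
  have bi: "\<beta> k absolutely_integrable_on {a..b}" using absint_subinterval[OF beta_int[OF k] ab(1,3)] .
  obtain N' s where N': "negligible N'" and s: "s = 1 \<or> s = -1" "\<And>x. x \<in> {0..l} - N' \<Longrightarrow> 0 < s * \<beta> k x"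
  proof -
    consider "AE x in lebesgue_on {0..l}. \<beta> k x < 0" | "AE x in lebesgue_on {0..l}. \<beta> k x > 0"
      using beta_sign k by blast
    then show ?thesis
    proof cases
      case 1
      then obtain N' where "negligible N'" "\<And>x. x \<in> {0..l} - N' \<Longrightarrow> \<beta> k x < 0"
        using AE_lebesgue_on_negligible[OF 1] by auto
      then show ?thesis by (intro that[of N' "-1"]) auto
    next
      case 2
      then obtain N' where "negligible N'" "\<And>x. x \<in> {0..l} - N' \<Longrightarrow> \<beta> k x > 0"
        using AE_lebesgue_on_negligible[OF 2] by auto
      then show ?thesis by (intro that[of N' 1]) auto
    qed
  qed
  define M' where "M' = max M 1"
  have low: "1 / M' \<le> \<bar>\<beta> k x\<bar>" if "x \<in> {0..l} - (N \<union> N')" for x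
  proof -
    have "\<beta> k x \<noteq> 0" using s(2)[of x] that by auto
    moreover have "\<bar>1 / \<beta> k x\<bar> \<le> M'" using N(2)[of x] that by (auto simp: M'_def)
    moreover have "M' > 0" by (simp add: M'_def)
    ultimately show ?thesis by (simp add: field_simps)
  qed
  have babs: "(\<lambda>t. \<bar>\<beta> k t\<bar>) integrable_on {a..b}" using absint_norm[OF bi] by (simp add: absolutely_integrable_on_def)
  have "0 < 1 / M' * (b - a)" using ab by (simp add: M'_def)
  also have "\<dots> = integral {a..b} (\<lambda>t. 1 / M')" using ab by simp
  also have "\<dots> \<le> integral {a..b} (\<lambda>t. if t \<in> N \<union> N' then 1 / M' else \<bar>\<beta> k t\<bar>)"
  proof (rule integral_le)
    show "(\<lambda>t. if t \<in> N \<union> N' then 1 / M' else \<bar>\<beta> k t\<bar>) integrable_on {a..b}"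
      by (rule integrable_spike[OF babs, of "N \<union> N'"]) (use N N' in auto)
  qed (use low ab in auto)
  also have "\<dots> = integral {a..b} (\<lambda>t. \<bar>\<beta> k t\<bar>)"
    by (rule integral_spike[of "N \<union> N'"]) (use N N' in auto)
  finally show pos: "0 < integral {a..b} (\<lambda>t. \<bar>\<beta> k t\<bar>)" .
  have "integral {a..b} (\<lambda>t. \<bar>\<beta> k t\<bar>) = integral {a..b} (\<lambda>t. s * \<beta> k t)"
  proof (rule integral_spike[OF N'])
    fix x assume "x \<in> {a..b} - N'"
    then show "s * \<beta> k x = \<bar>\<beta> k x\<bar>" using s(1) s(2)[of x] ab by auto
  qed
  also have "\<dots> = s * integral {a..b} (\<beta> k)" by simp
  finally have "integral {a..b} (\<lambda>t. \<bar>\<beta> k t\<bar>) = s * integral {a..b} (\<beta> k)" .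
  then have "\<bar>integral {a..b} (\<beta> k)\<bar> = integral {a..b} (\<lambda>t. \<bar>\<beta> k t\<bar>)"
    using s(1) pos by auto
  moreover have "integral {a..b} (\<lambda>t. complex_of_real (\<beta> k t)) = complex_of_real (integral {a..b} (\<beta> k))"
    using bi by (intro integral_of_real_complex) (simp add: absolutely_integrable_on_def)
  ultimately show "norm (integral {a..b} (\<lambda>t. complex_of_real (\<beta> k t))) = integral {a..b} (\<lambda>t. \<bar>\<beta> k t\<bar>)" by simp
qed

lemma rho_has: "k < n \<Longrightarrow> x \<in> {0..l} \<Longrightarrow> complex_of_real (rho \<beta> k x) = integral {0..x} (\<lambda>t. complex_of_real (\<beta> k t))"
  unfolding rho_def using absint_subinterval[OF beta_int, of k 0 x]
  by (subst integral_of_real_complex) (auto simp: absolutely_integrable_on_def)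

lemma rho_cont: "k < n \<Longrightarrow> continuous_on {0..l} (rho \<beta> k)"
  unfolding rho_def by (rule indef_cont[OF beta_int])

lemma exp_rho_has_integral:
  assumes k: "k < n" and x: "x \<in> {0..l}"
  shows "((\<lambda>t. c * complex_of_real (\<beta> k t) * exp (c * complex_of_real (rho \<beta> k t))) has_integral
     exp (c * complex_of_real (rho \<beta> k x)) - 1) {0..x}"
proof -
  have u: "(\<lambda>t. c * complex_of_real (\<beta> k t)) absolutely_integrable_on {0..x}"
    using absint_subinterval[OF betac_int[OF k], of 0 x] x by (intro set_integrable_mult_right) auto
  have i: "integral {0..t} (\<lambda>t. c * complex_of_real (\<beta> k t)) = c * complex_of_real (rho \<beta> k t)" if "t \<in> {0..x}" for t
    using rho_has[of k t] k x that by simp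
  show ?thesis
    using ac_exp[OF _ u] x
    by (intro has_integral_eq_rhs[OF has_integral_eq[OF _ ac_exp[OF _ u]]]) (use rho_has[OF k x] i in auto)
qed

end

text \<open>Identifies the explicit unperturbed matrix with the case \<open>Q = 0\<close>, so that
  the general theory covers both operators.\<close>

lemma fund_zero_Q:
  assumes "dirac n l \<beta> (\<lambda>j k x. 0)" and x: "x \<in> {0..l}" and jk: "j < n" "k < n"
  shows "fund n l \<beta> (\<lambda>j k x. 0) \<mu> x j k = fund0 \<beta> \<mu> x j k"
proof -
  interpret dirac n l \<beta> "\<lambda>j k x. 0" by fact
  have "ac_solves n l \<beta> (\<lambda>j k x. 0) (\<lambda>x j. fund0 \<beta> \<mu> x j k) (\<lambda>x j. \<mu> * fund0 \<beta> \<mu> x j k + 0)"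
    unfolding ac_solves_def
  proof (intro conjI allI impI ballI)
    fix i assume i: "i < n"
    show "continuous_on {0..l} (\<lambda>x. fund0 \<beta> \<mu> x i k)"
      unfolding fund0_def using rho_cont[OF jk(2)] by (cases "i = k") (auto intro!: continuous_intros)
    fix y assume y: "y \<in> {0..l}"
    show "((\<lambda>t. \<i> * complex_of_real (\<beta> i t) * (\<mu> * fund0 \<beta> \<mu> t i k + 0) - (\<Sum>ka<n. 0 * fund0 \<beta> \<mu> t ka k)) has_integral
       fund0 \<beta> \<mu> y i k - fund0 \<beta> \<mu> 0 i k) {0..y}"
      using exp_rho_has_integral[OF jk(2) y, of "\<i> * \<mu>"]
      by (cases "i = k") (auto simp: fund0_def rho_def algebra_simps)
  qed
  then show ?thesis
    by (rule ac_unique[OF _ _ _ _ x jk(1), of "\<lambda>x j. fund n l \<beta> (\<lambda>j k x. 0) \<mu> x j k" \<mu> "\<lambda>x j. 0", rotated])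
       (use fund_ac[of \<mu> k] jk in \<open>auto simp: fund_at_0 fund0_def rho_def\<close>)
qed

section \<open>Asymptotics of the fundamental matrix\<close>

text \<open>The dichotomy behind the Riemann-Lebesgue argument: a coupling is either absent or
  oscillating. For \<open>j = k\<close> the second alternative fails, so the diagonal of
  \<open>Q\<close> vanishes almost everywhere.\<close>

locale dirac_sep = dirac +
  assumes pair: "\<And>j k. j < n \<Longrightarrow> k < n \<Longrightarrow>
     (AE x in lebesgue_on {0..l}. Q j k x = 0) \<or>
     (\<exists>\<theta>>0. AE x in lebesgue_on {0..l}. \<theta> \<le> \<bar>\<beta> j x - \<beta> k x\<bar>)"
begin

text \<open>The entries of \<open>- Q\<close> conjugated by the diagonal unperturbed fundamental
  matrix.\<close>

definition osc :: "complex \<Rightarrow> nat \<Rightarrow> nat \<Rightarrow> real \<Rightarrow> complex" where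
  "osc \<mu> j k t = - (Q j k t * exp (- \<i> * \<mu> * complex_of_real (rho \<beta> j t - rho \<beta> k t)))"

lemma osc_small_primitive:
  assumes jk: "j < n" "k < n" and e: "e > 0"
  shows "\<exists>R. \<forall>\<mu>. \<bar>Im \<mu>\<bar> \<le> h \<and> R \<le> cmod \<mu> \<longrightarrow> (\<forall>x\<in>{0..l}. norm (integral {0..x} (osc \<mu> j k)) < e)"
  using pair[OF jk]
proof
  assume ae: "AE x in lebesgue_on {0..l}. Q j k x = 0"
  obtain N where N: "negligible N" "\<And>x. x \<in> {0..l} - N \<Longrightarrow> Q j k x = 0"
    using AE_lebesgue_on_negligible[OF ae] by auto
  have "integral {0..x} (osc \<mu> j k) = integral {0..x} (\<lambda>t. 0)" if "x \<in> {0..l}" for x \<mu>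
    by (rule integral_spike[OF N(1)]) (use N(2) that in \<open>auto simp: osc_def\<close>)
  then show ?thesis using e by auto
next
  assume "\<exists>\<theta>>0. AE x in lebesgue_on {0..l}. \<theta> \<le> \<bar>\<beta> j x - \<beta> k x\<bar>"
  then obtain \<theta> where \<theta>: "\<theta> > 0" "AE x in lebesgue_on {0..l}. \<theta> \<le> \<bar>\<beta> j x - \<beta> k x\<bar>" by blast
  obtain M1 M2 where M: "AE x in lebesgue_on {0..l}. \<bar>\<beta> j x\<bar> \<le> M1" "AE x in lebesgue_on {0..l}. \<bar>\<beta> k x\<bar> \<le> M2"
    using beta_bdd jk by blast
  have sm: "(\<lambda>x. \<beta> j x - \<beta> k x) \<in> borel_measurable (lebesgue_on {0..l})"
    using beta_meas jk by (intro borel_measurable_diff) auto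
  have sM: "AE x in lebesgue_on {0..l}. \<bar>\<beta> j x - \<beta> k x\<bar> \<le> M1 + M2"
    using M by eventually_elim (auto simp: abs_le_iff)
  have q: "Q j k absolutely_integrable_on {0..l}" using Q_L1 jk by blast
  obtain R where R: "\<And>\<mu> x. \<bar>Im \<mu>\<bar> \<le> h \<and> R \<le> cmod \<mu> \<Longrightarrow> x \<in> {0..l} \<Longrightarrow>
      norm (integral {0..x} (\<lambda>t. Q j k t * exp (- \<i> * \<mu> * complex_of_real (integral {0..t} (\<lambda>x. \<beta> j x - \<beta> k x))))) < e"
    using riemann_lebesgue_strip[OF l_pos sm sM \<theta> q e, of h] by blast
  have rd: "integral {0..t} (\<lambda>x. \<beta> j x - \<beta> k x) = rho \<beta> j t - rho \<beta> k t" if "t \<in> {0..l}" for t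
    unfolding rho_def using absint_subinterval[OF beta_int, of j 0 t] absint_subinterval[OF beta_int, of k 0 t] jk that
    by (intro Henstock_Kurzweil_Integration.integral_diff) (auto simp: absolutely_integrable_on_def)
  have "norm (integral {0..x} (osc \<mu> j k)) < e" if "\<bar>Im \<mu>\<bar> \<le> h \<and> R \<le> cmod \<mu>" "x \<in> {0..l}" for \<mu> x
  proof -
    have "integral {0..x} (osc \<mu> j k) = integral {0..x} (\<lambda>t. - (Q j k t * exp (- \<i> * \<mu> * complex_of_real (integral {0..t} (\<lambda>x. \<beta> j x - \<beta> k x)))))"
      by (intro Henstock_Kurzweil_Integration.integral_cong) (use that(2) in \<open>auto simp: osc_def rd\<close>)
    then show ?thesis using R[OF that] by simp
  qed
  then show ?thesis by blast
qed

lemma osc_small_primitive_uniform: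
  assumes e: "e > 0"
  shows "\<exists>R. \<forall>\<mu>. \<bar>Im \<mu>\<bar> \<le> h \<and> R \<le> cmod \<mu> \<longrightarrow>
    (\<forall>j<n. \<forall>k<n. \<forall>x\<in>{0..l}. norm (integral {0..x} (osc \<mu> j k)) < e)"
proof -
  have "\<forall>j\<in>{..<n}. \<forall>k\<in>{..<n}. \<exists>R. \<forall>\<mu>. \<bar>Im \<mu>\<bar> \<le> h \<and> R \<le> cmod \<mu> \<longrightarrow> (\<forall>x\<in>{0..l}. norm (integral {0..x} (osc \<mu> j k)) < e)"
    using osc_small_primitive[OF _ _ e] by blast
  then obtain R where R: "\<And>j k \<mu> x. j < n \<Longrightarrow> k < n \<Longrightarrow> \<bar>Im \<mu>\<bar> \<le> h \<and> R j k \<le> cmod \<mu> \<Longrightarrow> x \<in> {0..l} \<Longrightarrow> norm (integral {0..x} (osc \<mu> j k)) < e"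
    by (metis lessThan_iff)
  define S where "S = (\<Sum>j<n. \<Sum>k<n. \<bar>R j k\<bar>)"
  have "R j k \<le> S" if "j < n" "k < n" for j k
  proof -
    have "R j k \<le> (\<Sum>k<n. \<bar>R j k\<bar>)"
      by (rule order_trans[OF abs_ge_self member_le_sum[where f = "\<lambda>k. \<bar>R j k\<bar>"]]) (use that in auto)
    also have "\<dots> \<le> S" unfolding S_def
      by (rule member_le_sum[where f = "\<lambda>j. \<Sum>k<n. \<bar>R j k\<bar>"]) (use that in \<open>auto intro!: sum_nonneg\<close>)
    finally show ?thesis .
  qed
  then show ?thesis using R by (intro exI[of _ S]) (meson order_trans)
qed

lemma rho_bound:
  assumes "k < n" "x \<in> {0..l}"
  shows "\<bar>rho \<beta> k x\<bar> \<le> Bl"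
proof -
  have "\<bar>rho \<beta> k x\<bar> \<le> integral {0..x} (\<lambda>t. \<bar>\<beta> k t\<bar>)"
    unfolding rho_def using integral_norm_le[OF absint_subinterval[OF beta_int, of k 0 x]] assms by simp
  also have "\<dots> \<le> integral {0..l} (\<lambda>t. \<bar>\<beta> k t\<bar>)"
    using integral_norm_mono[OF beta_int, of k x l] assms by simp
  also have "\<dots> \<le> Bl" using Bl_ge assms by blast
  finally show ?thesis .
qed

lemma osc_integrable:
  assumes jk: "j < n" "k < n"
  shows "osc \<mu> j k absolutely_integrable_on {0..l}"
proof -
  have c: "continuous_on {0..l} (\<lambda>t. - exp (- \<i> * \<mu> * complex_of_real (rho \<beta> j t - rho \<beta> k t)))"
    using rho_cont jk by (intro continuous_intros) auto
  have "Q j k absolutely_integrable_on {0..l}" using Q_L1 jk by auto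
  from absint_mult_cont[OF this c] show ?thesis unfolding osc_def[abs_def] by simp
qed

definition umat :: "complex \<Rightarrow> nat \<Rightarrow> real \<Rightarrow> nat \<Rightarrow> complex" where
  "umat \<mu> k x j = exp (- \<i> * \<mu> * complex_of_real (rho \<beta> j x)) * fund n l \<beta> Q \<mu> x j k"

text \<open>The slowly varying factor \<open>umat\<close> of the fundamental matrix solves a Volterra equation with
  the rapidly oscillating kernel \<open>osc\<close>.\<close>

lemma umat_eq:
  assumes x: "x \<in> {0..l}" and j: "j < n" and k: "k < n"
  shows "((\<lambda>t. \<Sum>m<n. osc \<mu> j m t * umat \<mu> k t m) has_integral umat \<mu> k x j - (if j = k then 1 else 0)) {0..x}"
proof -
  let ?F = "fund n l \<beta> Q \<mu>"
  let ?V = "\<lambda>t. exp (- \<i> * \<mu> * complex_of_real (rho \<beta> j t))"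
  define u where "u = (\<lambda>t. - \<i> * \<mu> * complex_of_real (\<beta> j t) * ?V t)"
  define v where "v = (\<lambda>t. \<i> * complex_of_real (\<beta> j t) * (\<mu> * ?F t j k) - (\<Sum>m<n. Q j m t * ?F t m k))"
  have sub: "{0..x} \<subseteq> {0..l}" using x by auto
  have Fc: "continuous_on {0..x} (\<lambda>t. ?F t m k)" if "m < n" for m
    using ac_solves_cont[OF fund_ac] that continuous_on_subset[OF _ sub] by (auto simp: V.cont_def)
  have bi: "(\<lambda>t. complex_of_real (\<beta> j t)) absolutely_integrable_on {0..x}"
    using absint_subinterval[OF betac_int[OF j], of 0 x] x by auto
  have Qi: "Q j m absolutely_integrable_on {0..x}" if "m < n" for m
    using absint_subinterval[where u = "Q j m" and x = 0 and y = x and a = 0 and b = l] Q_L1 x j that by auto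
  have ui: "u absolutely_integrable_on {0..x}"
    unfolding u_def using continuous_on_subset[OF rho_cont[OF j] sub]
    by (intro absint_mult_cont set_integrable_mult_right bi continuous_intros) auto
  have "(\<lambda>t. \<i> * complex_of_real (\<beta> j t) * (\<mu> * ?F t j k)) absolutely_integrable_on {0..x}"
    by (intro absint_mult_cont set_integrable_mult_right bi continuous_intros Fc j)
  then have vi: "v absolutely_integrable_on {0..x}"
    unfolding v_def by (rule set_integral_diff) (auto intro!: absolutely_integrable_sum absint_mult_cont Qi Fc)
  have U: "?V t = ?V 0 + integral {0..t} u" if "t \<in> {0..x}" for t
  proof -
    have "integral {0..t} u = ?V t - 1"
      using integral_unique[OF exp_rho_has_integral[OF j, of t "- \<i> * \<mu>"]] that x unfolding u_def by simp
    then show ?thesis by (simp add: rho_def)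
  qed
  have Vv: "?F t j k = ?F 0 j k + integral {0..t} v" if "t \<in> {0..x}" for t
  proof -
    have "(v has_integral ?F t j k - ?F 0 j k) {0..t}"
      using fund_ac[of \<mu> k] that x j unfolding ac_solves_def v_def by auto
    then show ?thesis by (simp add: integral_unique)
  qed
  have "((\<lambda>t. u t * ?F t j k + v t * ?V t) has_integral ?V x * ?F x j k - ?V 0 * ?F 0 j k) {0..x}"
    by (rule ac_product[OF _ ui vi U Vv]) (use x in auto)
  \<comment> \<open>The terms with \<open>\<i> * \<mu> * \<beta> j\<close> from the exponential and
    from the equation cancel; only the coupling through \<open>Q\<close> survives.\<close>
  moreover have "u t * ?F t j k + v t * ?V t = (\<Sum>m<n. osc \<mu> j m t * umat \<mu> k t m)" for t
  proof -
    have "osc \<mu> j m t * umat \<mu> k t m = - (Q j m t * ?F t m k * ?V t)" for m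
    proof -
      have "exp (- \<i> * \<mu> * complex_of_real (rho \<beta> j t - rho \<beta> m t)) * exp (- \<i> * \<mu> * complex_of_real (rho \<beta> m t)) = ?V t"
        by (simp add: exp_add[symmetric] algebra_simps)
      moreover have "- (q * a) * (b * f) = - (q * f * (a * b))" for q a b f :: complex
        by (simp add: algebra_simps)
      ultimately show ?thesis unfolding osc_def umat_def by (simp only:)
    qed
    then have "(\<Sum>m<n. osc \<mu> j m t * umat \<mu> k t m) = - ((\<Sum>m<n. Q j m t * ?F t m k) * ?V t)"
      by (simp only: sum_negf sum_distrib_right)
    moreover have "(- \<i> * \<mu> * b * W) * f + (\<i> * b * (\<mu> * f) - s) * W = - (s * W)" for b W f s
      by (simp add: algebra_simps)
    ultimately show ?thesis unfolding u_def v_def by simp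
  qed
  ultimately show ?thesis using fund_at_0[OF j k, of \<mu>] by (simp add: umat_def rho_def split: if_splits)
qed

text \<open>The Volterra equation bounds \<open>umat\<close> by \<open>Mu\<close> and its
  oscillation by increments of \<open>G\<close>, both uniformly over the strip. The mesh for
  freezing can thus be fixed before \<open>\<mu>\<close>, after which the small primitives of
  \<open>osc\<close> for large \<open>\<mu>\<close> bring \<open>umat\<close> close to the
  identity.\<close>

lemma fund_asymp:
  assumes e: "e > 0"
  shows "\<exists>R. \<forall>\<mu>. \<bar>Im \<mu>\<bar> \<le> h \<and> R \<le> cmod \<mu> \<longrightarrow>
    (\<forall>x\<in>{0..l}. \<forall>j<n. \<forall>k<n. norm (fund n l \<beta> Q \<mu> x j k - fund0 \<beta> \<mu> x j k) < e)"
proof -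
  define q where "q = (\<lambda>t. \<Sum>j<n. \<Sum>k<n. cmod (Q j k t))"
  have q0: "0 \<le> q t" for t unfolding q_def by (intro sum_nonneg) auto
  have Qq: "cmod (Q j k t) \<le> q t" if "j < n" "k < n" for j k t
  proof -
    have "cmod (Q j k t) \<le> (\<Sum>k<n. cmod (Q j k t))" by (rule member_le_sum) (use that in auto)
    also have "\<dots> \<le> q t" unfolding q_def
      by (rule member_le_sum[where f = "\<lambda>j. \<Sum>k<n. cmod (Q j k t)"]) (use that in \<open>auto intro!: sum_nonneg\<close>)
    finally show ?thesis .
  qed
  have qi: "q absolutely_integrable_on {0..l}"
    unfolding q_def using Q_L1 by (intro absolutely_integrable_sum absint_norm) auto
  define G where "G x = integral {0..x} q" for x
  define Iq where "Iq = G l"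
  have Gc: "continuous_on {0..l} G" unfolding G_def by (rule indef_cont[OF qi])
  have Gm: "G x \<le> G y" if "0 \<le> x" "x \<le> y" "y \<le> l" for x y
    unfolding G_def using integral_norm_mono[OF qi that] q0 by simp
  have Iq: "Iq \<ge> 0" unfolding Iq_def using Gm[of 0 l] l_pos by (simp add: G_def)
  define B where "B = exp (\<bar>h\<bar> * (2 * Bl))"
  have B1: "B \<ge> 1" unfolding B_def using Bl_nonneg by simp
  have expB: "cmod (exp (c * \<i> * \<mu> * complex_of_real r)) \<le> B" if "\<bar>Im \<mu>\<bar> \<le> h" "\<bar>r\<bar> \<le> 2 * Bl" "c = 1 \<or> c = -1" for \<mu> r and c :: complex
  proof -
    have "\<bar>Im \<mu> * r\<bar> \<le> \<bar>h\<bar> * (2 * Bl)" unfolding abs_mult using that by (intro mult_mono) auto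
    then show ?thesis using that(3) unfolding B_def by (auto simp: norm_exp_eq_Re abs_le_iff)
  qed
  define Mu where "Mu = exp (B * Iq)"
  have Mu: "Mu \<ge> 1" unfolding Mu_def using B1 Iq by simp
  \<comment> \<open>\<open>\<omega>\<close> and the later \<open>\<eta>\<close> make each of the
    \<open>n\<close> coupling integrals at most \<open>e / (2 * (n + 1) * B)\<close>. The extra
    \<open>B\<close> pays for multiplying by the exponential again at the end, and
    \<open>n + 1\<close> makes the sum strictly smaller than \<open>e / B\<close>.\<close>
  define \<omega> where "\<omega> = e / (4 * (real n + 1) * B * Mu * B * B * (Iq + 1))"
  have om: "\<omega> > 0" unfolding \<omega>_def using e B1 Mu Iq by (intro divide_pos_pos mult_pos_pos) auto
  have "uniformly_continuous_on {0..l} G" using Gc compact_uniformly_continuous compact_Icc by blast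
  then obtain d where d: "d > 0" "\<And>s t. s \<in> {0..l} \<Longrightarrow> t \<in> {0..l} \<Longrightarrow> \<bar>s - t\<bar> < d \<Longrightarrow> \<bar>G s - G t\<bar> < \<omega>"
    unfolding uniformly_continuous_on_def dist_real_def using om by (metis abs_minus_commute)
  obtain N where N: "N > 0" "l / real N < d"
  proof -
    obtain N where "l / d < real N" using reals_Archimedean2 by blast
    moreover have "0 < l / d" using l_pos d(1) by simp
    ultimately have "0 < real N" by linarith
    with \<open>l / d < real N\<close> show ?thesis using d(1) by (intro that[of N]) (auto simp: field_simps)
  qed
  define \<eta> where "\<eta> = e / (8 * (real n + 1) * B * real N * Mu)"
  have eta: "\<eta> > 0" unfolding \<eta>_def using e B1 Mu N by (intro divide_pos_pos mult_pos_pos) auto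
  obtain R where R: "\<And>\<mu> j k x. \<bar>Im \<mu>\<bar> \<le> h \<and> R \<le> cmod \<mu> \<Longrightarrow> j < n \<Longrightarrow> k < n \<Longrightarrow> x \<in> {0..l} \<Longrightarrow>
      norm (integral {0..x} (osc \<mu> j k)) < \<eta>"
    using osc_small_primitive_uniform[OF eta, of h] by blast
  show ?thesis
  proof (rule exI[of _ R], intro allI impI ballI)
    fix \<mu> x j k assume mu: "\<bar>Im \<mu>\<bar> \<le> h \<and> R \<le> cmod \<mu>" and x: "x \<in> {0..l}" and j: "j < n" and k: "k < n"
    interpret E: volterra n l "osc \<mu>"
      using l_pos osc_integrable by unfold_locales auto
    have oscB: "cmod (osc \<mu> i m t) \<le> B * cmod (Q i m t)" if "i < n" "m < n" "t \<in> {0..l}" for i m t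
    proof -
      have "\<bar>rho \<beta> i t - rho \<beta> m t\<bar> \<le> 2 * Bl" using rho_bound[of i t] rho_bound[of m t] that by auto
      then have "cmod (exp (-1 * \<i> * \<mu> * complex_of_real (rho \<beta> i t - rho \<beta> m t))) \<le> B"
        using mu by (intro expB) auto
      from mult_left_mono[OF this, of "cmod (Q i m t)"] show ?thesis unfolding osc_def by (simp add: norm_mult mult.commute)
    qed
    have kapB: "E.kap t \<le> B * q t" if "t \<in> {0..l}" for t
      unfolding E.kap_def q_def sum_distrib_left by (intro sum_mono oscB that) auto
    have NB: "E.N l \<le> B * Iq"
    proof -
      have "E.N l \<le> integral {0..l} (\<lambda>t. B * q t)"
        unfolding E.N_def by (rule integral_le) (use E.kap_int qi kapB in \<open>auto simp: absolutely_integrable_on_def intro: integrable_on_mult_right\<close>)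
      then show ?thesis by (simp add: Iq_def G_def)
    qed
    let ?u = "umat \<mu> k"
    have uc: "E.cont ?u"
      unfolding E.cont_def umat_def
    proof (intro allI impI)
      fix m assume m: "m < n"
      then have "continuous_on {0..l} (\<lambda>x. fund n l \<beta> Q \<mu> x m k)"
        using ac_solves_cont[OF fund_ac] by (auto simp: V.cont_def)
      then show "continuous_on {0..l} (\<lambda>x. exp (- \<i> * \<mu> * complex_of_real (rho \<beta> m x)) * fund n l \<beta> Q \<mu> x m k)"
        using rho_cont[OF m] by (intro continuous_intros)
    qed
    have uT: "?u y i = (if i = k then 1 else 0) + E.T ?u y i" if "y \<in> {0..l}" "i < n" for y i
      using integral_unique[OF umat_eq[OF that k]] by (simp add: E.T_def)
    have uM: "cmod (?u y i) \<le> Mu" if "y \<in> {0..l}" "i < n" for y i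
    proof -
      have "cmod (?u y i) \<le> 1 * exp (E.N l)"
        by (rule E.a_priori_bound[OF uc _ uT _ _ that]) (auto simp: E.cont_def)
      also have "\<dots> \<le> Mu" unfolding Mu_def using NB by simp
      finally show ?thesis .
    qed
    have uosc1: "cmod (?u t i - ?u s i) \<le> Mu * (B * (G t - G s))" if st: "0 \<le> s" "s \<le> t" "t \<le> l" "i < n" for s t i
    proof -
      have "?u t i - ?u s i = E.T ?u t i - E.T ?u s i" using uT[of t i] uT[of s i] st by auto
      also have "\<dots> = integral {s..t} (\<lambda>y. \<Sum>m<n. osc \<mu> i m y * ?u y m)"
        unfolding E.T_def by (rule integral_diff_interval[OF E.T_integrand[OF uc]]) (use st in auto)
      finally have eq: "?u t i - ?u s i = \<dots>" .
      have "norm (integral {s..t} (\<lambda>y. \<Sum>m<n. osc \<mu> i m y * ?u y m)) \<le> integral {s..t} (\<lambda>y. Mu * B * q y)"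
      proof (rule integral_norm_bound_integral)
        show "(\<lambda>y. \<Sum>m<n. osc \<mu> i m y * ?u y m) integrable_on {s..t}"
          using absint_subinterval[OF E.T_integrand[OF uc], of i s t] st by (auto simp: absolutely_integrable_on_def)
        show "(\<lambda>y. Mu * B * q y) integrable_on {s..t}"
          using absint_subinterval[OF qi, of s t] st by (intro integrable_on_mult_right) (auto simp: absolutely_integrable_on_def)
        fix y assume y: "y \<in> {s..t}"
        have "norm (\<Sum>m<n. osc \<mu> i m y * ?u y m) \<le> E.kap y * Mu"
          by (rule E.kap_bound[OF st(4)]) (use uM y st Mu in auto)
        also have "\<dots> \<le> (B * q y) * Mu" using kapB[of y] y st Mu by (intro mult_right_mono) auto
        finally show "norm (\<Sum>m<n. osc \<mu> i m y * ?u y m) \<le> Mu * B * q y" by (simp add: algebra_simps)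
      qed
      also have "\<dots> = Mu * (B * (G t - G s))"
        unfolding G_def integral_diff_interval[OF qi st(1-3)] by simp
      finally show ?thesis unfolding eq .
    qed
    have uosc: "cmod (?u s i - ?u t i) \<le> Mu * (B * \<omega>)" if st: "s \<in> {0..l}" "t \<in> {0..l}" "\<bar>s - t\<bar> \<le> l / real N" "i < n" for s t i
    proof -
      have "\<bar>G s - G t\<bar> < \<omega>" using d(2)[OF st(1,2)] st(3) N(2) by simp
      then have "Mu * (B * (G s - G t)) \<le> Mu * (B * \<omega>)" "Mu * (B * (G t - G s)) \<le> Mu * (B * \<omega>)"
        using Mu B1 by (intro mult_left_mono; simp)+
      then show ?thesis
        using uosc1[of s t i] uosc1[of t s i] st by (cases "s \<le> t") (auto simp: norm_minus_commute)
    qed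
    have each: "norm (integral {0..x} (\<lambda>t. osc \<mu> j m t * ?u t m)) \<le> 2 * real N * \<eta> * Mu + Mu * (B * \<omega>) * (B * Iq)"
      if m: "m < n" for m
    proof -
      have "norm (integral {0..x} (\<lambda>t. osc \<mu> j m t * ?u t m)) \<le> 2 * real N * \<eta> * Mu + Mu * (B * \<omega>) * integral {0..l} (\<lambda>t. norm (osc \<mu> j m t))"
      proof (rule small_primitive_bound[OF l_pos osc_integrable[OF j m] _ _ _ _ N(1) x])
        show "continuous_on {0..l} (\<lambda>t. ?u t m)" using uc m by (auto simp: E.cont_def)
        show "norm (integral {0..y} (osc \<mu> j m)) \<le> \<eta>" if "y \<in> {0..l}" for y
          using R[OF mu j m that] by simp
      qed (use uM uosc m in auto)
      also have "integral {0..l} (\<lambda>t. norm (osc \<mu> j m t)) \<le> integral {0..l} (\<lambda>t. B * q t)"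
      proof (rule integral_le)
        show "(\<lambda>t. norm (osc \<mu> j m t)) integrable_on {0..l}"
          using absint_norm[OF osc_integrable[OF j m]] by (simp add: absolutely_integrable_on_def)
        show "(\<lambda>t. B * q t) integrable_on {0..l}" using qi by (intro integrable_on_mult_right) (simp add: absolutely_integrable_on_def)
        show "norm (osc \<mu> j m t) \<le> B * q t" if "t \<in> {0..l}" for t
          by (rule order_trans[OF oscB[OF j m that] mult_left_mono[OF Qq[OF j m]]]) (use B1 in simp)
      qed
      also have "integral {0..l} (\<lambda>t. B * q t) = B * Iq" by (simp add: Iq_def G_def)
      finally show ?thesis using Mu B1 om by (simp add: mult_left_mono)
    qed
    have t1: "2 * real N * \<eta> * Mu = e / (4 * (real n + 1) * B)"
      using N Mu B1 by (simp add: \<eta>_def divide_simps)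
    have t2: "Mu * (B * \<omega>) * (B * Iq) \<le> e / (4 * (real n + 1) * B)"
    proof -
      have "Mu * (B * \<omega>) * (B * Iq) \<le> Mu * (B * \<omega>) * (B * (Iq + 1))"
        using Mu B1 om Iq by (intro mult_left_mono) auto
      also have "\<dots> = e / (4 * (real n + 1) * B)"
      proof -
        have "Mu \<noteq> 0" "B \<noteq> 0" "Iq + 1 \<noteq> 0" "real n + 1 \<noteq> 0" using Mu B1 Iq by auto
        then show ?thesis by (simp add: \<omega>_def divide_simps)
      qed
      finally show ?thesis .
    qed
    have "?u x j - (if j = k then 1 else 0) = (\<Sum>m<n. integral {0..x} (\<lambda>t. osc \<mu> j m t * ?u t m))"
    proof -
      have ii: "(\<lambda>t. osc \<mu> j m t * ?u t m) integrable_on {0..x}" if "m < n" for m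
      proof -
        have "(\<lambda>t. osc \<mu> j m t * ?u t m) absolutely_integrable_on {0..l}"
          using uc that by (intro absint_mult_cont osc_integrable j) (auto simp: E.cont_def)
        then show ?thesis using absint_subinterval[where x = 0 and y = x and a = 0 and b = l] x by (auto simp: absolutely_integrable_on_def)
      qed
      have "((\<lambda>t. \<Sum>m<n. osc \<mu> j m t * ?u t m) has_integral (\<Sum>m<n. integral {0..x} (\<lambda>t. osc \<mu> j m t * ?u t m))) {0..x}"
        by (intro has_integral_sum integrable_integral ii) auto
      from has_integral_unique[OF umat_eq[OF x j k] this] show ?thesis .
    qed
    then have "cmod (?u x j - (if j = k then 1 else 0)) \<le> (\<Sum>m<n. e / (4 * (real n + 1) * B) + e / (4 * (real n + 1) * B))"
      by (simp only:) (rule sum_norm_le, rule order_trans[OF each add_mono[OF eq_refl[OF t1] t2]], simp)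
    also have "\<dots> < e / B"
      using e B1 by (simp add: divide_simps)
    finally have uclose: "cmod (?u x j - (if j = k then 1 else 0)) < e / B" .
    have fu: "fund n l \<beta> Q \<mu> x j k - fund0 \<beta> \<mu> x j k = exp (1 * \<i> * \<mu> * complex_of_real (rho \<beta> j x)) * (?u x j - (if j = k then 1 else 0))"
    proof -
      have 1: "exp (1 * \<i> * \<mu> * complex_of_real (rho \<beta> j x)) * exp (- \<i> * \<mu> * complex_of_real (rho \<beta> j x)) = 1"
        by (simp add: exp_add[symmetric])
      have 2: "a * (b * f - d) = (a * b) * f - a * d" for a b f d :: complex
        by (simp add: algebra_simps)
      show ?thesis unfolding umat_def fund0_def 2 1 by simp
    qed
    have "cmod (fund n l \<beta> Q \<mu> x j k - fund0 \<beta> \<mu> x j k) \<le> B * cmod (?u x j - (if j = k then 1 else 0))"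
      unfolding fu norm_mult using rho_bound[OF j x] mu Bl_nonneg by (intro mult_right_mono expB) auto
    also have "\<dots> < B * (e / B)" using uclose B1 by (intro mult_strict_left_mono) auto
    also have "\<dots> = e" using B1 by simp
    finally show "cmod (fund n l \<beta> Q \<mu> x j k - fund0 \<beta> \<mu> x j k) < e" .
  qed
qed

end

section \<open>Polar parts annihilated by a matrix of power series\<close>

text \<open>Membership in the ring of power series, viewed inside the field of Laurent
  series.\<close>

definition reg :: "complex fls \<Rightarrow> bool" where
  "reg f \<longleftrightarrow> (\<forall>i<0. fls_nth f i = 0)"

lemma reg_eq: "reg f \<Longrightarrow> f = fps_to_fls (fls_regpart f)"
  by (rule fls_eqI) (auto simp: reg_def)

lemma reg_fps [simp, intro]: "reg (fps_to_fls F)" by (simp add: reg_def)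

lemma reg_const [simp, intro]: "reg (fls_const a)"
  by (simp add: reg_def fls_const_nth)

lemma reg_0 [simp]: "reg 0" by (simp add: reg_def)

lemma reg_add: "reg f \<Longrightarrow> reg g \<Longrightarrow> reg (f + g)" by (simp add: reg_def)

lemma reg_diff: "reg f \<Longrightarrow> reg g \<Longrightarrow> reg (f - g)" by (simp add: reg_def)

lemma reg_mult: "reg f \<Longrightarrow> reg g \<Longrightarrow> reg (f * g)"
  by (metis reg_eq reg_fps fls_times_fps_to_fls)

lemma reg_sum: "(\<And>i. i \<in> I \<Longrightarrow> reg (f i)) \<Longrightarrow> reg (\<Sum>i\<in>I. f i)"
  by (induction I rule: infinite_finite_induct) (auto intro: reg_add)

lemma reg_const_cancel: "a \<noteq> 0 \<Longrightarrow> reg (fls_const a * f) \<Longrightarrow> reg f"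
  by (auto simp: reg_def)

lemma fps_to_fls_sum: "fps_to_fls (\<Sum>i\<in>I. f i) = (\<Sum>i\<in>I. fps_to_fls (f i))"
  by (induction I rule: infinite_finite_induct) auto

text \<open>The module \<open>A\<inverse> O\<^sup>n / O\<^sup>n\<close> over the ring \<open>O\<close> of power series has complex dimension
  equal to the order of vanishing of \<open>det A\<close>.\<close>

lemma pole_space_basis:
  fixes A :: "nat \<Rightarrow> nat \<Rightarrow> complex fps"
  assumes "Determinant.det (Matrix.mat n n (\<lambda>(i,j). A i j)) \<noteq> 0"
    and "subdegree (Determinant.det (Matrix.mat n n (\<lambda>(i,j). A i j))) = d"
  shows "\<exists>e :: nat \<Rightarrow> nat \<Rightarrow> complex fls.
     (\<forall>i<d. \<forall>r<n. reg (\<Sum>k<n. fps_to_fls (A r k) * e i k)) \<and>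
     (\<forall>c. (\<forall>r<n. reg (\<Sum>k<n. fps_to_fls (A r k) * c k)) \<longrightarrow>
          (\<exists>a. \<forall>k<n. reg (c k - (\<Sum>i<d. fls_const (a i) * e i k)))) \<and>
     (\<forall>a. (\<forall>k<n. reg (\<Sum>i<d. fls_const (a i) * e i k)) \<longrightarrow> (\<forall>i<d. a i = 0))"
  using assms
proof (induction d arbitrary: A)
  case 0
  let ?A = "Matrix.mat n n (\<lambda>(i,j). A i j)"
  let ?d = "Determinant.det ?A"
  \<comment> \<open>The determinant is a unit of the power series ring. Multiplying
    \<open>A c\<close> by the adjugate and by the inverse determinant therefore recovers
    \<open>c\<close> without poles, and the space is trivial.\<close>
  have d0: "fps_nth ?d 0 \<noteq> 0" using 0 by (simp add: subdegree_eq_0_iff)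
  have Ac: "?A \<in> carrier_mat n n" by simp
  have adj: "(\<Sum>r<n. adj_mat ?A $$ (k, r) * A r m) = (if k = m then ?d else 0)" if "k < n" "m < n" for k m
  proof -
    have "(adj_mat ?A * ?A) $$ (k, m) = (?d \<cdot>\<^sub>m 1\<^sub>m n) $$ (k, m)" by (simp only: adj_mat(3)[OF Ac])
    then show ?thesis
      using that adj_mat(1)[OF Ac] by (auto simp: scalar_prod_def lessThan_atLeast0)
  qed
  have "reg (c k)" if c: "\<forall>r<n. reg (\<Sum>k<n. fps_to_fls (A r k) * c k)" and k: "k < n" for c k
  proof -
    have "(\<Sum>r<n. fps_to_fls (adj_mat ?A $$ (k, r)) * (\<Sum>m<n. fps_to_fls (A r m) * c m)) =
        (\<Sum>m<n. fps_to_fls (\<Sum>r<n. adj_mat ?A $$ (k, r) * A r m) * c m)"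
      unfolding fps_to_fls_sum fls_times_fps_to_fls sum_distrib_left sum_distrib_right
      by (subst sum.swap) (simp add: mult.assoc)
    also have "\<dots> = (\<Sum>m<n. if k = m then fps_to_fls ?d * c m else 0)"
      by (intro sum.cong) (use adj[OF k] in auto)
    also have "\<dots> = fps_to_fls ?d * c k" using k by simp
    finally have "reg (fps_to_fls ?d * c k)"
      using c by (metis (no_types, lifting) reg_sum reg_mult reg_fps lessThan_iff)
    then have "reg (fps_to_fls (inverse ?d) * (fps_to_fls ?d * c k))" by (rule reg_mult[OF reg_fps])
    also have "fps_to_fls (inverse ?d) * (fps_to_fls ?d * c k) = fps_to_fls (inverse ?d * ?d) * c k"
      by (simp add: fls_times_fps_to_fls mult.assoc)
    also have "inverse ?d * ?d = 1" using d0 by (rule inverse_mult_eq_1)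
    finally show ?thesis by simp
  qed
  then show ?case by auto
next
  case (Suc d)
  let ?A = "Matrix.mat n n (\<lambda>(i,j). A i j)"
  let ?d = "Determinant.det ?A"
  have Ac: "?A \<in> carrier_mat n n" by simp
  \<comment> \<open>The determinant vanishes at the centre, so the matrix of constant terms has a
    kernel vector \<open>v\<close>; then \<open>A v\<close> is divisible by the local parameter
    \<open>X\<close>.\<close>
  define A0 where "A0 = Matrix.mat n n (\<lambda>(i,j). fps_nth (A i j) 0)"
  have A0c: "A0 \<in> carrier_mat n n" by (simp add: A0_def)
  have "Determinant.det A0 = fps_nth ?d 0"
    unfolding det_def'[OF A0c] det_def'[OF Ac] fps_sum_nth
  proof (intro sum.cong refl)
    fix p assume p: "p \<in> {p. p permutes {0..<n}}"
    have "fps_nth (\<Prod>i\<in>I. f i) 0 = (\<Prod>i\<in>I. fps_nth (f i) 0)" for I and f :: "nat \<Rightarrow> complex fps"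
      by (induction I rule: infinite_finite_induct) auto
    moreover have "A0 $$ (i, p i) = fps_nth (A i (p i)) 0" "?A $$ (i, p i) = A i (p i)" if "i < n" for i
      using permutes_in_image[of p "{0..<n}" i] p that by (auto simp: A0_def)
    ultimately show "signof p * (\<Prod>i = 0..<n. A0 $$ (i, p i)) = fps_nth (signof p * (\<Prod>i = 0..<n. ?A $$ (i, p i))) 0"
      by (simp add: sign_def)
  qed
  also have "\<dots> = 0" using Suc.prems by (metis nth_less_subdegree_zero zero_less_Suc)
  finally obtain vv where vv: "vv \<in> carrier_vec n" "vv \<noteq> 0\<^sub>v n" "A0 *\<^sub>v vv = 0\<^sub>v n"
    using det_0_iff_vec_prod_zero[OF A0c] by auto
  define v where "v k = vv $ k" for k
  obtain r where r: "r < n" "v r \<noteq> 0"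
    using vv(1,2) unfolding v_def by (metis carrier_vecD eq_vecI index_zero_vec(1) index_zero_vec(2))
  have v0: "(\<Sum>k<n. fps_nth (A i k) 0 * v k) = 0" if "i < n" for i
  proof -
    have "(A0 *\<^sub>v vv) $ i = 0" using vv that by simp
    then show ?thesis using that vv(1) by (simp add: A0_def v_def scalar_prod_def lessThan_atLeast0)
  qed
  define Av where "Av i = (\<Sum>k<n. A i k * fps_const (v k))" for i
  define b where "b i = fps_shift 1 (Av i)" for i
  have bX: "fps_X * b i = Av i" if "i < n" for i
  proof -
    have "fps_nth (Av i) 0 = 0" using v0[OF that] by (simp add: Av_def fps_sum_nth)
    then show ?thesis unfolding b_def by (intro fps_ext) (auto simp: fps_X_mult_nth)
  qed
  \<comment> \<open>Column \<open>r\<close>, where \<open>v r\<close> is nonzero, is replaced by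
    \<open>A v / X\<close>. Up to the constant \<open>v r\<close> this divides the determinant by
    \<open>X\<close> and lowers its order by one.\<close>
  define A1 where "A1 i k = (if k = r then b i else A i k)" for i k
  let ?A1 = "Matrix.mat n n (\<lambda>(i,j). A1 i j)"
  have A1c: "?A1 \<in> carrier_mat n n" by simp
  define w where "w = Matrix.vec n (\<lambda>k. fps_const (v k))"
  have wc: "w \<in> carrier_vec n" by (simp add: w_def)
  define M where "M = replace_col ?A (?A *\<^sub>v w) r"
  have Mc: "M \<in> carrier_mat n n" by (simp add: M_def replace_col_def)
  have MA: "M $$ (i, k) = (if k = r then fps_X * A1 i k else A1 i k)" if "i < n" "k < n" for i k
  proof -
    have "(?A *\<^sub>v w) $ i = Av i"
      using that by (simp add: w_def Av_def scalar_prod_def lessThan_atLeast0)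
    then show ?thesis using that bX by (simp add: M_def replace_col_def A1_def)
  qed
  have "Determinant.det M = (\<Sum>i<n. M $$ (i, r) * cofactor M i r)"
    by (rule laplace_expansion_column[OF Mc r(1)])
  also have "\<dots> = (\<Sum>i<n. fps_X * (?A1 $$ (i, r) * cofactor ?A1 i r))"
  proof (intro sum.cong refl)
    fix i assume i: "i \<in> {..<n}"
    have "mat_delete M i r = mat_delete ?A1 i r"
      by (rule eq_matI) (use Mc i r MA in \<open>auto simp: mat_delete_def\<close>)
    then have "cofactor M i r = cofactor ?A1 i r" by (simp add: cofactor_def)
    then show "M $$ (i, r) * cofactor M i r = fps_X * (?A1 $$ (i, r) * cofactor ?A1 i r)"
      using MA[of i r] i r by simp
  qed
  also have "\<dots> = fps_X * Determinant.det ?A1"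
    unfolding laplace_expansion_column[OF A1c r(1)] by (simp add: sum_distrib_left)
  finally have detM: "fps_const (v r) * ?d = fps_X * Determinant.det ?A1"
    using cramer_lemma_mat[OF Ac wc r(1)] r(1) unfolding M_def by (simp add: w_def)
  have d1: "Determinant.det ?A1 \<noteq> 0"
  proof
    assume "Determinant.det ?A1 = 0"
    then have "fps_const (v r) * ?d = 0" using detM by simp
    then show False using r Suc.prems by simp
  qed
  have "subdegree (fps_const (v r) * ?d) = Suc d" using Suc.prems r by simp
  moreover have "subdegree (fps_X * Determinant.det ?A1) = Suc (subdegree (Determinant.det ?A1))"
    using d1 by simp
  ultimately have sd1: "subdegree (Determinant.det ?A1) = d" using detM by simp
  obtain e' where e': "\<forall>i<d. \<forall>s<n. reg (\<Sum>k<n. fps_to_fls (A1 s k) * e' i k)"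
    "\<And>c. \<forall>s<n. reg (\<Sum>k<n. fps_to_fls (A1 s k) * c k) \<Longrightarrow> \<exists>a. \<forall>k<n. reg (c k - (\<Sum>i<d. fls_const (a i) * e' i k))"
    "\<And>a. \<forall>k<n. reg (\<Sum>i<d. fls_const (a i) * e' i k) \<Longrightarrow> \<forall>i<d. a i = 0"
    using Suc.IH[OF d1 sd1] by blast
  let ?z = "fls_X_inv :: complex fls"
  have zX: "fls_X * ?z = 1" "?z * fls_X = 1"
    by (simp_all add: fls_X_times_conv_shift fls_X_inv_times_conv_shift)
  \<comment> \<open>The column operation read on vectors: \<open>A (S c) = A1 c\<close>, with right
    inverse \<open>T\<close> below. New poles arise only along \<open>v\<close>.\<close>
  define S where "S c k = (if k = r then 0 else c k) + fls_const (v k) * (?z * c r)" for c :: "nat \<Rightarrow> complex fls" and k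
  have AS: "(\<Sum>k<n. fps_to_fls (A i k) * S c k) = (\<Sum>k<n. fps_to_fls (A1 i k) * c k)" if i: "i < n" for c i
  proof -
    have "(\<Sum>k<n. fps_to_fls (A i k) * S c k) =
        (\<Sum>k<n. if k = r then 0 else fps_to_fls (A i k) * c k) + (\<Sum>k<n. fps_to_fls (A i k) * fls_const (v k)) * (?z * c r)"
      unfolding sum_distrib_right sum.distrib[symmetric] S_def by (intro sum.cong) (auto simp: algebra_simps)
    also have "(\<Sum>k<n. fps_to_fls (A i k) * fls_const (v k)) = fps_to_fls (Av i)"
      by (simp add: Av_def fps_to_fls_sum fls_times_fps_to_fls)
    also have "fps_to_fls (Av i) = fls_X * fps_to_fls (b i)"
      unfolding bX[OF i, symmetric] by (simp add: fls_times_fps_to_fls)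
    also have "fls_X * fps_to_fls (b i) * (?z * c r) = fps_to_fls (b i) * c r * (fls_X * ?z)"
      by (simp only: mult_ac)
    also have "(\<Sum>k<n. if k = r then 0 else fps_to_fls (A i k) * c k) + fps_to_fls (b i) * c r * (fls_X * ?z) =
        (\<Sum>k<n. if k = r then 0 else fps_to_fls (A i k) * c k) + (\<Sum>k<n. if k = r then fps_to_fls (b i) * c r else 0)"
      using r by (simp add: zX)
    also have "\<dots> = (\<Sum>k<n. fps_to_fls (A1 i k) * c k)"
      unfolding sum.distrib[symmetric] by (intro sum.cong) (auto simp: A1_def)
    finally show ?thesis .
  qed
  define T where "T c k = (if k = r then fls_const (inverse (v r)) * (fls_X * c r) else c k - fls_const (v k * inverse (v r)) * c r)"
    for c :: "nat \<Rightarrow> complex fls" and k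
  have ST: "S (T c) k = c k" for c k
  proof -
    have "?z * (fls_const (inverse (v r)) * (fls_X * c r)) = fls_const (inverse (v r)) * c r * (?z * fls_X)"
      by (simp only: mult_ac)
    then have 1: "?z * T c r = fls_const (inverse (v r)) * c r" by (simp add: T_def zX)
    have 2: "fls_const (v k) * (fls_const (inverse (v r)) * c r) = fls_const (v k * inverse (v r)) * c r"
      by (simp add: mult.assoc[symmetric] fls_const_mult_const del: mult.assoc)
    show ?thesis
      unfolding S_def 1 2 using r by (auto simp: T_def)
  qed
  \<comment> \<open>The basis for \<open>A1\<close> is carried over by \<open>S\<close>; the one
    additional polar part is \<open>v / X\<close>.\<close>
  define e where "e i = (if i < d then S (e' i) else (\<lambda>k. fls_const (v k) * ?z))" for i
  have Se: "(\<Sum>i<Suc d. fls_const (a i) * e i k) =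
      (if k = r then 0 else (\<Sum>i<d. fls_const (a i) * e' i k)) +
      fls_const (v k) * (?z * ((\<Sum>i<d. fls_const (a i) * e' i r) + fls_const (a d)))" for a k
  proof -
    have "(\<Sum>i<d. fls_const (a i) * e i k) = (\<Sum>i<d. fls_const (a i) * S (e' i) k)"
      by (intro sum.cong) (auto simp: e_def)
    also have "\<dots> = (if k = r then 0 else (\<Sum>i<d. fls_const (a i) * e' i k)) + fls_const (v k) * (?z * (\<Sum>i<d. fls_const (a i) * e' i r))"
      by (auto simp: S_def distrib_left sum.distrib sum_distrib_left mult_ac)
    finally show ?thesis by (simp add: e_def distrib_left mult_ac)
  qed
  have zreg: "reg (?z * f - ?z * fls_const (fls_nth f 0))" if "reg f" for f
    using that unfolding fls_X_inv_times_conv_shift reg_def by (auto simp: fls_const_nth)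
  show ?case
  proof (intro exI[of _ e] conjI allI impI)
    fix i s assume i: "i < Suc d" and s: "s < n"
    show "reg (\<Sum>k<n. fps_to_fls (A s k) * e i k)"
    proof (cases "i < d")
      case True
      then show ?thesis using AS[OF s, of "e' i"] e'(1) s by (simp add: e_def)
    next
      case False
      have "S (\<lambda>k. if k = r then 1 else 0) = (\<lambda>k. fls_const (v k) * ?z)"
        by (auto simp: S_def)
      then show ?thesis using AS[OF s, of "\<lambda>k. if k = r then 1 else 0"] False r
        by (simp add: e_def if_distrib[of "(*) _"] cong: if_cong)
    qed
  next
    fix c assume "\<forall>s<n. reg (\<Sum>k<n. fps_to_fls (A s k) * c k)"
    then have "\<forall>s<n. reg (\<Sum>k<n. fps_to_fls (A1 s k) * T c k)"
      using AS[of _ "T c"] by (simp add: ST)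
    from e'(2)[OF this] obtain a where a: "\<And>k. k < n \<Longrightarrow> reg (T c k - (\<Sum>i<d. fls_const (a i) * e' i k))" by blast
    define f where "f k = T c k - (\<Sum>i<d. fls_const (a i) * e' i k)" for k
    \<comment> \<open>Dividing the regular series \<open>f r\<close> by \<open>X\<close> leaves a
      single polar coefficient, the constant term of \<open>f r\<close>: this is the coordinate
      along the new vector.\<close>
    define a' where "a' i = (if i < d then a i else fls_nth (f r) 0)" for i
    have "reg (c k - (\<Sum>i<Suc d. fls_const (a' i) * e i k))" if k: "k < n" for k
    proof -
      have s: "(\<Sum>i<d. fls_const (a' i) * e' i m) = T c m - f m" for m
        unfolding f_def by (simp add: a'_def)
      have "c k - (\<Sum>i<Suc d. fls_const (a' i) * e i k) = S (T c) k - (\<Sum>i<Suc d. fls_const (a' i) * e i k)"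
        by (simp only: ST)
      also have "\<dots> = (if k = r then 0 else f k) + fls_const (v k) * (?z * f r - ?z * fls_const (fls_nth (f r) 0))"
        unfolding Se s S_def by (auto simp: a'_def algebra_simps)
      finally show ?thesis
        using a k r zreg[of "f r"] by (auto simp: f_def intro!: reg_add reg_mult)
    qed
    then show "\<exists>a. \<forall>k<n. reg (c k - (\<Sum>i<Suc d. fls_const (a i) * e i k))" by blast
  next
    fix a i assume as: "\<forall>k<n. reg (\<Sum>i<Suc d. fls_const (a i) * e i k)" and i: "i < Suc d"
    define w where "w k = (\<Sum>i<d. fls_const (a i) * e' i k)" for k
    have R: "reg ((if k = r then 0 else w k) + fls_const (v k) * (?z * (w r + fls_const (a d))))" if "k < n" for k
      using as that unfolding Se w_def by blast
    \<comment> \<open>Component \<open>r\<close> consists of the quotient by \<open>X\<close> alone.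
      Its regularity makes \<open>w r\<close>, and then every \<open>w k\<close>, regular; this
      kills the old coefficients, and \<open>a d\<close> remains as a polar coefficient that must
      vanish.\<close>
    have zr: "reg (?z * (w r + fls_const (a d)))"
      using R[OF r(1)] reg_const_cancel[OF r(2)] by simp
    have "reg (fls_X * (?z * (w r + fls_const (a d))))"
      by (intro reg_mult zr) (auto simp: reg_def)
    also have "fls_X * (?z * (w r + fls_const (a d))) = (fls_X * ?z) * (w r + fls_const (a d))" by (simp only: mult_ac)
    finally have "reg (w r + fls_const (a d))" by (simp add: zX)
    then have "reg (w r + fls_const (a d) - fls_const (a d))" by (intro reg_diff) auto
    then have wr: "reg (w r)" by simp
    have "reg (w k)" if "k < n" for k
    proof (cases "k = r")
      case False
      have "reg (w k + fls_const (v k) * (?z * (w r + fls_const (a d))) - fls_const (v k) * (?z * (w r + fls_const (a d))))"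
        using R[OF that] False by (intro reg_diff reg_mult[OF _ zr]) auto
      then show ?thesis by simp
    qed (use wr in simp)
    then have ad: "\<forall>i<d. a i = 0" unfolding w_def by (intro e'(3)) blast
    then have "w r = 0" by (simp add: w_def)
    moreover have "fls_nth (?z * (w r + fls_const (a d))) (-1) = 0"
      by (rule zr[unfolded reg_def, rule_format]) simp
    ultimately have "fls_nth (?z * fls_const (a d)) (-1) = 0" by simp
    then have "a d = 0" by (simp add: fls_X_inv_times_conv_shift fls_const_nth)
    then show "a i = 0" using ad i by (auto simp: less_Suc_eq)
  qed
qed

section \<open>Root vectors and the characteristic determinant\<close>

text \<open>A pole of order at most \<open>N\<close> lets only the first \<open>N\<close> Taylor
  coefficients enter the residue; shifting \<open>c\<close> into a power series turns it into a
  Cauchy product.\<close>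

lemma fps_mult_fls_residue:
  fixes c :: "complex fls"
  assumes N: "\<And>m. m < - int N \<Longrightarrow> fls_nth c m = 0"
  shows "fls_nth (fps_to_fls F * c) (-1) = (\<Sum>i<N. fps_nth F i * fls_nth c (- 1 - int i))"
proof -
  define G where "G = fls_regpart (fls_shift (- int N) c)"
  have G: "fps_nth G m = fls_nth c (int m - int N)" for m by (simp add: G_def)
  have c: "c = fls_shift (int N) (fps_to_fls G)"
    by (rule fls_eqI) (auto simp: G N)
  have "fps_to_fls F * c = fls_shift (int N) (fps_to_fls (F * G))"
    unfolding c by (simp add: fls_shifted_times_simps fls_times_fps_to_fls)
  then have "fls_nth (fps_to_fls F * c) (-1) = fls_nth (fps_to_fls (F * G)) (int N - 1)" by simp
  also have "\<dots> = (\<Sum>i<N. fps_nth F i * fls_nth c (- 1 - int i))"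
  proof (cases N)
    case (Suc M)
    then have "fls_nth (fps_to_fls (F * G)) (int N - 1) = (\<Sum>i=0..M. fps_nth F i * fps_nth G (M - i))"
      by (simp add: fps_mult_nth)
    also have "\<dots> = (\<Sum>i<N. fps_nth F i * fls_nth c (- 1 - int i))"
    proof (rule sum.cong)
      fix i assume "i \<in> {..<N}"
      then have "int (M - i) - int N = - 1 - int i" using Suc by auto
      then show "fps_nth F i * fps_nth G (M - i) = fps_nth F i * fls_nth c (- 1 - int i)" by (simp only: G)
    qed (use Suc in auto)
    finally show ?thesis .
  qed simp
  finally show ?thesis .
qed

lemma fls_X_nth: "fls_nth (fls_X * (c::complex fls)) m = fls_nth c (m - 1)"
  by (simp add: fls_X_times_conv_shift)

lemma fls_X_power_nth: "fls_nth (fls_X ^ i * (c::complex fls)) m = fls_nth c (m - int i)"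
  by (induction i arbitrary: m) (auto simp only: power_Suc mult.assoc fls_X_nth, auto simp: algebra_simps)

lemma common_pole_bound:
  fixes n :: nat
  shows "\<exists>N. \<forall>k<n. \<forall>m< - int N. fls_nth (c k :: complex fls) m = 0"
proof -
  define N where "N = (\<Sum>k<n. nat (- fls_subdegree (c k)))"
  have "fls_nth (c k) m = 0" if "k < n" "m < - int N" for k m
  proof -
    have "nat (- fls_subdegree (c k)) \<le> N"
      unfolding N_def by (rule member_le_sum[where f = "\<lambda>k. nat (- fls_subdegree (c k))"]) (use that in auto)
    then show ?thesis using that by (intro fls_eq0_below_subdegree) linarith
  qed
  then show ?thesis by blast
qed

section \<open>The characteristic matrix and the residue pairing\<close>

locale dirac_bc = dirac +
  fixes C D :: "complex Matrix.mat"
  assumes C_dim: "C \<in> carrier_mat n n" and D_dim: "D \<in> carrier_mat n n"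
begin

lemma Amat_carrier: "Amat n l \<beta> Q C D \<mu> \<in> carrier_mat n n"
  using C_dim D_dim by (simp add: Amat_def)

lemma Amat_entry: "i < n \<Longrightarrow> k < n \<Longrightarrow>
  Amat n l \<beta> Q C D \<mu> $$ (i, k) = C $$ (i, k) + (\<Sum>m<n. D $$ (i, m) * fund n l \<beta> Q \<mu> l m k)"
  using C_dim D_dim by (simp add: Amat_def scalar_prod_def lessThan_atLeast0)

definition Afps :: "complex \<Rightarrow> nat \<Rightarrow> nat \<Rightarrow> complex fps" where
  "Afps \<mu> i k = fps_const (C $$ (i, k)) + (\<Sum>m<n. fps_const (D $$ (i, m)) * Phifps \<mu> l m k)"

abbreviation "detA \<mu> \<equiv> Determinant.det (Matrix.mat n n (\<lambda>(i,k). Afps \<mu> i k))"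

text \<open>Leibniz's formula is the same polynomial in the entries on both sides, so only the
  expansions of the entries matter.\<close>

lemma DeltaQ_fps: "(\<lambda>z. DeltaQ n l \<beta> Q C D (\<mu> + z)) has_fps_expansion detA \<mu>"
proof -
  have ent: "(\<lambda>z. Amat n l \<beta> Q C D (\<mu> + z) $$ (i, k)) has_fps_expansion Afps \<mu> i k" if "i < n" "k < n" for i k
    unfolding Amat_entry[OF that] Afps_def
    using l_pos that by (intro has_fps_expansion_add has_fps_expansion_const has_fps_expansion_sum has_fps_expansion_mult fund_has_fps_expansion) auto
  have "(\<lambda>z. \<Sum>p\<in>{p. p permutes {0..<n}}. of_int (sign p) * (\<Prod>i=0..<n. Amat n l \<beta> Q C D (\<mu> + z) $$ (i, p i)))
     has_fps_expansion (\<Sum>p\<in>{p. p permutes {0..<n}}. fps_const (of_int (sign p)) * (\<Prod>i=0..<n. Afps \<mu> i (p i)))"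
  proof (intro has_fps_expansion_const has_fps_expansion_mult has_fps_expansion_sum has_fps_expansion_prod ent)
    fix p i assume "p \<in> {p. p permutes {0..<n}}" "i \<in> {0..<n}"
    then show "p i < n" "i < n" using permutes_in_image[of p "{0..<n}" i] by auto
  qed
  moreover have "(\<lambda>z. \<Sum>p\<in>{p. p permutes {0..<n}}. of_int (sign p) * (\<Prod>i=0..<n. Amat n l \<beta> Q C D (\<mu> + z) $$ (i, p i))) =
      (\<lambda>z. DeltaQ n l \<beta> Q C D (\<mu> + z))"
    unfolding DeltaQ_def det_def'[OF Amat_carrier] by simp
  moreover have "(\<Sum>p\<in>{p. p permutes {0..<n}}. fps_const (of_int (sign p)) * (\<Prod>i=0..<n. Afps \<mu> i (p i))) = detA \<mu>"
  proof -
    have c: "Matrix.mat n n (\<lambda>(i,k). Afps \<mu> i k) \<in> carrier_mat n n" by simp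
    show ?thesis unfolding det_def'[OF c]
    proof (intro sum.cong refl)
      fix p assume p: "p \<in> {p. p permutes {0..<n}}"
      have "(\<Prod>i=0..<n. Afps \<mu> i (p i)) = (\<Prod>i=0..<n. Matrix.mat n n (\<lambda>(i,k). Afps \<mu> i k) $$ (i, p i))"
        using permutes_in_image[of p "{0..<n}"] p by (intro prod.cong) auto
      then show "fps_const (of_int (sign p)) * (\<Prod>i=0..<n. Afps \<mu> i (p i)) =
         signof p * (\<Prod>i=0..<n. Matrix.mat n n (\<lambda>(i,k). Afps \<mu> i k) $$ (i, p i))"
        by (simp add: sign_def)
    qed
  qed
  ultimately show ?thesis by simp
qed

definition Ubc :: "(real \<Rightarrow> nat \<Rightarrow> complex) \<Rightarrow> nat \<Rightarrow> complex" where
  "Ubc y i = (\<Sum>k<n. C $$ (i,k) * y 0 k + D $$ (i,k) * y l k)"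

text \<open>Residue pairing of the fundamental matrix with a Laurent vector: polar parts \<open>c\<close> with \<open>A c\<close>
  regular correspond bijectively to root vectors, and multiplication by the local parameter to the
  operator minus \<open>\<mu>\<close>.\<close>

definition Psi :: "complex \<Rightarrow> (nat \<Rightarrow> complex fls) \<Rightarrow> real \<Rightarrow> nat \<Rightarrow> complex" where
  "Psi \<mu> c x j = (\<Sum>k<n. fls_nth (fps_to_fls (Phifps \<mu> x j k) * c k) (-1))"

lemma Psi_expand:
  assumes "\<And>k m. k < n \<Longrightarrow> m < - int N \<Longrightarrow> fls_nth (c k) m = 0"
  shows "Psi \<mu> c x j = (\<Sum>k<n. \<Sum>i<N. fls_nth (c k) (- 1 - int i) * Phi \<mu> i x j k)"
  unfolding Psi_def
proof (intro sum.cong refl)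
  fix k assume "k \<in> {..<n}"
  then have "fls_nth (fps_to_fls (Phifps \<mu> x j k) * c k) (-1) = (\<Sum>i<N. fps_nth (Phifps \<mu> x j k) i * fls_nth (c k) (- 1 - int i))"
    by (intro fps_mult_fls_residue assms) auto
  then show "fls_nth (fps_to_fls (Phifps \<mu> x j k) * c k) (-1) = (\<Sum>i<N. fls_nth (c k) (- 1 - int i) * Phi \<mu> i x j k)"
    by (simp only: Phifps_def fps_nth_Abs_fps mult.commute)
qed

lemma Psi_reg:
  assumes "\<And>k. k < n \<Longrightarrow> reg (c k)"
  shows "Psi \<mu> c x j = 0"
  using Psi_expand[of 0 c \<mu> x j] assms by (simp add: reg_def)

lemma Psi_diff: "Psi \<mu> (\<lambda>k. c k - c' k) x j = Psi \<mu> c x j - Psi \<mu> c' x j"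
  by (simp add: Psi_def right_diff_distrib sum_subtractf)

lemma Psi_sum: "Psi \<mu> (\<lambda>k. \<Sum>i\<in>I. fls_const (a i) * e i k) x j = (\<Sum>i\<in>I. a i * Psi \<mu> (e i) x j)"
proof -
  have "fps_to_fls (Phifps \<mu> x j k) * (\<Sum>i\<in>I. fls_const (a i) * e i k) =
      (\<Sum>i\<in>I. fls_const (a i) * (fps_to_fls (Phifps \<mu> x j k) * e i k))" for k
    by (simp add: sum_distrib_left mult_ac)
  then show ?thesis
    unfolding Psi_def by (simp add: fls_nth_sum sum_distrib_left) (rule sum.swap)
qed

text \<open>Multiplication by \<open>fls_X\<close> shifts the coefficients of \<open>c\<close> by
  one, and the operator minus \<open>\<mu>\<close> sends \<open>Phi \<mu> (Suc i)\<close> to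
  \<open>Phi \<mu> i\<close>; the two shifts match.\<close>

lemma Psi_ac: "ac_solves n l \<beta> Q (Psi \<mu> c) (\<lambda>x j. \<mu> * Psi \<mu> c x j + Psi \<mu> (\<lambda>k. fls_X * c k) x j)"
proof -
  obtain N where N: "\<And>k m. k < n \<Longrightarrow> m < - int N \<Longrightarrow> fls_nth (c k) m = 0"
    using common_pole_bound[of n c] by blast
  have N': "fls_nth (fls_X * c k) m = 0" if "k < n" "m < - int N" for k m
    using N that by (simp add: fls_X_nth)
  have e: "Psi \<mu> c x j = (\<Sum>p\<in>{..<n}\<times>{..<N}. fls_nth (c (fst p)) (- 1 - int (snd p)) * Phi \<mu> (snd p) x j (fst p))" for x j
  proof -
    have "Psi \<mu> c x j = (\<Sum>k<n. \<Sum>i<N. fls_nth (c k) (- 1 - int i) * Phi \<mu> i x j k)"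
      by (rule Psi_expand) (rule N)
    then show ?thesis by (simp add: sum.cartesian_product split_def del: Phi.simps)
  qed
  have shift: "(\<Sum>i<N. fls_nth (c k) (- 1 - int i) * (if i = 0 then 0 else Phi \<mu> (i - 1) x j k)) =
      (\<Sum>i<N. fls_nth (fls_X * c k) (- 1 - int i) * Phi \<mu> i x j k)" if k: "k < n" for k x j
  proof (cases N)
    case (Suc M)
    \<comment> \<open>The shift drops an end term; its coefficient lies below the common pole order
      and vanishes.\<close>
    have "fls_nth (c k) (- int M - 2) = 0" using N[OF k] Suc by simp
    then show ?thesis
      unfolding Suc
      by (subst sum.lessThan_Suc_shift) (simp add: fls_X_nth algebra_simps del: Phi.simps)
  qed simp
  have "ac_solves n l \<beta> Q
     (\<lambda>x j. \<Sum>p\<in>{..<n}\<times>{..<N}. fls_nth (c (fst p)) (- 1 - int (snd p)) * Phi \<mu> (snd p) x j (fst p))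
     (\<lambda>x j. \<Sum>p\<in>{..<n}\<times>{..<N}. fls_nth (c (fst p)) (- 1 - int (snd p)) *
        (\<mu> * Phi \<mu> (snd p) x j (fst p) + (if snd p = 0 then 0 else Phi \<mu> (snd p - 1) x j (fst p))))"
  proof (rule ac_solves_sum)
    fix p
    show "ac_solves n l \<beta> Q (\<lambda>x j. Phi \<mu> (snd p) x j (fst p))
       (\<lambda>x j. \<mu> * Phi \<mu> (snd p) x j (fst p) + (if snd p = 0 then 0 else Phi \<mu> (snd p - 1) x j (fst p)))"
      using Phi_ac_0[of \<mu> "fst p"] Phi_ac_Suc[of \<mu> "snd p - 1" "fst p"] by (cases "snd p") (auto simp del: Phi.simps)
  qed simp
  then show ?thesis
  proof (rule ac_solves_cong)
    fix x j
    have "(\<Sum>p\<in>{..<n}\<times>{..<N}. fls_nth (c (fst p)) (- 1 - int (snd p)) * (if snd p = 0 then 0 else Phi \<mu> (snd p - 1) x j (fst p))) =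
       (\<Sum>k<n. \<Sum>i<N. fls_nth (c k) (- 1 - int i) * (if i = 0 then 0 else Phi \<mu> (i - 1) x j k))"
      by (simp add: sum.cartesian_product case_prod_beta del: Phi.simps)
    also have "\<dots> = Psi \<mu> (\<lambda>k. fls_X * c k) x j"
    proof -
      have "Psi \<mu> (\<lambda>k. fls_X * c k) x j = (\<Sum>k<n. \<Sum>i<N. fls_nth (fls_X * c k) (- 1 - int i) * Phi \<mu> i x j k)"
        by (rule Psi_expand) (rule N')
      also have "\<dots> = (\<Sum>k<n. \<Sum>i<N. fls_nth (c k) (- 1 - int i) * (if i = 0 then 0 else Phi \<mu> (i - 1) x j k))"
        by (rule sum.cong[OF refl], rule shift[symmetric]) simp
      finally show ?thesis ..
    qed
    finally have s2: "(\<Sum>p\<in>{..<n}\<times>{..<N}. fls_nth (c (fst p)) (- 1 - int (snd p)) * (if snd p = 0 then 0 else Phi \<mu> (snd p - 1) x j (fst p))) =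
       Psi \<mu> (\<lambda>k. fls_X * c k) x j" .
    show "\<mu> * Psi \<mu> c x j + Psi \<mu> (\<lambda>k. fls_X * c k) x j =
      (\<Sum>p\<in>{..<n}\<times>{..<N}. fls_nth (c (fst p)) (- 1 - int (snd p)) *
        (\<mu> * Phi \<mu> (snd p) x j (fst p) + (if snd p = 0 then 0 else Phi \<mu> (snd p - 1) x j (fst p))))"
      unfolding e s2[symmetric] by (simp add: distrib_left sum.distrib sum_distrib_left mult_ac del: Phi.simps)
  qed (simp add: e)
qed

text \<open>At 0 the fundamental matrix is the identity for every parameter, so initial values read
  off the residues of \<open>c\<close>. Applied to \<open>fls_X ^ i * c\<close> this recovers every
  polar coefficient.\<close>

lemma Psi_at_0:
  assumes j: "j < n"
  shows "Psi \<mu> c 0 j = fls_nth (c j) (-1)"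
proof -
  have "Phifps \<mu> 0 j k = (if j = k then 1 else 0)" for k
    by (rule fps_ext) (simp add: Phifps_def Phi_at_0[OF j] del: Phi.simps)
  then have "Psi \<mu> c 0 j = (\<Sum>k<n. if j = k then fls_nth (c j) (-1) else 0)"
    unfolding Psi_def by (intro sum.cong) auto
  then show ?thesis using j by simp
qed

text \<open>The boundary form is linear and A is C plus D times the fundamental matrix at
  \<open>l\<close>, so applying it under the residue produces \<open>A c\<close>. The boundary
  conditions along a chain thus say that \<open>A c\<close> has no polar part.\<close>

lemma Ubc_Psi: "Ubc (Psi \<mu> c) i = fls_nth (\<Sum>k<n. fps_to_fls (Afps \<mu> i k) * c k) (-1)"
proof -
  have "fps_to_fls (Afps \<mu> i k) * c k = fls_const (C $$ (i,k)) * c k +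
      (\<Sum>m<n. fls_const (D $$ (i,m)) * (fps_to_fls (Phifps \<mu> l m k) * c k))" for k
    unfolding Afps_def by (simp add: fps_to_fls_sum fls_times_fps_to_fls distrib_right sum_distrib_right mult.assoc)
  then have "fls_nth (\<Sum>k<n. fps_to_fls (Afps \<mu> i k) * c k) (-1) =
     (\<Sum>k<n. C $$ (i,k) * fls_nth (c k) (-1)) + (\<Sum>k<n. \<Sum>m<n. D $$ (i,m) * fls_nth (fps_to_fls (Phifps \<mu> l m k) * c k) (-1))"
    by (simp add: fls_nth_sum sum.distrib)
  also have "(\<Sum>k<n. \<Sum>m<n. D $$ (i,m) * fls_nth (fps_to_fls (Phifps \<mu> l m k) * c k) (-1)) = (\<Sum>m<n. D $$ (i,m) * Psi \<mu> c l m)"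
    unfolding Psi_def sum_distrib_left by (rule sum.swap)
  also have "(\<Sum>k<n. C $$ (i,k) * fls_nth (c k) (-1)) = (\<Sum>k<n. C $$ (i,k) * Psi \<mu> c 0 k)"
    by (intro sum.cong) (auto simp: Psi_at_0)
  finally show ?thesis by (simp add: Ubc_def sum.distrib)
qed

lemma in_H_cont: "cont g \<Longrightarrow> in_H n l \<beta> g"
  unfolding in_H_def V.cont_def
proof (intro allI impI conjI)
  fix k assume g: "\<forall>k<n. continuous_on {0..l} (\<lambda>x. g x k)" and k: "k < n"
  then show "(\<lambda>x. g x k) \<in> borel_measurable (lebesgue_on {0..l})"
    by (intro continuous_imp_measurable_on_sets_lebesgue) auto
  have "(\<lambda>x. \<bar>\<beta> k x\<bar> * (cmod (g x k))\<^sup>2) absolutely_integrable_on {0..l}"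
    using g k absint_norm[OF beta_int[OF k]] by (intro absint_mult_cont continuous_intros) auto
  then show "(\<lambda>x. \<bar>\<beta> k x\<bar> * (cmod (g x k))\<^sup>2) integrable_on {0..l}" by (simp add: absolutely_integrable_on_def)
qed

lemma op_LU_I:
  assumes "ac_solves n l \<beta> Q y (\<lambda>x j. \<mu> * y x j + h x j)" "cont h" "\<And>i. i < n \<Longrightarrow> Ubc y i = 0"
  shows "op_LU n l \<beta> Q C D y (\<lambda>x j. \<mu> * y x j + h x j)"
  unfolding op_LU_def
proof (intro conjI)
  show "in_H n l \<beta> (\<lambda>x j. \<mu> * y x j + h x j)"
    using ac_solves_cont[OF assms(1)] assms(2) by (intro in_H_cont) (auto simp: V.cont_def intro!: continuous_intros)
qed (use assms in \<open>auto simp: Ubc_def\<close>)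

lemma H_eq_refl: "H_eq n l f f" by (simp add: H_eq_def)

text \<open>The chain consists of \<open>Psi\<close> at \<open>fls_X ^ i * c\<close>. The boundary
  form of its \<open>i\<close>-th member is the coefficient of \<open>A c\<close> at
  \<open>- 1 - i\<close>, which vanishes, and the chain ends once the powers of \<open>fls_X\<close>
  have removed all poles.\<close>

lemma root_vec_Psi:
  assumes A: "\<forall>r<n. reg (\<Sum>k<n. fps_to_fls (Afps \<mu> r k) * c k)"
  shows "root_vec n l \<beta> Q C D \<mu> (Psi \<mu> c)"
proof -
  obtain N where N: "\<And>k m. k < n \<Longrightarrow> m < - int N \<Longrightarrow> fls_nth (c k) m = 0"
    using common_pole_bound[of n c] by blast
  define ys where "ys i = Psi \<mu> (\<lambda>k. fls_X ^ i * c k)" for i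
  have ac: "ac_solves n l \<beta> Q (ys i) (\<lambda>x j. \<mu> * ys i x j + ys (Suc i) x j)" for i
    using Psi_ac[of \<mu> "\<lambda>k. fls_X ^ i * c k"] by (simp add: ys_def mult_ac)
  have U: "Ubc (ys i) r = 0" if r: "r < n" for i r
  proof -
    have "(\<Sum>k<n. fps_to_fls (Afps \<mu> r k) * (fls_X ^ i * c k)) = fls_X ^ i * (\<Sum>k<n. fps_to_fls (Afps \<mu> r k) * c k)"
      by (simp add: sum_distrib_left mult_ac)
    then show ?thesis using A r unfolding ys_def Ubc_Psi by (simp add: fls_X_power_nth reg_def)
  qed
  show ?thesis
    unfolding root_vec_def
  \<comment> \<open>\<open>Suc N\<close> rather than \<open>N\<close>: the chain must have length at
    least 1 even if \<open>c\<close> has no poles.\<close>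
  proof (intro exI[of _ "Suc N"] exI[of _ ys] conjI allI impI)
    show "ys 0 = Psi \<mu> c" by (simp add: ys_def)
    have "ys (Suc N) x j = 0" for x j
      unfolding ys_def by (rule Psi_reg) (unfold reg_def fls_X_power_nth, use N in auto)
    then show "H_eq n l (ys (Suc N)) (\<lambda>x j. 0)" by (simp add: H_eq_def)
    fix i
    show "\<exists>g. op_LU n l \<beta> Q C D (ys i) g \<and> H_eq n l (ys (Suc i)) (\<lambda>x j. g x j - \<mu> * ys i x j)"
      using op_LU_I[OF ac ac_solves_cont[OF ac] U] by (intro exI[of _ "\<lambda>x j. \<mu> * ys i x j + ys (Suc i) x j"]) (simp add: H_eq_refl)
  qed simp
qed

lemma H_eq_sym_shift:
  assumes "H_eq n l f (\<lambda>x j. g x j - \<mu> * y x j)"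
  shows "H_eq n l g (\<lambda>x j. \<mu> * y x j + f x j)"
  using assms unfolding H_eq_def by (auto elim!: eventually_mono)

text \<open>The initial values of y, (L - \<mu>) y, and so on serve as polar coefficients of
  \<open>c\<close>. From the end of the chain, where both sides are 0, uniqueness of the Cauchy
  problem identifies each member in turn with \<open>Psi\<close> at the corresponding shift of
  \<open>c\<close>.\<close>

lemma Psi_surj:
  assumes "root_vec n l \<beta> Q C D \<mu> y"
  shows "\<exists>c. (\<forall>r<n. reg (\<Sum>k<n. fps_to_fls (Afps \<mu> r k) * c k)) \<and> (\<forall>x\<in>{0..l}. \<forall>j<n. y x j = Psi \<mu> c x j)"
proof -
  obtain K ys where K: "K \<ge> 1" and y0: "ys 0 = y" and yK: "H_eq n l (ys K) (\<lambda>x j. 0)"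
    and ch: "\<And>i. i < K \<Longrightarrow> \<exists>g. op_LU n l \<beta> Q C D (ys i) g \<and> H_eq n l (ys (Suc i)) (\<lambda>x j. g x j - \<mu> * ys i x j)"
    using assms unfolding root_vec_def by blast
  \<comment> \<open>The last member of the chain vanishes only almost everywhere; replacing the tail
    by 0 makes its initial value 0 as well.\<close>
  define w where "w i = (if i < K then ys i else (\<lambda>x j. 0))" for i
  have wac: "ac_solves n l \<beta> Q (w i) (\<lambda>x j. \<mu> * w i x j + w (Suc i) x j)"
    and wU: "\<And>r. r < n \<Longrightarrow> Ubc (w i) r = 0" if i: "i < K" for i
  proof -
    obtain g where g: "op_LU n l \<beta> Q C D (ys i) g" "H_eq n l (ys (Suc i)) (\<lambda>x j. g x j - \<mu> * ys i x j)"
      using ch[OF i] by blast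
    have "H_eq n l (w (Suc i)) (\<lambda>x j. g x j - \<mu> * ys i x j)"
    proof (cases "Suc i < K")
      case False
      then have "Suc i = K" using i by simp
      then show ?thesis using g(2) yK False unfolding H_eq_def w_def
        by (auto elim!: eventually_elim2)
    qed (use g in \<open>simp add: w_def\<close>)
    from ac_solves_AE[OF _ H_eq_sym_shift[OF this], of "ys i"]
    show "ac_solves n l \<beta> Q (w i) (\<lambda>x j. \<mu> * w i x j + w (Suc i) x j)"
      using g(1) i by (simp add: op_LU_def w_def)
    show "Ubc (w i) r = 0" if "r < n" for r
      using g(1) i that by (simp add: op_LU_def w_def Ubc_def)
  qed
  \<comment> \<open>The coefficient at \<open>- 1 - i\<close> is the initial value of the
    \<open>i\<close>-th member; the reflection \<open>K - 1 - m\<close> and the shift by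
    \<open>K\<close> only translate power series indices.\<close>
  define c where "c j = fls_shift (int K) (fps_to_fls (Abs_fps (\<lambda>m. if m < K then w (K - 1 - m) 0 j else 0)))" for j
  have cn: "fls_nth (c j) (- 1 - int i) = w i 0 j" for i j
  proof (cases "i < K")
    case True
    then have "nat (- 1 - int i + int K) = K - Suc i" "K - Suc (K - Suc i) = i" by auto
    then show ?thesis using True by (auto simp: c_def)
  qed (auto simp: c_def w_def)
  have cp: "fls_nth (c j) m = 0" if "m < - int K" for j m
    using that by (simp add: c_def)
  have regK: "reg (fls_X ^ i * c k)" if "i \<ge> K" for i k
    using that by (auto simp: reg_def fls_X_power_nth cp)
  have wPsi: "\<forall>x\<in>{0..l}. \<forall>j<n. w i x j = Psi \<mu> (\<lambda>k. fls_X ^ i * c k) x j" if "i \<le> K" for i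
    using that
  proof (induction rule: inc_induct)
    case base
    show ?case using Psi_reg[OF regK[OF order_refl]] by (simp add: w_def)
  next
    case (step i)
    show ?case
    proof (intro ballI allI impI)
      fix x j assume xj: "x \<in> {0..l}" "j < n"
      show "w i x j = Psi \<mu> (\<lambda>k. fls_X ^ i * c k) x j"
      proof (rule ac_unique[OF wac[OF step.hyps(2)] _ _ _ xj])
        show "ac_solves n l \<beta> Q (Psi \<mu> (\<lambda>k. fls_X ^ i * c k)) (\<lambda>x j. \<mu> * Psi \<mu> (\<lambda>k. fls_X ^ i * c k) x j + Psi \<mu> (\<lambda>k. fls_X ^ Suc i * c k) x j)"
          using Psi_ac[of \<mu> "\<lambda>k. fls_X ^ i * c k"] by (simp add: mult_ac)
        show "w i 0 j = Psi \<mu> (\<lambda>k. fls_X ^ i * c k) 0 j" if "j < n" for j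
          using that by (simp add: Psi_at_0 fls_X_power_nth cn)
      qed (use step.IH in blast)
    qed
  qed
  have "reg (\<Sum>k<n. fps_to_fls (Afps \<mu> r k) * c k)" if r: "r < n" for r
    unfolding reg_def
  proof (intro allI impI)
    fix m :: int assume m: "m < 0"
    define i where "i = nat (- 1 - m)"
    have mi: "m = - 1 - int i" using m by (simp add: i_def)
    have "fls_nth (\<Sum>k<n. fps_to_fls (Afps \<mu> r k) * c k) m = fls_nth (fls_X ^ i * (\<Sum>k<n. fps_to_fls (Afps \<mu> r k) * c k)) (-1)"
      by (simp add: fls_X_power_nth mi)
    also have "fls_X ^ i * (\<Sum>k<n. fps_to_fls (Afps \<mu> r k) * c k) = (\<Sum>k<n. fps_to_fls (Afps \<mu> r k) * (fls_X ^ i * c k))"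
      by (simp add: sum_distrib_left mult_ac)
    also have "fls_nth \<dots> (-1) = Ubc (Psi \<mu> (\<lambda>k. fls_X ^ i * c k)) r" by (simp add: Ubc_Psi)
    also have "\<dots> = 0"
    proof (cases "i < K")
      case True
      then have "Ubc (Psi \<mu> (\<lambda>k. fls_X ^ i * c k)) r = Ubc (w i) r"
        unfolding Ubc_def using wPsi[of i] l_pos by (intro sum.cong) auto
      then show ?thesis using wU[OF True r] by simp
    next
      case False
      then show ?thesis using Psi_reg[OF regK[of i]] by (simp add: Ubc_def)
    qed
    finally show "fls_nth (\<Sum>k<n. fps_to_fls (Afps \<mu> r k) * c k) m = 0" .
  qed
  moreover have "\<forall>x\<in>{0..l}. \<forall>j<n. y x j = Psi \<mu> c x j"
    using wPsi[of 0] K y0 by (simp add: w_def)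
  ultimately show ?thesis by blast
qed

text \<open>Near a point where \<open>h\<close> is nonzero it deviates from that value by at most
  half. As the weight has constant sign, the integral of the weight times \<open>h\<close> over such
  an interval cannot vanish.\<close>

lemma Bint_zero:
  assumes h: "cont h" and z: "\<And>x. x \<in> {0..l} \<Longrightarrow> Bint h x j = 0" and j: "j < n" and x: "x \<in> {0..l}"
  shows "h x j = 0"
proof (rule ccontr)
  assume ne: "h x j \<noteq> 0"
  have hc: "continuous_on {0..l} (\<lambda>t. h t j)" using h j by (simp add: V.cont_def)
  then obtain d where d: "d > 0" "\<And>t. t \<in> {0..l} \<Longrightarrow> dist t x < d \<Longrightarrow> dist (h t j) (h x j) < cmod (h x j) / 2"
    using ne x unfolding continuous_on_iff by (metis half_gt_zero zero_less_norm_iff)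
  define a b where "a = max 0 (x - d / 2)" and "b = min l (x + d / 2)"
  have ab: "0 \<le> a" "a < b" "b \<le> l" using x d(1) l_pos by (auto simp: a_def b_def)
  have near: "cmod (h t j - h x j) \<le> cmod (h x j) / 2" if "t \<in> {a..b}" for t
  proof -
    have "t \<in> {0..l}" "\<bar>t - x\<bar> < d" using that ab d(1) by (auto simp: a_def b_def)
    from d(2)[OF this(1)] this(2) show ?thesis by (simp add: dist_norm)
  qed
  have bi: "(\<lambda>t. complex_of_real (\<beta> j t)) absolutely_integrable_on {a..b}"
    using absint_subinterval[OF betac_int[OF j] ab(1,3)] .
  have hc': "continuous_on {a..b} (\<lambda>t. h t j)" using continuous_on_subset[OF hc] ab by auto
  have "integral {a..b} (\<lambda>t. \<i> * complex_of_real (\<beta> j t) * h t j) = Bint h b j - Bint h a j"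
    unfolding Bint_def by (rule integral_diff_interval[OF Bint_integrand[OF h j], symmetric]) (use ab in auto)
  also have "\<dots> = 0" using z ab by simp
  finally have "\<i> * integral {a..b} (\<lambda>t. complex_of_real (\<beta> j t) * h t j) = 0" by (simp add: mult.assoc)
  then have 0: "integral {a..b} (\<lambda>t. complex_of_real (\<beta> j t) * h t j) = 0" by simp
  have ii: "(\<lambda>t. complex_of_real (\<beta> j t) * h t j) integrable_on {a..b}" "(\<lambda>t. complex_of_real (\<beta> j t) * h x j) integrable_on {a..b}"
    using absint_mult_cont[OF bi hc'] absint_mult_cont[OF bi continuous_on_const] by (auto simp: absolutely_integrable_on_def)
  have "integral {a..b} (\<lambda>t. complex_of_real (\<beta> j t) * (h t j - h x j)) = - (integral {a..b} (\<lambda>t. complex_of_real (\<beta> j t)) * h x j)"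
    using ii 0 by (simp add: right_diff_distrib Henstock_Kurzweil_Integration.integral_diff)
  then have "norm (integral {a..b} (\<lambda>t. complex_of_real (\<beta> j t))) * cmod (h x j) =
     norm (integral {a..b} (\<lambda>t. complex_of_real (\<beta> j t) * (h t j - h x j)))" by (simp add: norm_mult)
  also have "\<dots> \<le> cmod (h x j) / 2 * integral {a..b} (\<lambda>t. norm (complex_of_real (\<beta> j t)))"
    by (rule integral_product_bound[OF bi]) (use near in \<open>auto intro!: continuous_intros hc'\<close>)
  finally have "integral {a..b} (\<lambda>t. \<bar>\<beta> j t\<bar>) * cmod (h x j) \<le> cmod (h x j) / 2 * integral {a..b} (\<lambda>t. \<bar>\<beta> j t\<bar>)"
    using beta_abs_integral_pos(2)[OF j ab] by simp
  moreover have "0 < integral {a..b} (\<lambda>t. \<bar>\<beta> j t\<bar>) * cmod (h x j)"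
    using beta_abs_integral_pos(1)[OF j ab] ne by simp
  ultimately show False by (simp add: mult.commute)
qed

text \<open>If \<open>Psi\<close> vanishes at \<open>c\<close>, the equation leaves
  \<open>Bint\<close> of \<open>Psi\<close> at \<open>fls_X * c\<close> equal to 0, so that function
  vanishes too. Inductively all shifts give 0, and their initial values are all the polar
  coefficients of \<open>c\<close>.\<close>

lemma Psi_inj:
  assumes z: "\<forall>x\<in>{0..l}. \<forall>j<n. Psi \<mu> c x j = 0" and k: "k < n"
  shows "reg (c k)"
proof -
  have all: "\<forall>x\<in>{0..l}. \<forall>j<n. Psi \<mu> (\<lambda>k. fls_X ^ i * c k) x j = 0" for i
  proof (induction i)
    case 0
    then show ?case using z by simp
  next
    case (Suc i)
    let ?P = "Psi \<mu> (\<lambda>k. fls_X ^ i * c k)" and ?S = "Psi \<mu> (\<lambda>k. fls_X ^ Suc i * c k)"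
    have Sc: "cont ?S" by (rule ac_solves_cont[OF Psi_ac])
    have ac: "ac_solves n l \<beta> Q ?P (\<lambda>x j. \<mu> * ?P x j + ?S x j)"
      using Psi_ac[of \<mu> "\<lambda>k. fls_X ^ i * c k"] by (simp add: mult_ac)
    have "Bint ?S x j = 0" if xj: "x \<in> {0..l}" "j < n" for x j
    proof -
      have "?P x j = ?P 0 j + Bint ?S x j + V.T \<mu> ?P x j"
        using ac xj unfolding ac_solves_iff[OF Sc] by blast
      moreover have "V.T \<mu> ?P x j = V.T \<mu> (\<lambda>x j. 0) x j"
        using Suc xj by (intro V.T_cong) auto
      moreover have "?P x j = 0" "?P 0 j = 0" using Suc xj l_pos by auto
      ultimately show ?thesis by (simp add: V.T_def)
    qed
    then show ?case using Bint_zero[OF Sc] by blast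
  qed
  show ?thesis
    unfolding reg_def
  proof (intro allI impI)
    fix m :: int assume m: "m < 0"
    define i where "i = nat (- 1 - m)"
    have mi: "m = - 1 - int i" using m by (simp add: i_def)
    have "Psi \<mu> (\<lambda>k. fls_X ^ i * c k) 0 k = 0" using all[of i] k l_pos by simp
    then show "fls_nth (c k) m = 0" using k by (simp add: Psi_at_0 fls_X_power_nth mi)
  qed
qed

text \<open>The basis of the space of polar parts is transported by \<open>Psi\<close>, whose kernel
  consists of the regular vectors.\<close>

lemma root_basis:
  assumes "detA \<mu> \<noteq> 0"
  shows "\<exists>e :: nat \<Rightarrow> nat \<Rightarrow> complex fls.
     (\<forall>i<subdegree (detA \<mu>). \<forall>r<n. reg (\<Sum>k<n. fps_to_fls (Afps \<mu> r k) * e i k)) \<and>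
     (\<forall>a. (\<forall>x\<in>{0..l}. \<forall>j<n. (\<Sum>i<subdegree (detA \<mu>). a i * Psi \<mu> (e i) x j) = 0) \<longrightarrow> (\<forall>i<subdegree (detA \<mu>). a i = 0)) \<and>
     (\<forall>y. root_vec n l \<beta> Q C D \<mu> y \<longrightarrow>
        (\<exists>a. \<forall>x\<in>{0..l}. \<forall>j<n. y x j = (\<Sum>i<subdegree (detA \<mu>). a i * Psi \<mu> (e i) x j)))"
proof -
  let ?d = "subdegree (detA \<mu>)"
  obtain e where e: "\<forall>i<?d. \<forall>r<n. reg (\<Sum>k<n. fps_to_fls (Afps \<mu> r k) * e i k)"
     "\<And>c. \<forall>r<n. reg (\<Sum>k<n. fps_to_fls (Afps \<mu> r k) * c k) \<Longrightarrow> \<exists>a. \<forall>k<n. reg (c k - (\<Sum>i<?d. fls_const (a i) * e i k))"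
     "\<And>a. \<forall>k<n. reg (\<Sum>i<?d. fls_const (a i) * e i k) \<Longrightarrow> \<forall>i<?d. a i = 0"
    using pole_space_basis[OF assms refl]
    apply (elim exE conjE)
    subgoal premises p for e
      by (rule that[of e]) (use p in blast)+
    done
  show ?thesis
  proof (intro exI[of _ e] conjI allI impI)
    show "reg (\<Sum>k<n. fps_to_fls (Afps \<mu> r k) * e i k)" if "i < ?d" "r < n" for i r
      using e(1) that by blast
    show "a i = 0" if "\<forall>x\<in>{0..l}. \<forall>j<n. (\<Sum>i<?d. a i * Psi \<mu> (e i) x j) = 0" "i < ?d" for a i
    proof -
      have "\<forall>k<n. reg (\<Sum>i<?d. fls_const (a i) * e i k)"
        using Psi_inj[of \<mu> "\<lambda>k. \<Sum>i<?d. fls_const (a i) * e i k"] that(1) unfolding Psi_sum by blast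
      then show ?thesis using e(3) that(2) by blast
    qed
    show "\<exists>a. \<forall>x\<in>{0..l}. \<forall>j<n. y x j = (\<Sum>i<?d. a i * Psi \<mu> (e i) x j)" if y: "root_vec n l \<beta> Q C D \<mu> y" for y
    proof -
      obtain c where c: "\<forall>r<n. reg (\<Sum>k<n. fps_to_fls (Afps \<mu> r k) * c k)" "\<forall>x\<in>{0..l}. \<forall>j<n. y x j = Psi \<mu> c x j"
        using Psi_surj[OF y] by blast
      obtain a where a: "\<forall>k<n. reg (c k - (\<Sum>i<?d. fls_const (a i) * e i k))" using e(2)[OF c(1)] by blast
      have "Psi \<mu> c x j = (\<Sum>i<?d. a i * Psi \<mu> (e i) x j)" for x j
      proof -
        have "Psi \<mu> (\<lambda>k. c k - (\<Sum>i<?d. fls_const (a i) * e i k)) x j = 0"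
          by (rule Psi_reg) (use a in blast)
        then show ?thesis unfolding Psi_diff Psi_sum by simp
      qed
      then show ?thesis using c(2) by auto
    qed
  qed
qed

end

section \<open>Normalized systems of root vectors\<close>

context dirac
begin

lemma weighted_integrable:
  assumes "cont f" "k < n"
  shows "(\<lambda>x. \<bar>\<beta> k x\<bar> * (cmod (f x k))\<^sup>2) absolutely_integrable_on {0..l}"
  using assms absint_norm[OF beta_int[OF assms(2)]]
  by (intro absint_mult_cont continuous_intros) (auto simp: V.cont_def)

definition Hsq :: "(real \<Rightarrow> nat \<Rightarrow> complex) \<Rightarrow> real" where
  "Hsq f = (\<Sum>k<n. integral {0..l} (\<lambda>x. \<bar>\<beta> k x\<bar> * (cmod (f x k))\<^sup>2))"

lemma H_norm_Hsq: "H_norm n l \<beta> f = sqrt (Hsq f)" by (simp add: H_norm_def Hsq_def)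

lemma Hsq_component_nonneg:
  assumes "cont f" "k < n"
  shows "0 \<le> integral {0..l} (\<lambda>x. \<bar>\<beta> k x\<bar> * (cmod (f x k))\<^sup>2)"
  using weighted_integrable[OF assms]
  by (intro Henstock_Kurzweil_Integration.integral_nonneg) (auto simp: absolutely_integrable_on_def)

lemma Hsq_ge:
  assumes "cont f" "k < n"
  shows "integral {0..l} (\<lambda>x. \<bar>\<beta> k x\<bar> * (cmod (f x k))\<^sup>2) \<le> Hsq f"
  unfolding Hsq_def
  by (rule member_le_sum[where f = "\<lambda>k. integral {0..l} (\<lambda>x. \<bar>\<beta> k x\<bar> * (cmod (f x k))\<^sup>2)"])
     (use assms Hsq_component_nonneg in auto)

lemma Hsq_nonneg: "cont f \<Longrightarrow> 0 \<le> Hsq f"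
  unfolding Hsq_def by (intro sum_nonneg Hsq_component_nonneg) auto

lemma H_norm_scale: "H_norm n l \<beta> (\<lambda>x j. a * f x j) = cmod a * H_norm n l \<beta> f"
proof -
  have "Hsq (\<lambda>x j. a * f x j) = (cmod a)\<^sup>2 * Hsq f"
    unfolding Hsq_def sum_distrib_left
    by (intro sum.cong refl) (simp add: norm_mult power_mult_distrib mult.left_commute[of _ "(cmod a)\<^sup>2"])
  then show ?thesis by (simp add: H_norm_Hsq real_sqrt_mult)
qed

lemma Hsq_cong: "(\<And>x j. x \<in> {0..l} \<Longrightarrow> j < n \<Longrightarrow> f x j = g x j) \<Longrightarrow> Hsq f = Hsq g"
  unfolding Hsq_def by (intro sum.cong Henstock_Kurzweil_Integration.integral_cong) auto

lemma Hsq_lower: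
  assumes f: "cont f" and k: "k < n" and ab: "0 \<le> a" "a < b" "b \<le> l"
    and q: "\<And>x. x \<in> {a..b} \<Longrightarrow> q \<le> cmod (f x k)" "0 \<le> q"
  shows "q\<^sup>2 * integral {a..b} (\<lambda>t. \<bar>\<beta> k t\<bar>) \<le> Hsq f"
proof -
  let ?g = "\<lambda>x. \<bar>\<beta> k x\<bar> * (cmod (f x k))\<^sup>2"
  have gi: "?g absolutely_integrable_on {0..l}" by (rule weighted_integrable[OF f k])
  have "q\<^sup>2 * integral {a..b} (\<lambda>t. \<bar>\<beta> k t\<bar>) = integral {a..b} (\<lambda>t. q\<^sup>2 * \<bar>\<beta> k t\<bar>)" by simp
  also have "\<dots> \<le> integral {a..b} ?g"
  proof (rule integral_le)
    show "(\<lambda>t. q\<^sup>2 * \<bar>\<beta> k t\<bar>) integrable_on {a..b}"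
      using absint_norm[OF absint_subinterval[OF beta_int[OF k] ab(1,3)]]
      by (intro integrable_on_mult_right) (simp add: absolutely_integrable_on_def)
    show "?g integrable_on {a..b}"
      using absint_subinterval[OF gi ab(1,3)] by (simp add: absolutely_integrable_on_def)
    show "q\<^sup>2 * \<bar>\<beta> k t\<bar> \<le> ?g t" if "t \<in> {a..b}" for t
      using q(1)[OF that] q(2) by (subst mult.commute) (intro mult_left_mono power_mono, auto)
  qed
  also have "\<dots> = integral {0..b} ?g - integral {0..a} ?g"
    using integral_diff_interval[OF gi, of a b] ab by simp
  also have "\<dots> \<le> integral {0..l} ?g"
  proof -
    have "0 \<le> integral {0..a} ?g"
      using absint_subinterval[OF gi, of 0 a] ab
      by (intro Henstock_Kurzweil_Integration.integral_nonneg) (auto simp: absolutely_integrable_on_def)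
    moreover have "integral {0..b} ?g \<le> integral {0..l} ?g"
      using integral_norm_mono[OF gi, of b l] ab by (simp add: abs_mult)
    ultimately show ?thesis by simp
  qed
  also have "\<dots> \<le> Hsq f" by (rule Hsq_ge[OF f k])
  finally show ?thesis .
qed

text \<open>Continuity spreads a nonzero value to an interval, on which the modulus of the weight
  has positive integral.\<close>

lemma H_norm_pos:
  assumes f: "cont f" and x: "x \<in> {0..l}" and j: "j < n" and ne: "f x j \<noteq> 0"
  shows "0 < H_norm n l \<beta> f"
proof -
  have fc: "continuous_on {0..l} (\<lambda>t. f t j)" using f j by (simp add: V.cont_def)
  then obtain d where d: "d > 0" "\<And>t. t \<in> {0..l} \<Longrightarrow> dist t x < d \<Longrightarrow> dist (f t j) (f x j) < cmod (f x j) / 2"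
    using ne x unfolding continuous_on_iff by (metis half_gt_zero zero_less_norm_iff)
  define a b where "a = max 0 (x - d / 2)" and "b = min l (x + d / 2)"
  have ab: "0 \<le> a" "a < b" "b \<le> l" using x d(1) l_pos by (auto simp: a_def b_def)
  have near: "cmod (f x j) / 2 \<le> cmod (f t j)" if "t \<in> {a..b}" for t
  proof -
    have "t \<in> {0..l}" "\<bar>t - x\<bar> < d" using that ab d(1) by (auto simp: a_def b_def)
    from d(2)[OF this(1)] this(2) have "cmod (f t j - f x j) < cmod (f x j) / 2" by (simp add: dist_norm)
    then show ?thesis using norm_triangle_ineq2[of "f x j" "f t j"] by (simp add: norm_minus_commute)
  qed
  have "0 < (cmod (f x j) / 2)\<^sup>2 * integral {a..b} (\<lambda>t. \<bar>\<beta> j t\<bar>)"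
    using beta_abs_integral_pos(1)[OF j ab] ne by simp
  also have "\<dots> \<le> Hsq f" by (rule Hsq_lower[OF f j ab near]) auto
  finally show ?thesis by (simp add: H_norm_Hsq)
qed

text \<open>Squared norms are compared because they are Lipschitz on bounded sets, with no lower
  bound on the norm involved: the difference of squares factors into (|f| - |g|) (|f| +
  |g|).\<close>

lemma Hsq_diff:
  assumes f: "cont f" and g: "cont g"
    and P: "\<And>x j. x \<in> {0..l} \<Longrightarrow> j < n \<Longrightarrow> cmod (f x j) \<le> P" "\<And>x j. x \<in> {0..l} \<Longrightarrow> j < n \<Longrightarrow> cmod (g x j) \<le> P"
    and d: "\<And>x j. x \<in> {0..l} \<Longrightarrow> j < n \<Longrightarrow> cmod (f x j - g x j) \<le> d"
  shows "\<bar>Hsq f - Hsq g\<bar> \<le> 2 * P * d * Bl"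
proof -
  have "\<bar>integral {0..l} (\<lambda>x. \<bar>\<beta> k x\<bar> * (cmod (f x k))\<^sup>2) - integral {0..l} (\<lambda>x. \<bar>\<beta> k x\<bar> * (cmod (g x k))\<^sup>2)\<bar>
      \<le> 2 * P * d * integral {0..l} (\<lambda>t. \<bar>\<beta> k t\<bar>)" if k: "k < n" for k
  proof -
    have ii: "(\<lambda>x. \<bar>\<beta> k x\<bar> * (cmod (f x k))\<^sup>2) integrable_on {0..l}" "(\<lambda>x. \<bar>\<beta> k x\<bar> * (cmod (g x k))\<^sup>2) integrable_on {0..l}"
      using weighted_integrable[OF f k] weighted_integrable[OF g k] by (auto simp: absolutely_integrable_on_def)
    have "integral {0..l} (\<lambda>x. \<bar>\<beta> k x\<bar> * (cmod (f x k))\<^sup>2) - integral {0..l} (\<lambda>x. \<bar>\<beta> k x\<bar> * (cmod (g x k))\<^sup>2) =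
       integral {0..l} (\<lambda>x. \<bar>\<beta> k x\<bar> * (cmod (f x k))\<^sup>2 - \<bar>\<beta> k x\<bar> * (cmod (g x k))\<^sup>2)"
      using ii by (simp add: Henstock_Kurzweil_Integration.integral_diff)
    also have "norm \<dots> \<le> integral {0..l} (\<lambda>x. 2 * P * d * \<bar>\<beta> k x\<bar>)"
    proof (rule integral_norm_bound_integral)
      show "(\<lambda>x. \<bar>\<beta> k x\<bar> * (cmod (f x k))\<^sup>2 - \<bar>\<beta> k x\<bar> * (cmod (g x k))\<^sup>2) integrable_on {0..l}"
        by (intro integrable_diff ii)
      show "(\<lambda>x. 2 * P * d * \<bar>\<beta> k x\<bar>) integrable_on {0..l}"
        using absint_norm[OF beta_int[OF k]] by (intro integrable_on_mult_right) (simp add: absolutely_integrable_on_def)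
      fix x assume x: "x \<in> {0..l}"
      let ?u = "cmod (f x k)" and ?v = "cmod (g x k)"
      have "\<bar>?u\<^sup>2 - ?v\<^sup>2\<bar> = \<bar>?u - ?v\<bar> * (?u + ?v)"
        by (simp add: power2_eq_square square_diff_square_factored abs_mult mult.commute)
      also have "\<dots> \<le> d * (2 * P)"
      proof (rule mult_mono)
        show "\<bar>?u - ?v\<bar> \<le> d" using norm_triangle_ineq3[of "f x k" "g x k"] d[OF x k] by simp
        then show "0 \<le> d" by linarith
        show "?u + ?v \<le> 2 * P" using P[OF x k] by simp
      qed simp
      finally have "\<bar>?u\<^sup>2 - ?v\<^sup>2\<bar> \<le> d * (2 * P)" .
      then have "\<bar>\<beta> k x\<bar> * \<bar>?u\<^sup>2 - ?v\<^sup>2\<bar> \<le> \<bar>\<beta> k x\<bar> * (d * (2 * P))" by (intro mult_left_mono) auto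
      then show "norm (\<bar>\<beta> k x\<bar> * ?u\<^sup>2 - \<bar>\<beta> k x\<bar> * ?v\<^sup>2) \<le> 2 * P * d * \<bar>\<beta> k x\<bar>"
        by (simp add: right_diff_distrib[symmetric] abs_mult mult_ac)
    qed
    finally show ?thesis by simp
  qed
  then have "\<bar>Hsq f - Hsq g\<bar> \<le> (\<Sum>k<n. 2 * P * d * integral {0..l} (\<lambda>t. \<bar>\<beta> k t\<bar>))"
    unfolding Hsq_def sum_subtractf[symmetric] by (intro order_trans[OF sum_abs] sum_mono) auto
  then show ?thesis by (simp add: Bl_def sum_distrib_left)
qed

end

section \<open>Normalized bases matching the enumeration of zeros\<close>

context dirac_bc
begin

lemma root_basis_normalized:
  assumes "detA \<mu> \<noteq> 0"
  shows "\<exists>e :: nat \<Rightarrow> real \<Rightarrow> nat \<Rightarrow> complex.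
     (\<forall>i<subdegree (detA \<mu>). root_vec n l \<beta> Q C D \<mu> (e i) \<and> H_norm n l \<beta> (e i) = 1) \<and>
     (\<forall>a. (\<forall>x\<in>{0..l}. \<forall>j<n. (\<Sum>i<subdegree (detA \<mu>). a i * e i x j) = 0) \<longrightarrow> (\<forall>i<subdegree (detA \<mu>). a i = 0)) \<and>
     (\<forall>y. root_vec n l \<beta> Q C D \<mu> y \<longrightarrow>
        (\<exists>a. \<forall>x\<in>{0..l}. \<forall>j<n. y x j = (\<Sum>i<subdegree (detA \<mu>). a i * e i x j)))"
proof -
  let ?d = "subdegree (detA \<mu>)"
  obtain e where e: "\<And>i r. i < ?d \<Longrightarrow> r < n \<Longrightarrow> reg (\<Sum>k<n. fps_to_fls (Afps \<mu> r k) * e i k)"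
    and ind: "\<And>a. \<forall>x\<in>{0..l}. \<forall>j<n. (\<Sum>i<?d. a i * Psi \<mu> (e i) x j) = 0 \<Longrightarrow> \<forall>i<?d. a i = 0"
    and span: "\<And>y. root_vec n l \<beta> Q C D \<mu> y \<Longrightarrow> \<exists>a. \<forall>x\<in>{0..l}. \<forall>j<n. y x j = (\<Sum>i<?d. a i * Psi \<mu> (e i) x j)"
    using root_basis[OF assms]
    apply (elim exE conjE)
    subgoal premises p for e by (rule that[of e]) (use p in blast)+
    done
  define N where "N i = H_norm n l \<beta> (Psi \<mu> (e i))" for i
  have N: "N i > 0" if i: "i < ?d" for i
  proof -
    have "\<exists>x\<in>{0..l}. \<exists>j<n. Psi \<mu> (e i) x j \<noteq> 0"
    proof (rule ccontr)
      assume "\<not> ?thesis"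
      then have z: "\<And>x j. x \<in> {0..l} \<Longrightarrow> j < n \<Longrightarrow> Psi \<mu> (e i) x j = 0" by blast
      have "\<forall>x\<in>{0..l}. \<forall>j<n. (\<Sum>m<?d. (if m = i then 1 else 0) * Psi \<mu> (e m) x j) = 0"
        using z by (auto simp: if_distrib[of "\<lambda>z. z * _"] cong: if_cong)
      from ind[OF this] i show False by auto
    qed
    then show ?thesis unfolding N_def using H_norm_pos[OF ac_solves_cont[OF Psi_ac]] by blast
  qed
  \<comment> \<open>The scaling is done on the polar part, so that the result is again of the form
    covered by \<open>root_vec_Psi\<close>.\<close>
  define e' where "e' i = Psi \<mu> (\<lambda>k. fls_const (1 / complex_of_real (N i)) * e i k)" for i
  have e'e: "e' i = (\<lambda>x j. (1 / complex_of_real (N i)) * Psi \<mu> (e i) x j)" for i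
    using Psi_sum[where I = "{()}" and a = "\<lambda>_. 1 / complex_of_real (N i)" and e = "\<lambda>_. e i"] by (simp add: e'_def fun_eq_iff)
  show ?thesis
  proof (intro exI[of _ e'] conjI allI impI)
    fix i assume i: "i < ?d"
    show "root_vec n l \<beta> Q C D \<mu> (e' i)"
      unfolding e'_def
    proof (rule root_vec_Psi, intro allI impI)
      fix r assume r: "r < n"
      have "reg (fls_const (1 / complex_of_real (N i)) * (\<Sum>k<n. fps_to_fls (Afps \<mu> r k) * e i k))"
        by (intro reg_mult e i r) auto
      then show "reg (\<Sum>k<n. fps_to_fls (Afps \<mu> r k) * (fls_const (1 / complex_of_real (N i)) * e i k))"
        by (simp add: sum_distrib_left mult_ac)
    qed
    show "H_norm n l \<beta> (e' i) = 1"
      unfolding e'e H_norm_scale using N[OF i] by (simp add: norm_divide N_def)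
  next
    fix a i assume "\<forall>x\<in>{0..l}. \<forall>j<n. (\<Sum>i<?d. a i * e' i x j) = 0" and i: "i < ?d"
    then have "\<forall>x\<in>{0..l}. \<forall>j<n. (\<Sum>i<?d. (a i / complex_of_real (N i)) * Psi \<mu> (e i) x j) = 0"
      by (simp add: e'e)
    from ind[OF this] i N[OF i] show "a i = 0" by auto
  next
    fix y assume "root_vec n l \<beta> Q C D \<mu> y"
    from span[OF this] obtain a where a: "\<forall>x\<in>{0..l}. \<forall>j<n. y x j = (\<Sum>i<?d. a i * Psi \<mu> (e i) x j)" by blast
    have "(\<Sum>i<?d. a i * Psi \<mu> (e i) x j) = (\<Sum>i<?d. (a i * complex_of_real (N i)) * e' i x j)" for x j
      by (intro sum.cong) (use N in \<open>auto simp: e'e\<close>, metis less_irrefl)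
    then show "\<exists>a. \<forall>x\<in>{0..l}. \<forall>j<n. y x j = (\<Sum>i<?d. a i * e' i x j)"
      using a by (intro exI[of _ "\<lambda>i. a i * complex_of_real (N i)"]) simp
  qed
qed

lemma DeltaQ_entire: "DeltaQ n l \<beta> Q C D holomorphic_on UNIV"
proof -
  have "DeltaQ n l \<beta> Q C D analytic_on {z}" for z
    using has_fps_expansion_imp_analytic[OF DeltaQ_fps] .
  then have "DeltaQ n l \<beta> Q C D analytic_on UNIV"
    by (subst analytic_on_analytic_at) auto
  then show ?thesis by (rule analytic_imp_holomorphic)
qed

text \<open>If the expansion were 0, the function would vanish identically and have the same
  \<open>zorder\<close> everywhere. Every fibre of \<open>lam\<close> would then have the
  cardinality of the nonempty fibre over \<open>lam 0\<close>, and the integers would map onto the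
  complex plane. With a nonzero expansion, the order of a zero is the subdegree.\<close>

lemma enumerates_detA:
  assumes en: "enumerates_zeros (DeltaQ n l \<beta> Q C D) lam"
  shows "detA \<mu> \<noteq> 0" and "card {m. lam m = \<mu>} = subdegree (detA \<mu>)"
proof -
  show ne: "detA \<mu> \<noteq> 0"
  proof
    assume "detA \<mu> = 0"
    then have e0: "(\<lambda>z. DeltaQ n l \<beta> Q C D (\<mu> + z)) has_fps_expansion 0" using DeltaQ_fps[of \<mu>] by simp
    have hol: "(\<lambda>z. DeltaQ n l \<beta> Q C D (\<mu> + z)) holomorphic_on UNIV"
      using holomorphic_on_compose[of "\<lambda>z. \<mu> + z" UNIV "DeltaQ n l \<beta> Q C D"] holomorphic_on_subset[OF DeltaQ_entire]
      by (simp add: o_def holomorphic_on_add)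
    have "DeltaQ n l \<beta> Q C D z = 0" for z
      using has_fps_expansion_0_analytic_continuation[OF e0 hol open_UNIV connected_UNIV UNIV_I UNIV_I, of "z - \<mu>"] by simp
    then have D0: "DeltaQ n l \<beta> Q C D = (\<lambda>z. 0)" by auto
    \<comment> \<open>Whatever value \<open>zorder\<close> takes on the zero function, it is
      invariant under translation.\<close>
    have zo: "zorder (\<lambda>z. 0 :: complex) z = zorder (\<lambda>z. 0 :: complex) 0" for z :: complex
      by (rule zorder_shift)
    have cd: "card {m. lam m = z} = card {m. lam m = lam 0}" for z
      using en zo[of z] zo[of "lam 0"] unfolding enumerates_zeros_def D0 by simp
    have "finite {m. lam m = lam 0}" "0 \<in> {m. lam m = lam 0}" using en by (auto simp: enumerates_zeros_def)
    then have "card {m. lam m = lam 0} > 0" by (auto simp: card_gt_0_iff)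
    then have "{m. lam m = z} \<noteq> {}" for z using cd[of z] by (metis card.empty less_irrefl)
    then have "\<exists>m. z = lam m" for z by (metis (mono_tags, lifting) Collect_empty_eq)
    then have "range lam = UNIV" by (simp add: surj_def)
    then have "countable (UNIV :: complex set)" by (metis countable_image countableI_type)
    then show False using uncountable_UNIV_complex by simp
  qed
  have D0: "DeltaQ n l \<beta> Q C D \<mu> = fps_nth (detA \<mu>) 0"
    using has_fps_expansion_imp_0_eq_fps_nth_0[OF DeltaQ_fps[of \<mu>]] by simp
  show "card {m. lam m = \<mu>} = subdegree (detA \<mu>)"
  proof (cases "DeltaQ n l \<beta> Q C D \<mu> = 0")
    case True
    then show ?thesis using en has_fps_expansion_zorder[OF DeltaQ_fps ne] by (simp add: enumerates_zeros_def)
  next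
    case False
    then have "subdegree (detA \<mu>) = 0" using D0 by simp
    then show ?thesis using en False by (simp add: enumerates_zeros_def)
  qed
qed

lemma H_norm_zero: "(\<And>x j. x \<in> {0..l} \<Longrightarrow> j < n \<Longrightarrow> f x j = 0) \<Longrightarrow> H_norm n l \<beta> f = 0"
  using Hsq_cong[of f "\<lambda>x j. 0"] by (simp add: H_norm_Hsq) (simp add: Hsq_def)

text \<open>Each fibre of \<open>lam\<close> has as many indices as the root subspace has
  dimensions, so bases are transported along a bijection. At indices in \<open>S\<close> the
  subspace is a line, and any normalized vector of it may be prescribed.\<close>

lemma root_system_exists:
  assumes en: "enumerates_zeros (DeltaQ n l \<beta> Q C D) lam"
    and S: "\<And>m. m \<in> S \<Longrightarrow> card {k. lam k = lam m} = 1"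
      "\<And>m. m \<in> S \<Longrightarrow> root_vec n l \<beta> Q C D (lam m) (g m)" "\<And>m. m \<in> S \<Longrightarrow> H_norm n l \<beta> (g m) = 1"
  shows "\<exists>f. normalized_root_system n l \<beta> Q C D lam f \<and> (\<forall>m\<in>S. f m = g m)"
proof -
  define d where "d \<mu> = subdegree (detA \<mu>)" for \<mu>
  define I where "I \<mu> = {m. lam m = \<mu>}" for \<mu>
  have fin: "finite (I \<mu>)" for \<mu> using en by (simp add: enumerates_zeros_def I_def)
  have cd: "card (I \<mu>) = d \<mu>" for \<mu> using enumerates_detA(2)[OF en] by (simp add: I_def d_def)
  have "\<forall>\<mu>. \<exists>e :: nat \<Rightarrow> real \<Rightarrow> nat \<Rightarrow> complex.
     (\<forall>i<d \<mu>. root_vec n l \<beta> Q C D \<mu> (e i) \<and> H_norm n l \<beta> (e i) = 1) \<and>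
     (\<forall>a. (\<forall>x\<in>{0..l}. \<forall>j<n. (\<Sum>i<d \<mu>. a i * e i x j) = 0) \<longrightarrow> (\<forall>i<d \<mu>. a i = 0)) \<and>
     (\<forall>y. root_vec n l \<beta> Q C D \<mu> y \<longrightarrow>
        (\<exists>a. \<forall>x\<in>{0..l}. \<forall>j<n. y x j = (\<Sum>i<d \<mu>. a i * e i x j)))"
    using root_basis_normalized[OF enumerates_detA(1)[OF en]] unfolding d_def by blast
  then obtain e where e: "\<And>\<mu> i. i < d \<mu> \<Longrightarrow> root_vec n l \<beta> Q C D \<mu> (e \<mu> i)" "\<And>\<mu> i. i < d \<mu> \<Longrightarrow> H_norm n l \<beta> (e \<mu> i) = 1"
    and ind: "\<And>\<mu> a. \<forall>x\<in>{0..l}. \<forall>j<n. (\<Sum>i<d \<mu>. a i * e \<mu> i x j) = 0 \<Longrightarrow> \<forall>i<d \<mu>. a i = 0"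
    and span: "\<And>\<mu> y. root_vec n l \<beta> Q C D \<mu> y \<Longrightarrow> \<exists>a. \<forall>x\<in>{0..l}. \<forall>j<n. y x j = (\<Sum>i<d \<mu>. a i * e \<mu> i x j)"
    by (subst (asm) choice_iff) blast
  have "\<forall>\<mu>. \<exists>h. bij_betw h (I \<mu>) {..<d \<mu>}"
    using fin cd by (metis ex_bij_betw_finite_nat lessThan_atLeast0)
  then obtain h where h: "\<And>\<mu>. bij_betw (h \<mu>) (I \<mu>) {..<d \<mu>}" by metis
  define f where "f m = (if m \<in> S then g m else e (lam m) (h (lam m) m))" for m
  have hm: "h (lam m) m < d (lam m)" for m
    using bij_betw_apply[OF h, of m "lam m"] by (auto simp: I_def)
  have rv: "root_vec n l \<beta> Q C D (lam m) (f m)" "H_norm n l \<beta> (f m) = 1" for m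
    using S e hm by (auto simp: f_def)
  have bas: "(\<forall>c::int \<Rightarrow> complex. (\<forall>x\<in>{0..l}. \<forall>j<n. (\<Sum>m\<in>I \<mu>. c m * f m x j) = 0) \<longrightarrow> (\<forall>m\<in>I \<mu>. c m = 0)) \<and>
     (\<forall>y. root_vec n l \<beta> Q C D \<mu> y \<longrightarrow> (\<exists>c::int \<Rightarrow> complex. \<forall>x\<in>{0..l}. \<forall>j<n. y x j = (\<Sum>m\<in>I \<mu>. c m * f m x j)))" for \<mu>
  proof (cases "S \<inter> I \<mu> = {}")
    case True
    have fe: "f m = e \<mu> (h \<mu> m)" if "m \<in> I \<mu>" for m using True that by (auto simp: f_def I_def)
    have re: "(\<Sum>m\<in>I \<mu>. c (h \<mu> m) * f m x j) = (\<Sum>i<d \<mu>. c i * e \<mu> i x j)" for c :: "nat \<Rightarrow> complex" and x j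
      using sum.reindex_bij_betw[OF h[of \<mu>], of "\<lambda>i. c i * e \<mu> i x j"] fe by simp
    have inv: "inv_into (I \<mu>) (h \<mu>) (h \<mu> m) = m" if "m \<in> I \<mu>" for m
      using h[of \<mu>] that by (auto simp: bij_betw_def)
    show ?thesis
    proof (intro conjI allI impI ballI)
      fix c :: "int \<Rightarrow> complex" and m
      assume c: "\<forall>x\<in>{0..l}. \<forall>j<n. (\<Sum>m\<in>I \<mu>. c m * f m x j) = 0" and m: "m \<in> I \<mu>"
      have eq: "(\<Sum>m\<in>I \<mu>. c m * f m x j) = (\<Sum>i<d \<mu>. c (inv_into (I \<mu>) (h \<mu>) i) * e \<mu> i x j)" for x j
        unfolding re[symmetric] by (intro sum.cong) (auto simp: inv)
      have "\<forall>i<d \<mu>. c (inv_into (I \<mu>) (h \<mu>) i) = 0" using c unfolding eq by (rule ind)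
      moreover have "h \<mu> m < d \<mu>" using hm[of m] m by (simp add: I_def)
      ultimately show "c m = 0" using inv[OF m] by metis
    next
      fix y assume "root_vec n l \<beta> Q C D \<mu> y"
      from span[OF this] obtain a where "\<forall>x\<in>{0..l}. \<forall>j<n. y x j = (\<Sum>i<d \<mu>. a i * e \<mu> i x j)" by blast
      then show "\<exists>c::int \<Rightarrow> complex. \<forall>x\<in>{0..l}. \<forall>j<n. y x j = (\<Sum>m\<in>I \<mu>. c m * f m x j)"
        by (intro exI[of _ "\<lambda>m. a (h \<mu> m)"]) (simp add: re)
    qed
  next
    case False
    then obtain m where m: "m \<in> S" "lam m = \<mu>" by (auto simp: I_def)
    have "card (I \<mu>) = 1" using S(1)[OF m(1)] m(2) by (simp add: I_def)
    moreover have "m \<in> I \<mu>" using m by (simp add: I_def)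
    ultimately have Im: "I \<mu> = {m}" by (auto simp: card_1_singleton_iff)
    have d1: "d \<mu> = 1" using cd[of \<mu>] Im by simp
    have rvm: "root_vec n l \<beta> Q C D \<mu> (f m)" using rv(1)[of m] m by simp
    obtain a where a: "\<forall>x\<in>{0..l}. \<forall>j<n. f m x j = a * e \<mu> 0 x j"
      using span[OF rvm] d1 by auto
    have nz: "\<exists>x\<in>{0..l}. \<exists>j<n. f m x j \<noteq> 0"
      using H_norm_zero[of "f m"] rv(2)[of m] by fastforce
    then have a0: "a \<noteq> 0" using a by auto
    show ?thesis
      unfolding Im
    proof (intro conjI allI impI ballI)
      fix c :: "int \<Rightarrow> complex" and k
      assume "\<forall>x\<in>{0..l}. \<forall>j<n. (\<Sum>m\<in>{m}. c m * f m x j) = 0" "k \<in> {m}"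
      then show "c k = 0" using nz by auto
    next
      fix y assume "root_vec n l \<beta> Q C D \<mu> y"
      from span[OF this] d1 obtain b where "\<forall>x\<in>{0..l}. \<forall>j<n. y x j = b * e \<mu> 0 x j" by auto
      then show "\<exists>c::int \<Rightarrow> complex. \<forall>x\<in>{0..l}. \<forall>j<n. y x j = (\<Sum>m\<in>{m}. c m * f m x j)"
        using a a0 by (intro exI[of _ "\<lambda>_. b / a"]) simp
    qed
  qed
  have "normalized_root_system n l \<beta> Q C D lam f"
    unfolding normalized_root_system_def
    using rv fin bas unfolding I_def by auto
  then show ?thesis by (intro exI[of _ f]) (auto simp: f_def)
qed

end

section \<open>Regular boundary conditions\<close>

text \<open>Asymptotic equality with a bounded reference. Boundedness of \<open>g\<close> makes the
  relation stable under products, hence under polynomial expressions such as determinants and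
  adjugates.\<close>

definition near :: "'m filter \<Rightarrow> ('m \<Rightarrow> complex) \<Rightarrow> ('m \<Rightarrow> complex) \<Rightarrow> bool" where
  "near F f g \<longleftrightarrow> Bfun g F \<and> ((\<lambda>m. f m - g m) \<longlongrightarrow> 0) F"

lemma near_refl: "Bfun g F \<Longrightarrow> near F g g" by (simp add: near_def)

lemma near_const: "near F (\<lambda>m. c) (\<lambda>m. c)" by (intro near_refl Bfun_const)

lemma near_add:
  assumes "near F f g" "near F f' g'"
  shows "near F (\<lambda>m. f m + f' m) (\<lambda>m. g m + g' m)"
  unfolding near_def
proof
  obtain B B' where B: "eventually (\<lambda>m. norm (g m) \<le> B) F" "eventually (\<lambda>m. norm (g' m) \<le> B') F"
    using assms unfolding near_def Bfun_def by blast
  show "Bfun (\<lambda>m. g m + g' m) F"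
  proof (rule BfunI)
    show "eventually (\<lambda>m. norm (g m + g' m) \<le> B + B') F"
      using B by eventually_elim (rule order_trans[OF norm_triangle_ineq add_mono])
  qed
  have "((\<lambda>m. (f m - g m) + (f' m - g' m)) \<longlongrightarrow> 0 + 0) F"
    using assms unfolding near_def by (intro tendsto_add) auto
  then show "((\<lambda>m. f m + f' m - (g m + g' m)) \<longlongrightarrow> 0) F" by (simp add: algebra_simps)
qed

lemma tendsto_zero_mult_Bfun:
  fixes f g :: "'m \<Rightarrow> complex"
  assumes "(f \<longlongrightarrow> 0) F" "Bfun g F"
  shows "((\<lambda>m. f m * g m) \<longlongrightarrow> 0) F"
  using bounded_bilinear.Zfun_prod_Bfun[OF bounded_bilinear_mult, of f F g] assms
  by (simp add: tendsto_Zfun_iff)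

lemma near_mult:
  assumes "near F f g" "near F f' g'"
  shows "near F (\<lambda>m. f m * f' m) (\<lambda>m. g m * g' m)"
  unfolding near_def
proof
  obtain B B' where B: "eventually (\<lambda>m. norm (g m) \<le> B) F" "eventually (\<lambda>m. norm (g' m) \<le> B') F"
    using assms unfolding near_def Bfun_def by blast
  show "Bfun (\<lambda>m. g m * g' m) F"
  proof (rule BfunI)
    show "eventually (\<lambda>m. norm (g m * g' m) \<le> B * B') F"
      using B by eventually_elim (auto simp: norm_mult intro!: mult_mono order_trans[OF norm_ge_zero])
  qed
  have "((\<lambda>m. (f m - g m) * (f' m - g' m) + (f m - g m) * g' m + (f' m - g' m) * g m) \<longlongrightarrow> 0 * 0 + 0 + 0) F"
    using assms unfolding near_def by (intro tendsto_add tendsto_mult tendsto_zero_mult_Bfun) auto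
  then show "((\<lambda>m. f m * f' m - g m * g' m) \<longlongrightarrow> 0) F" by (simp add: algebra_simps)
qed

lemma near_sum: "(\<And>i. i \<in> I \<Longrightarrow> near F (f i) (g i)) \<Longrightarrow> near F (\<lambda>m. \<Sum>i\<in>I. f i m) (\<lambda>m. \<Sum>i\<in>I. g i m)"
  by (induction I rule: infinite_finite_induct) (auto intro: near_add near_const)

lemma near_prod: "(\<And>i. i \<in> I \<Longrightarrow> near F (f i) (g i)) \<Longrightarrow> near F (\<lambda>m. \<Prod>i\<in>I. f i m) (\<lambda>m. \<Prod>i\<in>I. g i m)"
  by (induction I rule: infinite_finite_induct) (auto intro: near_mult near_const)

lemma near_det:
  assumes A: "\<And>m. A m \<in> carrier_mat n n" and B: "\<And>m. B m \<in> carrier_mat n n"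
    and "\<And>i k. i < n \<Longrightarrow> k < n \<Longrightarrow> near F (\<lambda>m. A m $$ (i, k)) (\<lambda>m. B m $$ (i, k))"
  shows "near F (\<lambda>m. Determinant.det (A m)) (\<lambda>m. Determinant.det (B m))"
  unfolding det_def'[OF A] det_def'[OF B]
proof (intro near_sum near_mult near_prod near_const assms(3))
  fix p i assume "p \<in> {p. p permutes {0..<n}}" "i \<in> {0..<n}"
  then show "p i < n" "i < n" using permutes_in_image[of p "{0..<n}" i] by auto
qed

lemma near_adj_mat:
  assumes A: "\<And>m. A m \<in> carrier_mat n n" and B: "\<And>m. B m \<in> carrier_mat n n"
    and AB: "\<And>i k. i < n \<Longrightarrow> k < n \<Longrightarrow> near F (\<lambda>m. A m $$ (i, k)) (\<lambda>m. B m $$ (i, k))"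
    and ik: "i < n" "k < n"
  shows "near F (\<lambda>m. adj_mat (A m) $$ (i, k)) (\<lambda>m. adj_mat (B m) $$ (i, k))"
proof -
  have eq: "adj_mat M $$ (i, k) = (-1) ^ (k + i) * Determinant.det (mat_delete M k i)" if "M \<in> carrier_mat n n" for M :: "complex Matrix.mat"
    using that ik by (simp add: adj_mat_def cofactor_def)
  have md: "mat_delete M k i \<in> carrier_mat (n - 1) (n - 1)" if "M \<in> carrier_mat n n" for M :: "complex Matrix.mat"
    using that by (rule mat_delete_carrier)
  show ?thesis
    unfolding eq[OF A] eq[OF B]
  proof (intro near_mult near_const near_det[where n = "n - 1"] md A B)
    fix r s assume rs: "r < n - 1" "s < n - 1"
    have "mat_delete M k i $$ (r, s) = M $$ (if r < k then r else Suc r, if s < i then s else Suc s)" if "M \<in> carrier_mat n n" for M :: "complex Matrix.mat"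
      using that rs by (simp add: mat_delete_def)
    then show "near F (\<lambda>m. mat_delete (A m) k i $$ (r, s)) (\<lambda>m. mat_delete (B m) k i $$ (r, s))"
      using A B AB rs by simp
  qed
qed

lemma tendsto_det:
  fixes A :: "'m \<Rightarrow> complex Matrix.mat"
  assumes A: "\<And>m. A m \<in> carrier_mat n n" and B: "B \<in> carrier_mat n n"
    and "\<And>i k. i < n \<Longrightarrow> k < n \<Longrightarrow> ((\<lambda>m. A m $$ (i, k)) \<longlongrightarrow> B $$ (i, k)) F"
  shows "((\<lambda>m. Determinant.det (A m)) \<longlongrightarrow> Determinant.det B) F"
  unfolding det_def'[OF A] det_def'[OF B]
proof (intro tendsto_sum tendsto_mult tendsto_prod tendsto_const assms(3))
  fix p i assume "p \<in> {p. p permutes {0..<n}}" "i \<in> {0..<n}"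
  then show "p i < n" "i < n" using permutes_in_image[of p "{0..<n}" i] by auto
qed

text \<open>For each \<open>m\<close> a violating point is selected if there is one; convergence
  along this selection rules out violations eventually. Uniformity in \<open>x\<close> thus reduces
  to families of points, to which the calculus of \<open>near\<close> applies.\<close>

lemma uniform_from_selection:
  fixes f :: "'m \<Rightarrow> 'x \<Rightarrow> complex"
  assumes "\<And>xs. (\<And>m. xs m \<in> S) \<Longrightarrow> ((\<lambda>m. f m (xs m)) \<longlongrightarrow> 0) F" and "s0 \<in> S" and e: "\<epsilon> > 0"
  shows "\<forall>\<^sub>F m in F. \<forall>x\<in>S. cmod (f m x) < \<epsilon>"
proof -
  define xs where "xs m = (if \<exists>x\<in>S. \<not> cmod (f m x) < \<epsilon> then SOME x. x \<in> S \<and> \<not> cmod (f m x) < \<epsilon> else s0)" for m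
  have xs: "xs m \<in> S \<and> ((\<exists>x\<in>S. \<not> cmod (f m x) < \<epsilon>) \<longrightarrow> \<not> cmod (f m (xs m)) < \<epsilon>)" for m
  proof (cases "\<exists>x\<in>S. \<not> cmod (f m x) < \<epsilon>")
    case True
    then have "\<exists>x. x \<in> S \<and> \<not> cmod (f m x) < \<epsilon>" by blast
    from someI_ex[OF this] show ?thesis using True by (simp add: xs_def)
  qed (use assms(2) in \<open>auto simp: xs_def\<close>)
  have "((\<lambda>m. f m (xs m)) \<longlongrightarrow> 0) F" using xs by (intro assms(1)) blast
  then have "\<forall>\<^sub>F m in F. cmod (f m (xs m)) < \<epsilon>" using e by (auto dest!: tendstoD simp: dist_norm)
  then show ?thesis using xs by (auto elim!: eventually_mono)
qed

section \<open>The unperturbed determinant away from the real axis\<close>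

context dirac_bc
begin

lemma A0mat_carrier: "A0mat n l \<beta> C D \<mu> \<in> carrier_mat n n"
  using C_dim D_dim by (simp add: A0mat_def)

lemma A0mat_entry:
  assumes "i < n" "k < n"
  shows "A0mat n l \<beta> C D \<mu> $$ (i, k) = C $$ (i, k) + D $$ (i, k) * exp (\<i> * \<mu> * complex_of_real (rho \<beta> k l))"
proof -
  have "A0mat n l \<beta> C D \<mu> $$ (i, k) = C $$ (i, k) + (\<Sum>m<n. D $$ (i, m) * fund0 \<beta> \<mu> l m k)"
    using assms C_dim D_dim by (simp add: A0mat_def scalar_prod_def lessThan_atLeast0)
  also have "(\<Sum>m<n. D $$ (i, m) * fund0 \<beta> \<mu> l m k) = (\<Sum>m<n. if m = k then D $$ (i, k) * exp (\<i> * \<mu> * complex_of_real (rho \<beta> k l)) else 0)"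
    by (intro sum.cong) (auto simp: fund0_def)
  finally show ?thesis using assms by simp
qed

lemma rho_l_nonzero: "k < n \<Longrightarrow> rho \<beta> k l \<noteq> 0"
  using beta_abs_integral_pos[of k 0 l] rho_has[of k l] l_pos by auto

text \<open>A column whose exponential grows in the half plane selected by \<open>\<sigma>\<close>
  is multiplied by the inverse exponential. All entries then tend to those of \<open>C\<close> or
  \<open>D\<close>, so the rescaled determinant tends to a nonzero number; as the factors have
  modulus at most 1, \<open>Delta0\<close> itself is no smaller.\<close>

lemma Delta0_lower_half_plane:
  assumes \<sigma>: "\<sigma> = 1 \<or> \<sigma> = -1"
    and det: "Determinant.det (Matrix.mat n n (\<lambda>(i,k). if \<sigma> * rho \<beta> k l > 0 then C $$ (i,k) else D $$ (i,k))) \<noteq> 0"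
  shows "\<exists>h c. c > 0 \<and> (\<forall>\<mu>. h \<le> \<sigma> * Im \<mu> \<longrightarrow> c \<le> cmod (Delta0 n l \<beta> C D \<mu>))"
proof -
  define F where "F = filtercomap (\<lambda>\<mu>. \<sigma> * Im \<mu>) at_top"
  define b where "b k = rho \<beta> k l" for k
  define s where "s k \<mu> = (if \<sigma> * b k > 0 then 1 else exp (- \<i> * \<mu> * complex_of_real (b k)))" for k \<mu>
  define M where "M \<mu> = Matrix.mat n n (\<lambda>(i,k). A0mat n l \<beta> C D \<mu> $$ (i,k) * s k \<mu>)" for \<mu>
  let ?L = "Matrix.mat n n (\<lambda>(i,k). if \<sigma> * b k > 0 then C $$ (i,k) else D $$ (i,k))"
  have Mc: "M \<mu> \<in> carrier_mat n n" for \<mu> by (simp add: M_def)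
  have decay: "((\<lambda>\<mu>. exp (c * \<i> * \<mu> * complex_of_real r)) \<longlongrightarrow> 0) F" if cr: "c = 1 \<or> c = -1" "0 < Re c * \<sigma> * r" for c :: complex and r
  proof -
    have "filterlim (\<lambda>t::real. t * (Re c * \<sigma> * r)) at_top at_top"
      by (rule filterlim_at_top_mult_tendsto_pos[OF tendsto_const cr(2) filterlim_ident])
    then have "filterlim (\<lambda>t::real. - (t * (Re c * \<sigma> * r))) at_bot at_top"
      by (simp add: filterlim_uminus_at_bot)
    then have "((\<lambda>t::real. exp (- (t * (Re c * \<sigma> * r)))) \<longlongrightarrow> 0) at_top"
      by (rule filterlim_compose[OF exp_at_bot])
    then have "((\<lambda>\<mu>. exp (- ((\<sigma> * Im \<mu>) * (Re c * \<sigma> * r)))) \<longlongrightarrow> 0) F"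
      unfolding F_def by (rule filterlim_compose) (rule filterlim_filtercomap)
    moreover have "norm (exp (c * \<i> * \<mu> * complex_of_real r)) = exp (- ((\<sigma> * Im \<mu>) * (Re c * \<sigma> * r)))" for \<mu>
      using cr(1) \<sigma> by (auto simp: norm_exp_eq_Re)
    ultimately have "((\<lambda>\<mu>. norm (exp (c * \<i> * \<mu> * complex_of_real r))) \<longlongrightarrow> 0) F" by simp
    then show ?thesis by (rule tendsto_norm_zero_cancel)
  qed
  have lim: "((\<lambda>\<mu>. M \<mu> $$ (i, k)) \<longlongrightarrow> ?L $$ (i, k)) F" if ik: "i < n" "k < n" for i k
  proof (cases "\<sigma> * b k > 0")
    case True
    have e: "M \<mu> $$ (i, k) = C $$ (i,k) + D $$ (i,k) * exp (1 * \<i> * \<mu> * complex_of_real (b k))" for \<mu>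
      using ik True by (simp add: M_def s_def A0mat_entry b_def)
    have "((\<lambda>\<mu>. C $$ (i,k) + D $$ (i,k) * exp (1 * \<i> * \<mu> * complex_of_real (b k))) \<longlongrightarrow> C $$ (i,k) + D $$ (i,k) * 0) F"
      by (intro tendsto_intros decay) (use True in auto)
    then show ?thesis unfolding e using ik True by simp
  next
    case False
    then have neg: "0 < Re (-1) * \<sigma> * b k" using rho_l_nonzero[OF ik(2)] \<sigma> by (auto simp: b_def)
    have e: "M \<mu> $$ (i, k) = C $$ (i,k) * exp (-1 * \<i> * \<mu> * complex_of_real (b k)) + D $$ (i,k)" for \<mu>
    proof -
      have "exp (\<i> * \<mu> * complex_of_real (b k)) * exp (- \<i> * \<mu> * complex_of_real (b k)) = 1"
        by (simp add: exp_add[symmetric])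
      then have "D $$ (i,k) * exp (\<i> * \<mu> * complex_of_real (b k)) * exp (- \<i> * \<mu> * complex_of_real (b k)) = D $$ (i,k)"
        by (simp only: mult.assoc mult_1_right)
      then show ?thesis using ik False by (simp add: M_def s_def A0mat_entry b_def[symmetric] distrib_right)
    qed
    have "((\<lambda>\<mu>. C $$ (i,k) * exp (-1 * \<i> * \<mu> * complex_of_real (b k)) + D $$ (i,k)) \<longlongrightarrow> C $$ (i,k) * 0 + D $$ (i,k)) F"
      by (intro tendsto_intros decay) (use neg in auto)
    then show ?thesis unfolding e using ik False by simp
  qed
  have dl: "((\<lambda>\<mu>. Determinant.det (M \<mu>)) \<longlongrightarrow> Determinant.det ?L) F"
    by (rule tendsto_det[OF Mc _ lim]) auto
  define c where "c = cmod (Determinant.det ?L) / 2"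
  have c: "c > 0" using det by (simp add: c_def b_def)
  have "\<forall>\<^sub>F \<mu> in F. c < cmod (Determinant.det (M \<mu>))"
    using tendsto_norm[OF dl] c by (intro order_tendstoD(1)) (auto simp: c_def)
  then obtain h where h: "\<And>\<mu>. h \<le> \<sigma> * Im \<mu> \<Longrightarrow> c < cmod (Determinant.det (M \<mu>))"
    unfolding F_def eventually_filtercomap_at_top_linorder by blast
  have dM: "Determinant.det (M \<mu>) = Delta0 n l \<beta> C D \<mu> * (\<Prod>k=0..<n. s k \<mu>)" for \<mu>
  proof -
    have "Determinant.det (M \<mu>) = (\<Sum>p\<in>{p. p permutes {0..<n}}. signof p * (\<Prod>i=0..<n. A0mat n l \<beta> C D \<mu> $$ (i, p i)) * (\<Prod>k=0..<n. s k \<mu>))"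
      unfolding det_def'[OF Mc]
    proof (intro sum.cong refl)
      fix p assume p: "p \<in> {p. p permutes {0..<n}}"
      have "(\<Prod>i=0..<n. M \<mu> $$ (i, p i)) = (\<Prod>i=0..<n. A0mat n l \<beta> C D \<mu> $$ (i, p i) * s (p i) \<mu>)"
        using permutes_in_image[of p "{0..<n}"] p by (intro prod.cong) (auto simp: M_def)
      also have "\<dots> = (\<Prod>i=0..<n. A0mat n l \<beta> C D \<mu> $$ (i, p i)) * (\<Prod>i=0..<n. s (p i) \<mu>)" by (rule prod.distrib)
      also have "(\<Prod>i=0..<n. s (p i) \<mu>) = (\<Prod>k=0..<n. s k \<mu>)"
        using prod.permute[of p "{0..<n}" "\<lambda>k. s k \<mu>"] p by (simp add: o_def)
      finally show "signof p * (\<Prod>i=0..<n. M \<mu> $$ (i, p i)) = signof p * (\<Prod>i=0..<n. A0mat n l \<beta> C D \<mu> $$ (i, p i)) * (\<Prod>k=0..<n. s k \<mu>)"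
        by (simp add: mult.assoc)
    qed
    then show ?thesis unfolding Delta0_def det_def'[OF A0mat_carrier] by (simp add: sum_distrib_right)
  qed
  show ?thesis
  \<comment> \<open>The maximum with 0 puts \<open>\<mu>\<close> on the side where all scaling
    factors have modulus at most 1.\<close>
  proof (rule exI[of _ "max h 0"], rule exI[of _ c], intro conjI allI impI c)
    fix \<mu> assume mu: "max h 0 \<le> \<sigma> * Im \<mu>"
    have s1: "cmod (s k \<mu>) \<le> 1" if "k < n" for k
    proof (cases "\<sigma> * b k > 0")
      case False
      have "Im \<mu> * b k = (\<sigma> * Im \<mu>) * (\<sigma> * b k)" using \<sigma> by auto
      also have "\<dots> \<le> 0" by (rule mult_nonneg_nonpos) (use mu False in auto)
      finally show ?thesis using False by (simp add: s_def norm_exp_eq_Re)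
    qed (simp add: s_def)
    have "c \<le> cmod (Determinant.det (M \<mu>))" using h[of \<mu>] mu by simp
    also have "\<dots> = cmod (Delta0 n l \<beta> C D \<mu>) * (\<Prod>k=0..<n. cmod (s k \<mu>))" by (simp add: dM norm_mult prod_norm)
    also have "\<dots> \<le> cmod (Delta0 n l \<beta> C D \<mu>) * 1"
      using s1 by (intro mult_left_mono prod_le_1) auto
    finally show "c \<le> cmod (Delta0 n l \<beta> C D \<mu>)" by simp
  qed
qed

text \<open>The two determinants in the definition of regularity are the limits of the rescaled
  \<open>Delta0\<close> in the lower and in the upper half plane respectively.\<close>

lemma regular_lower:
  assumes "regular_bc n l \<beta> C D"
  shows "\<exists>h c. c > 0 \<and> (\<forall>\<mu>. h \<le> \<bar>Im \<mu>\<bar> \<longrightarrow> c \<le> cmod (Delta0 n l \<beta> C D \<mu>))"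
proof -
  have Pc: "Pplus n l \<beta> \<in> carrier_mat n n" "Pminus n l \<beta> \<in> carrier_mat n n"
    by (auto simp: Pplus_def Pminus_def)
  have ent: "(X * Pminus n l \<beta> + Y * Pplus n l \<beta>) $$ (i, k) = (if rho \<beta> k l > 0 then Y $$ (i,k) else X $$ (i,k))"
    "(X * Pplus n l \<beta> + Y * Pminus n l \<beta>) $$ (i, k) = (if rho \<beta> k l > 0 then X $$ (i,k) else Y $$ (i,k))"
    if X: "X \<in> carrier_mat n n" "Y \<in> carrier_mat n n" and ik: "i < n" "k < n" for X Y i k
  proof -
    have mp: "(Z * Pplus n l \<beta>) $$ (i, k) = (if rho \<beta> k l > 0 then Z $$ (i,k) else 0)" if "Z \<in> carrier_mat n n" for Z
    proof -
      have "(Z * Pplus n l \<beta>) $$ (i, k) = (\<Sum>m<n. if m = k then (if rho \<beta> k l > 0 then Z $$ (i,k) else 0) else 0)"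
      proof -
        have "(Z * Pplus n l \<beta>) $$ (i, k) = (\<Sum>m<n. Z $$ (i, m) * Pplus n l \<beta> $$ (m, k))"
          using that ik Pc by (simp add: scalar_prod_def lessThan_atLeast0)
        also have "\<dots> = (\<Sum>m<n. if m = k then (if rho \<beta> k l > 0 then Z $$ (i,k) else 0) else 0)"
          using ik by (intro sum.cong) (auto simp: Pplus_def)
        finally show ?thesis .
      qed
      then show ?thesis using ik by simp
    qed
    have mm: "(Z * Pminus n l \<beta>) $$ (i, k) = (if rho \<beta> k l > 0 then 0 else Z $$ (i,k))" if "Z \<in> carrier_mat n n" for Z
    proof -
      have "(Z * Pminus n l \<beta>) $$ (i, k) = (\<Sum>m<n. if m = k then (if rho \<beta> k l > 0 then 0 else Z $$ (i,k)) else 0)"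
      proof -
        have "(Z * Pminus n l \<beta>) $$ (i, k) = (\<Sum>m<n. Z $$ (i, m) * Pminus n l \<beta> $$ (m, k))"
          using that ik Pc by (simp add: scalar_prod_def lessThan_atLeast0)
        also have "\<dots> = (\<Sum>m<n. if m = k then (if rho \<beta> k l > 0 then 0 else Z $$ (i,k)) else 0)"
          using ik by (intro sum.cong) (auto simp: Pplus_def Pminus_def)
        finally show ?thesis .
      qed
      then show ?thesis using ik by simp
    qed
    show "(X * Pminus n l \<beta> + Y * Pplus n l \<beta>) $$ (i, k) = (if rho \<beta> k l > 0 then Y $$ (i,k) else X $$ (i,k))"
      "(X * Pplus n l \<beta> + Y * Pminus n l \<beta>) $$ (i, k) = (if rho \<beta> k l > 0 then X $$ (i,k) else Y $$ (i,k))"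
      using mp[OF X(1)] mp[OF X(2)] mm[OF X(1)] mm[OF X(2)] X ik Pc by auto
  qed
  have 1: "Matrix.mat n n (\<lambda>(i,k). if 1 * rho \<beta> k l > 0 then C $$ (i,k) else D $$ (i,k)) = C * Pplus n l \<beta> + D * Pminus n l \<beta>"
    by (rule eq_matI) (use C_dim D_dim Pc ent(2)[OF C_dim D_dim] in auto)
  have 2: "Matrix.mat n n (\<lambda>(i,k). if (-1) * rho \<beta> k l > 0 then C $$ (i,k) else D $$ (i,k)) = C * Pminus n l \<beta> + D * Pplus n l \<beta>"
    by (rule eq_matI) (use C_dim D_dim Pc ent(1)[OF C_dim D_dim] rho_l_nonzero in \<open>auto simp: less_le\<close>)
  obtain h1 c1 where 3: "c1 > 0" "\<And>\<mu>. h1 \<le> 1 * Im \<mu> \<Longrightarrow> c1 \<le> cmod (Delta0 n l \<beta> C D \<mu>)"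
    using Delta0_lower_half_plane[of 1] assms unfolding 1 regular_bc_def by blast
  obtain h2 c2 where 4: "c2 > 0" "\<And>\<mu>. h2 \<le> -1 * Im \<mu> \<Longrightarrow> c2 \<le> cmod (Delta0 n l \<beta> C D \<mu>)"
    using Delta0_lower_half_plane[of "-1"] assms unfolding 2 regular_bc_def by blast
  show ?thesis
  proof (rule exI[of _ "max h1 h2"], rule exI[of _ "min c1 c2"], intro conjI allI impI)
    fix \<mu> assume "max h1 h2 \<le> \<bar>Im \<mu>\<bar>"
    then have "h1 \<le> 1 * Im \<mu> \<or> h2 \<le> -1 * Im \<mu>" by auto
    then show "min c1 c2 \<le> cmod (Delta0 n l \<beta> C D \<mu>)" using 3(2)[of \<mu>] 4(2)[of \<mu>] by auto
  qed (use 3 4 in auto)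
qed

text \<open>Interpreting the locale at \<open>Q = 0\<close> transfers every result about the
  perturbed operator to the unperturbed one.\<close>

lemma dirac_bc_zero: "dirac_bc n l \<beta> (\<lambda>j k x. 0) C D"
  by unfold_locales (use l_pos beta_meas beta_bdd beta_inv_bdd beta_sign C_dim D_dim in auto)

lemma Amat_zero_Q: "Amat n l \<beta> (\<lambda>j k x. 0) C D \<mu> = A0mat n l \<beta> C D \<mu>"
proof -
  interpret Z: dirac_bc n l \<beta> "\<lambda>j k x. 0" C D by (rule dirac_bc_zero)
  have "Matrix.mat n n (\<lambda>(j,k). fund n l \<beta> (\<lambda>j k x. 0) \<mu> l j k) = Matrix.mat n n (\<lambda>(j,k). fund0 \<beta> \<mu> l j k)"
    by (rule eq_matI) (use fund_zero_Q[OF Z.dirac_axioms] l_pos in auto)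
  then show ?thesis by (simp add: Amat_def A0mat_def)
qed

lemma DeltaQ_zero_Q: "DeltaQ n l \<beta> (\<lambda>j k x. 0) C D = Delta0 n l \<beta> C D"
  by (auto simp: DeltaQ_def Delta0_def Amat_zero_Q)

lemma Yvec_zero_Q: "x \<in> {0..l} \<Longrightarrow> j < n \<Longrightarrow> Yvec n l \<beta> (\<lambda>j k x. 0) C D p \<mu> x j = Y0vec n l \<beta> C D p \<mu> x j"
  using fund_zero_Q[OF dirac_bc.axioms(1)[OF dirac_bc_zero]]
  by (auto simp: Yvec_def Y0vec_def Amat_zero_Q intro!: sum.cong)

lemma Delta0_entire: "Delta0 n l \<beta> C D holomorphic_on UNIV"
  using dirac_bc.DeltaQ_entire[OF dirac_bc_zero] by (simp add: DeltaQ_zero_Q)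

lemma Yvec_cont: "cont (Yvec n l \<beta> Q C D p \<mu>)"
  unfolding V.cont_def Yvec_def
  using ac_solves_cont[OF fund_ac] by (auto simp: V.cont_def intro!: continuous_intros)

lemma Y0vec_cont: "cont (Y0vec n l \<beta> C D p \<mu>)"
  unfolding V.cont_def Y0vec_def
proof (intro allI impI continuous_intros)
  fix j k assume "k \<in> {..<n}"
  then have "continuous_on {0..l} (rho \<beta> k)" using rho_cont by auto
  then show "continuous_on {0..l} (\<lambda>x. fund0 \<beta> \<mu> x j k)"
    unfolding fund0_def by (cases "j = k") (auto intro!: continuous_intros)
qed

end

section \<open>Asymptotics along the sequences of zeros\<close>

locale bvp = dirac_sep + dirac_bc +
  fixes lam lam0 :: "int \<Rightarrow> complex"
  assumes regular: "regular_bc n l \<beta> C D"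
    and lam_zeros: "enumerates_zeros (DeltaQ n l \<beta> Q C D) lam"
    and lam0_zeros: "enumerates_zeros (Delta0 n l \<beta> C D) lam0"
    and lam_asymp: "((\<lambda>m. lam m - lam0 m) \<longlongrightarrow> 0) cofinite"
begin

lemma zero_of_enumerates:
  assumes "enumerates_zeros G mu"
  shows "G (mu m) = 0"
proof (rule ccontr)
  assume "G (mu m) \<noteq> 0"
  then have "finite {k. mu k = mu m}" "card {k. mu k = mu m} = 0" using assms by (auto simp: enumerates_zeros_def)
  then show False by auto
qed

lemma Delta0_lam0: "Delta0 n l \<beta> C D (lam0 m) = 0"
  by (rule zero_of_enumerates[OF lam0_zeros])

lemma DeltaQ_lam: "DeltaQ n l \<beta> Q C D (lam m) = 0"
  by (rule zero_of_enumerates[OF lam_zeros])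

lemma lam0_strip: "\<exists>h\<ge>0. \<forall>m. \<bar>Im (lam0 m)\<bar> \<le> h"
proof -
  obtain h c where h: "c > 0" "\<And>\<mu>. h \<le> \<bar>Im \<mu>\<bar> \<Longrightarrow> c \<le> cmod (Delta0 n l \<beta> C D \<mu>)"
    using regular_lower[OF regular] by blast
  have "\<bar>Im (lam0 m)\<bar> \<le> max h 0" for m
    using h(1) h(2)[of "lam0 m"] Delta0_lam0[of m] by (cases "h \<le> \<bar>Im (lam0 m)\<bar>") auto
  then show ?thesis by (intro exI[of _ "max h 0"]) auto
qed

definition hh :: real where "hh = (SOME h. h \<ge> 0 \<and> (\<forall>m. \<bar>Im (lam0 m)\<bar> \<le> h))"

lemma hh: "hh \<ge> 0" "\<bar>Im (lam0 m)\<bar> \<le> hh"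
  using someI_ex[OF lam0_strip[unfolded Bex_def]] unfolding hh_def by auto

text \<open>\<open>Delta0\<close> has a zero but is bounded below off a strip, so it is not
  constant; a disc then contains finitely many of its zeros, each enumerated finitely often.\<close>

lemma lam0_infinity: "\<forall>\<^sub>F m in cofinite. R < cmod (lam0 m)"
proof -
  obtain h c where h: "c > 0" "\<And>\<mu>. h \<le> \<bar>Im \<mu>\<bar> \<Longrightarrow> c \<le> cmod (Delta0 n l \<beta> C D \<mu>)"
    using regular_lower[OF regular] by blast
  have "\<not> Delta0 n l \<beta> C D constant_on UNIV"
  proof
    assume "Delta0 n l \<beta> C D constant_on UNIV"
    then have "Delta0 n l \<beta> C D (Complex 0 \<bar>h\<bar>) = Delta0 n l \<beta> C D (lam0 0)" by (auto simp: constant_on_def)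
    then show False using h(1) h(2)[of "Complex 0 \<bar>h\<bar>"] Delta0_lam0[of 0] abs_ge_self[of h] by auto
  qed
  then have fin: "finite {z \<in> cball 0 R. Delta0 n l \<beta> C D z = 0}"
    by (intro holomorphic_compact_finite_zeros[OF Delta0_entire]) auto
  have "{m. \<not> R < cmod (lam0 m)} \<subseteq> (\<Union>z\<in>{z \<in> cball 0 R. Delta0 n l \<beta> C D z = 0}. {m. lam0 m = z})"
    using Delta0_lam0 by auto
  moreover have "finite (\<Union>z\<in>{z \<in> cball 0 R. Delta0 n l \<beta> C D z = 0}. {m. lam0 m = z})"
    using fin lam0_zeros by (auto simp: enumerates_zeros_def)
  ultimately show ?thesis unfolding eventually_cofinite by (rule finite_subset)
qed

lemma lam_close: "\<epsilon> > 0 \<Longrightarrow> \<forall>\<^sub>F m in cofinite. cmod (lam m - lam0 m) < \<epsilon>"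
  using tendstoD[OF lam_asymp, of \<epsilon>] by (simp add: dist_norm)

lemma lam_infinity: "\<forall>\<^sub>F m in cofinite. R < cmod (lam m)"
  using lam0_infinity[of "R + 1"] lam_close[of 1, simplified]
proof eventually_elim
  case (elim m)
  then show ?case using norm_triangle_ineq2[of "lam0 m" "lam0 m - lam m"] by (simp add: norm_minus_commute)
qed

lemma lam_strip: "\<forall>\<^sub>F m in cofinite. \<bar>Im (lam m)\<bar> \<le> hh + 1"
  using lam_close[of 1, simplified]
proof eventually_elim
  case (elim m)
  then show ?case using abs_Im_le_cmod[of "lam m - lam0 m"] hh(2)[of m] by simp
qed

lemma exp_rho_bound:
  assumes "x \<in> {0..l}" "k < n"
  shows "cmod (exp (\<i> * lam0 m * complex_of_real (rho \<beta> k x))) \<le> exp (hh * Bl)"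
    and "exp (- (hh * Bl)) \<le> cmod (exp (\<i> * lam0 m * complex_of_real (rho \<beta> k x)))"
proof -
  have "\<bar>Im (lam0 m) * rho \<beta> k x\<bar> \<le> hh * Bl"
    unfolding abs_mult using hh(1) hh(2)[of m] rho_bound[of k x] assms by (intro mult_mono) auto
  then show "cmod (exp (\<i> * lam0 m * complex_of_real (rho \<beta> k x))) \<le> exp (hh * Bl)"
    "exp (- (hh * Bl)) \<le> cmod (exp (\<i> * lam0 m * complex_of_real (rho \<beta> k x)))"
    by (auto simp: norm_exp_eq_Re abs_le_iff)
qed

text \<open>Two comparisons: \<open>fund\<close> with \<open>fund0\<close> at \<open>lam m\<close>,
  by the asymptotics in the strip, and \<open>fund0\<close> at \<open>lam m\<close> with
  \<open>fund0\<close> at \<open>lam0 m\<close>, by boundedness of \<open>rho\<close> and of the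
  exponentials. The points \<open>xs m\<close> are arbitrary in preparation for
  \<open>uniform_from_selection\<close>.\<close>

lemma fund_near:
  assumes xs: "\<And>m. xs m \<in> {0..l}" and jk: "j < n" "k < n"
  shows "near cofinite (\<lambda>m. fund n l \<beta> Q (lam m) (xs m) j k) (\<lambda>m. fund0 \<beta> (lam0 m) (xs m) j k)"
  unfolding near_def
proof
  show "Bfun (\<lambda>m. fund0 \<beta> (lam0 m) (xs m) j k) cofinite"
    by (rule BfunI[of _ "exp (hh * Bl)"]) (use exp_rho_bound(1)[OF xs jk(2)] in \<open>auto simp: fund0_def\<close>)
  have 1: "((\<lambda>m. fund n l \<beta> Q (lam m) (xs m) j k - fund0 \<beta> (lam m) (xs m) j k) \<longlongrightarrow> 0) cofinite"
  proof (rule tendstoI)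
    fix e :: real assume e: "e > 0"
    obtain R where R: "\<And>\<mu> x. \<bar>Im \<mu>\<bar> \<le> hh + 1 \<and> R \<le> cmod \<mu> \<Longrightarrow> x \<in> {0..l} \<Longrightarrow> norm (fund n l \<beta> Q \<mu> x j k - fund0 \<beta> \<mu> x j k) < e"
      using fund_asymp[OF e, of "hh + 1"] jk by blast
    show "\<forall>\<^sub>F m in cofinite. dist (fund n l \<beta> Q (lam m) (xs m) j k - fund0 \<beta> (lam m) (xs m) j k) 0 < e"
      using lam_strip lam_infinity[of R] by eventually_elim (use R xs in \<open>auto simp: dist_norm\<close>)
  qed
  have 2: "((\<lambda>m. fund0 \<beta> (lam m) (xs m) j k - fund0 \<beta> (lam0 m) (xs m) j k) \<longlongrightarrow> 0) cofinite"
  proof (cases "j = k")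
    case True
    have "Bfun (\<lambda>m. complex_of_real (rho \<beta> k (xs m))) cofinite"
      by (rule BfunI[of _ Bl]) (use rho_bound[OF jk(2) xs] in auto)
    from tendsto_zero_mult_Bfun[OF lam_asymp this]
    have "((\<lambda>m. \<i> * ((lam m - lam0 m) * complex_of_real (rho \<beta> k (xs m)))) \<longlongrightarrow> \<i> * 0) cofinite"
      by (intro tendsto_intros)
    then have "((\<lambda>m. exp (\<i> * ((lam m - lam0 m) * complex_of_real (rho \<beta> k (xs m)))) - 1) \<longlongrightarrow> exp (\<i> * 0) - 1) cofinite"
      by (intro tendsto_diff tendsto_exp tendsto_const)
    then have "((\<lambda>m. exp (\<i> * ((lam m - lam0 m) * complex_of_real (rho \<beta> k (xs m)))) - 1) \<longlongrightarrow> 0) cofinite" by simp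
    moreover have "Bfun (\<lambda>m. exp (\<i> * lam0 m * complex_of_real (rho \<beta> k (xs m)))) cofinite"
      by (rule BfunI[of _ "exp (hh * Bl)"]) (use exp_rho_bound(1)[OF xs jk(2)] in auto)
    ultimately have "((\<lambda>m. (exp (\<i> * ((lam m - lam0 m) * complex_of_real (rho \<beta> k (xs m)))) - 1) * exp (\<i> * lam0 m * complex_of_real (rho \<beta> k (xs m)))) \<longlongrightarrow> 0) cofinite"
      by (rule tendsto_zero_mult_Bfun)
    moreover have "(exp (\<i> * ((lam m - lam0 m) * complex_of_real r)) - 1) * exp (\<i> * lam0 m * complex_of_real r) =
        exp (\<i> * lam m * complex_of_real r) - exp (\<i> * lam0 m * complex_of_real r)" for m r
    proof -
      have "exp (\<i> * ((lam m - lam0 m) * complex_of_real r)) * exp (\<i> * lam0 m * complex_of_real r) = exp (\<i> * lam m * complex_of_real r)"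
        by (simp add: exp_add[symmetric] algebra_simps)
      then show ?thesis by (simp only: left_diff_distrib mult_1_left)
    qed
    ultimately show ?thesis using True by (simp add: fund0_def)
  qed (simp add: fund0_def)
  from tendsto_add[OF 1 2] show "((\<lambda>m. fund n l \<beta> Q (lam m) (xs m) j k - fund0 \<beta> (lam0 m) (xs m) j k) \<longlongrightarrow> 0) cofinite"
    by simp
qed

lemma Amat_near:
  assumes ik: "i < n" "k < n"
  shows "near cofinite (\<lambda>m. Amat n l \<beta> Q C D (lam m) $$ (i, k)) (\<lambda>m. A0mat n l \<beta> C D (lam0 m) $$ (i, k))"
proof -
  have "A0mat n l \<beta> C D \<mu> $$ (i, k) = C $$ (i, k) + (\<Sum>m<n. D $$ (i, m) * fund0 \<beta> \<mu> l m k)" for \<mu>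
    using ik C_dim D_dim by (simp add: A0mat_def scalar_prod_def lessThan_atLeast0)
  then show ?thesis
    unfolding Amat_entry[OF ik]
    using l_pos ik by (auto intro!: near_add near_const near_sum near_mult fund_near)
qed

lemma adj_near:
  assumes "i < n" "k < n"
  shows "near cofinite (\<lambda>m. adj_mat (Amat n l \<beta> Q C D (lam m)) $$ (i, k)) (\<lambda>m. adj_mat (A0mat n l \<beta> C D (lam0 m)) $$ (i, k))"
  by (rule near_adj_mat[OF Amat_carrier A0mat_carrier Amat_near assms])

lemma Y_near:
  assumes "\<And>m. xs m \<in> {0..l}" and "p < n" "j < n"
  shows "near cofinite (\<lambda>m. Yvec n l \<beta> Q C D p (lam m) (xs m) j) (\<lambda>m. Y0vec n l \<beta> C D p (lam0 m) (xs m) j)"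
  unfolding Yvec_def Y0vec_def using assms by (intro near_sum near_mult adj_near fund_near) auto

lemma cnorm_le_sum: "cnorm n v \<le> (\<Sum>j<n. cmod (v j))"
  using L2_set_le_sum[of "{..<n}" "\<lambda>j. cmod (v j)"] by (simp add: cnorm_def L2_set_def)

lemma components_imp_cnorm:
  assumes "\<And>j \<epsilon>. j < n \<Longrightarrow> \<epsilon> > 0 \<Longrightarrow> \<forall>\<^sub>F m in F. \<forall>x\<in>{0..l}. cmod (f m x j) < \<epsilon>" and e: "\<epsilon> > 0"
  shows "\<forall>\<^sub>F m in F. \<forall>x\<in>{0..l}. cnorm n (\<lambda>j. f m x j) < \<epsilon>"
proof -
  define d where "d = \<epsilon> / (real n + 1)"
  have d: "d > 0" using e by (simp add: d_def)
  have "\<forall>\<^sub>F m in F. \<forall>j\<in>{..<n}. \<forall>x\<in>{0..l}. cmod (f m x j) < d"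
    using assms(1) d by (intro eventually_ball_finite) auto
  then show ?thesis
  proof eventually_elim
    case (elim m)
    show ?case
    proof
      fix x assume x: "x \<in> {0..l}"
      have "cnorm n (\<lambda>j. f m x j) \<le> (\<Sum>j<n. cmod (f m x j))" by (rule cnorm_le_sum)
      also have "\<dots> \<le> (\<Sum>j<n. d)" using elim x by (intro sum_mono) (auto intro: less_imp_le)
      also have "\<dots> < \<epsilon>" using e by (simp add: d_def field_simps)
      finally show "cnorm n (\<lambda>j. f m x j) < \<epsilon>" .
    qed
  qed
qed

lemma Y_uniform:
  assumes "p < n" "j < n" "\<epsilon> > 0"
  shows "\<forall>\<^sub>F m in cofinite. \<forall>x\<in>{0..l}. cmod (Yvec n l \<beta> Q C D p (lam m) x j - Y0vec n l \<beta> C D p (lam0 m) x j) < \<epsilon>"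
proof (rule uniform_from_selection)
  show "((\<lambda>m. Yvec n l \<beta> Q C D p (lam m) (xs m) j - Y0vec n l \<beta> C D p (lam0 m) (xs m) j) \<longlongrightarrow> 0) cofinite"
    if "\<And>m. xs m \<in> {0..l}" for xs
    using Y_near[OF that assms(1,2)] by (simp add: near_def)
  show "0 \<in> {0..l}" using l_pos by simp
qed (rule assms)

lemma Y_uniform_all:
  assumes "\<epsilon> > 0"
  shows "\<forall>\<^sub>F m in cofinite. \<forall>p<n. \<forall>j<n. \<forall>x\<in>{0..l}. cmod (Yvec n l \<beta> Q C D p (lam m) x j - Y0vec n l \<beta> C D p (lam0 m) x j) < \<epsilon>"
proof -
  have "\<forall>\<^sub>F m in cofinite. \<forall>p\<in>{..<n}. \<forall>j\<in>{..<n}. \<forall>x\<in>{0..l}. cmod (Yvec n l \<beta> Q C D p (lam m) x j - Y0vec n l \<beta> C D p (lam0 m) x j) < \<epsilon>"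
    by (rule eventually_ball_finite, simp, rule ballI, rule eventually_ball_finite, simp, rule ballI, rule Y_uniform) (use assms in auto)
  then show ?thesis by (rule eventually_mono) auto
qed

lemma Y_H_norm:
  assumes p: "p < n"
  shows "((\<lambda>m. H_norm n l \<beta> (\<lambda>x j. Yvec n l \<beta> Q C D p (lam m) x j - Y0vec n l \<beta> C D p (lam0 m) x j)) \<longlongrightarrow> 0) cofinite"
proof (rule tendstoI)
  fix e :: real assume e: "e > 0"
  define d where "d = e / (2 * sqrt (2 * Bl + 1))"
  have s: "sqrt (2 * Bl + 1) > 0" using Bl_nonneg by simp
  have d: "d > 0" using e s by (simp add: d_def)
  show "\<forall>\<^sub>F m in cofinite. dist (H_norm n l \<beta> (\<lambda>x j. Yvec n l \<beta> Q C D p (lam m) x j - Y0vec n l \<beta> C D p (lam0 m) x j)) 0 < e"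
    using Y_uniform_all[OF d]
  proof eventually_elim
    case (elim m)
    let ?f = "\<lambda>x j. Yvec n l \<beta> Q C D p (lam m) x j - Y0vec n l \<beta> C D p (lam0 m) x j"
    have fc: "cont ?f"
      using Yvec_cont[of p "lam m"] Y0vec_cont[of p "lam0 m"] by (auto simp: V.cont_def intro: continuous_on_diff)
    \<comment> \<open>Comparison with the zero function turns the difference estimate into a bound
      for the norm itself; \<open>d\<close> is chosen so that this norm is at most
      \<open>e / 2\<close>.\<close>
    have "\<bar>Hsq ?f - Hsq (\<lambda>x j. 0)\<bar> \<le> 2 * d * d * Bl"
      by (rule Hsq_diff[OF fc cont_zero]) (use elim p d in \<open>auto intro: less_imp_le\<close>)
    then have "Hsq ?f \<le> d\<^sup>2 * (2 * Bl + 1)"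
      using Hsq_nonneg[OF fc] by (simp add: Hsq_def power2_eq_square algebra_simps)
        (smt (verit) zero_le_square)
    then have "H_norm n l \<beta> ?f \<le> sqrt (d\<^sup>2 * (2 * Bl + 1))" unfolding H_norm_Hsq by (rule real_sqrt_le_mono)
    also have "\<dots> = d * sqrt (2 * Bl + 1)" using d by (simp add: real_sqrt_mult)
    also have "\<dots> = e / 2" using s by (simp add: d_def)
    finally show ?case using e Hsq_nonneg[OF fc] by (simp add: H_norm_Hsq)
  qed
qed

end

section \<open>Strictly regular boundary conditions\<close>

text \<open>Jacobi's formula. The terms of Leibniz's expansion differentiated in row
  \<open>i\<close> add up to the determinant with row \<open>i\<close> replaced by derivatives, and
  Laplace expansion along that row involves only cofactors untouched by the replacement.\<close>

lemma det_has_field_derivative: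
  fixes a a' :: "nat \<Rightarrow> nat \<Rightarrow> complex \<Rightarrow> complex" and A :: "complex \<Rightarrow> complex Matrix.mat"
  assumes A: "\<And>z. A z \<in> carrier_mat n n" "\<And>z i k. i < n \<Longrightarrow> k < n \<Longrightarrow> A z $$ (i, k) = a i k z"
    and d: "\<And>i k. i < n \<Longrightarrow> k < n \<Longrightarrow> (a i k has_field_derivative a' i k z) (at z)"
  shows "((\<lambda>z. Determinant.det (A z)) has_field_derivative
     (\<Sum>i<n. \<Sum>k<n. a' i k z * cofactor (A z) i k)) (at z)"
proof -
  let ?P = "{p. p permutes {0..<n}}"
  have pn: "p i < n" if "p \<in> ?P" "i < n" for p i
    using permutes_in_image[of p "{0..<n}" i] that by auto
  have prodD: "((\<lambda>z. \<Prod>i\<in>I. f i z) has_field_derivative (\<Sum>i\<in>I. f' i * (\<Prod>j\<in>I - {i}. f j z))) (at z)"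
    if "\<And>i. i \<in> I \<Longrightarrow> (f i has_field_derivative f' i) (at z)" for I :: "nat set" and f :: "nat \<Rightarrow> complex \<Rightarrow> complex" and f'
  proof -
    have "((\<lambda>z. \<Prod>i\<in>I. f i z) has_derivative (\<lambda>y. \<Sum>i\<in>I. f' i * y * (\<Prod>j\<in>I - {i}. f j z))) (at z)"
      using that unfolding has_field_derivative_def by (intro has_derivative_prod) auto
    moreover have "(\<lambda>y. \<Sum>i\<in>I. f' i * y * (\<Prod>j\<in>I - {i}. f j z)) = (*) (\<Sum>i\<in>I. f' i * (\<Prod>j\<in>I - {i}. f j z))"
      by (rule ext) (simp add: sum_distrib_left sum_distrib_right mult_ac)
    ultimately show ?thesis unfolding has_field_derivative_def by simp
  qed
  have dz: "(\<lambda>z. Determinant.det (A z)) = (\<lambda>z. \<Sum>p\<in>?P. signof p * (\<Prod>i=0..<n. a i (p i) z))"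
    unfolding det_def'[OF A(1)] by (intro ext sum.cong refl arg_cong2[of _ _ _ _ "(*)"] prod.cong) (use A(2) pn in auto)
  have D: "((\<lambda>z. Determinant.det (A z)) has_field_derivative
     (\<Sum>p\<in>?P. signof p * (\<Sum>i\<in>{0..<n}. a' i (p i) z * (\<Prod>j\<in>{0..<n} - {i}. a j (p j) z)))) (at z)"
    unfolding dz
    by (intro DERIV_sum DERIV_cmult prodD d) (use pn in auto)
  have row: "(\<Sum>k<n. a' i k z * cofactor (A z) i k) = (\<Sum>p\<in>?P. signof p * (a' i (p i) z * (\<Prod>j\<in>{0..<n} - {i}. a j (p j) z)))" if i: "i < n" for i
  proof -
    define B where "B = Matrix.mat n n (\<lambda>(j,k). if j = i then a' i k z else a j k z)"
    have Bc: "B \<in> carrier_mat n n" by (simp add: B_def)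
    have "cofactor B i k = cofactor (A z) i k" if k: "k < n" for k
    proof -
      have "mat_delete B i k = mat_delete (A z) i k"
        by (rule eq_matI) (use A(1)[of z] A(2) i k in \<open>auto simp: mat_delete_def B_def\<close>)
      then show ?thesis by (simp add: cofactor_def)
    qed
    then have "(\<Sum>k<n. a' i k z * cofactor (A z) i k) = (\<Sum>k<n. B $$ (i,k) * cofactor B i k)"
      using i by (intro sum.cong) (auto simp: B_def)
    also have "\<dots> = Determinant.det B" by (rule laplace_expansion_row[OF Bc i, symmetric])
    also have "\<dots> = (\<Sum>p\<in>?P. signof p * (\<Prod>j=0..<n. B $$ (j, p j)))" by (rule det_def'[OF Bc])
    also have "\<dots> = (\<Sum>p\<in>?P. signof p * (a' i (p i) z * (\<Prod>j\<in>{0..<n} - {i}. a j (p j) z)))"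
    proof (intro sum.cong refl)
      fix p assume p: "p \<in> ?P"
      have "(\<Prod>j=0..<n. B $$ (j, p j)) = B $$ (i, p i) * (\<Prod>j\<in>{0..<n} - {i}. B $$ (j, p j))"
        using i by (intro prod.remove) auto
      also have "(\<Prod>j\<in>{0..<n} - {i}. B $$ (j, p j)) = (\<Prod>j\<in>{0..<n} - {i}. a j (p j) z)"
        by (intro prod.cong) (use pn[OF p] in \<open>auto simp: B_def\<close>)
      also have "B $$ (i, p i) = a' i (p i) z" using i pn[OF p] by (simp add: B_def)
      finally show "signof p * (\<Prod>j=0..<n. B $$ (j, p j)) = signof p * (a' i (p i) z * (\<Prod>j\<in>{0..<n} - {i}. a j (p j) z))" by simp
    qed
    finally show ?thesis .
  qed
  have "(\<Sum>i<n. \<Sum>k<n. a' i k z * cofactor (A z) i k) =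
     (\<Sum>i<n. \<Sum>p\<in>?P. signof p * (a' i (p i) z * (\<Prod>j\<in>{0..<n} - {i}. a j (p j) z)))"
    by (intro sum.cong refl row) auto
  also have "\<dots> = (\<Sum>p\<in>?P. signof p * (\<Sum>i\<in>{0..<n}. a' i (p i) z * (\<Prod>j\<in>{0..<n} - {i}. a j (p j) z)))"
    by (subst sum.swap) (simp add: sum_distrib_left lessThan_atLeast0)
  finally show ?thesis using D by simp
qed

text \<open>Normal families: entire functions, locally uniformly bounded and not all degenerating to zero,
  whose zero at the origin is simple and isolated at a fixed scale, have derivative at the origin
  bounded away from zero; otherwise a limit function would have a double zero there, contradicting
  Hurwitz for the quotients by \<open>z\<close>.\<close>

lemma deriv_lower_bound_normal_family:
  fixes g :: "nat \<Rightarrow> complex \<Rightarrow> complex"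
  assumes hol: "\<And>k. g k holomorphic_on UNIV"
    and bd: "\<And>R. \<exists>B. \<forall>k. \<forall>z\<in>cball 0 R. cmod (g k z) \<le> B"
    and g0: "\<And>k. g k 0 = 0" and dne: "\<And>k. deriv (g k) 0 \<noteq> 0"
    and iso: "\<And>k z. z \<noteq> 0 \<Longrightarrow> cmod z < \<delta> \<Longrightarrow> g k z \<noteq> 0" and \<delta>: "\<delta> > 0"
    and low: "c > 0" "\<And>k. c \<le> cmod (g k z0)"
    and lim: "(\<lambda>k. deriv (g k) 0) \<longlonglongrightarrow> 0"
  shows False
proof -
  have bdK: "\<exists>B. \<forall>h\<in>range g. \<forall>z\<in>K. cmod (h z) \<le> B" if K: "compact K" for K
  proof -
    obtain R where "\<forall>x\<in>K. cmod x \<le> R" using compact_imp_bounded[OF K] unfolding bounded_iff by auto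
    then have R: "K \<subseteq> cball 0 R" by auto
    obtain B where "\<forall>k. \<forall>z\<in>cball 0 R. cmod (g k z) \<le> B" using bd[of R] ..
    then show ?thesis using R by (intro exI[of _ B]) (auto simp: subset_iff)
  qed
  obtain G r where G: "G holomorphic_on UNIV" and r: "strict_mono (r :: nat \<Rightarrow> nat)"
    and pt: "\<And>x. (\<lambda>n. g (r n) x) \<longlonglongrightarrow> G x"
    and ul: "\<And>K. compact K \<Longrightarrow> uniform_limit K (g \<circ> r) G sequentially"
  proof (rule Montel[of UNIV "range g" g])
    fix G r assume "G holomorphic_on UNIV" "strict_mono (r :: nat \<Rightarrow> nat)"
      "\<And>x. x \<in> UNIV \<Longrightarrow> (\<lambda>n. g (r n) x) \<longlonglongrightarrow> G x"
      "\<And>K. compact K \<Longrightarrow> K \<subseteq> UNIV \<Longrightarrow> uniform_limit K (g \<circ> r) G sequentially"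
    then show ?thesis by (intro that[of G r]) auto
  qed (use hol bdK in auto)
  have G0: "G 0 = 0" using pt[of 0] by (simp add: g0 LIMSEQ_const_iff)
  have Gz0: "c \<le> cmod (G z0)"
    using tendsto_norm[OF pt[of z0]] low(2) by (intro LIMSEQ_le_const) auto
  define h where "h k z = (if z = 0 then deriv (g k) 0 else (g k z - g k 0) / (z - 0))" for k z
  define H where "H z = (if z = 0 then deriv G 0 else (G z - G 0) / (z - 0))" for z
  have hh: "h k holomorphic_on UNIV" for k unfolding h_def by (rule pole_lemma_open[OF hol open_UNIV])
  have HH: "H holomorphic_on UNIV" unfolding H_def by (rule pole_lemma_open[OF G open_UNIV])
  have close: "\<forall>\<^sub>F n in sequentially. \<forall>z\<in>cball 0 \<delta>. cmod (h (r n) z - H z) < e" if e: "e > 0" for e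
  proof -
    have "\<forall>\<^sub>F n in sequentially. \<forall>z\<in>cball 0 \<delta>. dist ((g \<circ> r) n z) (G z) < e / 2 * \<delta>"
      by (rule uniform_limitD[OF ul[OF compact_cball]]) (use e \<delta> in simp)
    then show ?thesis
    proof eventually_elim
      case (elim n)
      have "cmod (h (r n) z - H z) \<le> e / 2" if z: "z \<in> cball 0 \<delta>" for z
      \<comment> \<open>Division by \<open>z\<close> is harmless on the circle of radius
        \<open>\<delta>\<close>; the maximum principle carries the estimate into the disc, including
        the removable singularity.\<close>
      proof (rule maximum_modulus_frontier[of "\<lambda>z. h (r n) z - H z" "cball 0 \<delta>"])
        show "(\<lambda>z. h (r n) z - H z) holomorphic_on interior (cball 0 \<delta>)"
          by (intro holomorphic_on_diff holomorphic_on_subset[OF hh] holomorphic_on_subset[OF HH]) auto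
        show "continuous_on (closure (cball 0 \<delta>)) (\<lambda>z. h (r n) z - H z)"
          by (intro continuous_on_diff holomorphic_on_imp_continuous_on holomorphic_on_subset[OF hh] holomorphic_on_subset[OF HH]) auto
        fix w :: complex assume "w \<in> frontier (cball 0 \<delta>)"
        then have w: "cmod w = \<delta>" by (simp add: frontier_cball)
        then have w0: "w \<noteq> 0" using \<delta> by auto
        have "h (r n) w - H w = (g (r n) w - G w) / w" using w0 by (simp add: h_def H_def g0 G0 diff_divide_distrib)
        then have "cmod (h (r n) w - H w) = cmod (g (r n) w - G w) / \<delta>" by (simp add: norm_divide w)
        also have "\<dots> \<le> (e / 2 * \<delta>) / \<delta>"
          using elim[rule_format, of w] w \<delta> by (intro divide_right_mono) (auto simp: dist_norm)
        finally show "cmod (h (r n) w - H w) \<le> e / 2" using \<delta> by simp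
      qed (use z in auto)
      then show ?case using e by fastforce
    qed
  qed
  have "(\<lambda>n. h (r n) 0) \<longlonglongrightarrow> H 0"
  proof (rule tendstoI)
    fix e :: real assume "e > 0"
    from close[OF this] show "\<forall>\<^sub>F n in sequentially. dist (h (r n) 0) (H 0) < e"
      by (rule eventually_mono) (use \<delta> in \<open>auto simp: dist_norm\<close>)
  qed
  moreover have "(\<lambda>n. h (r n) 0) \<longlonglongrightarrow> 0"
    using LIMSEQ_subseq_LIMSEQ[OF lim r] by (simp add: h_def o_def)
  ultimately have H0: "H 0 = 0" by (rule LIMSEQ_unique)
  have GH: "G z = z * H z" for z by (simp add: H_def G0)
  \<comment> \<open>A constant quotient would be 0, so \<open>G\<close> would vanish on the disc and
    hence everywhere, against the lower bound at \<open>z0\<close>.\<close>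
  have nc: "\<not> H constant_on ball 0 \<delta>"
  proof
    assume "H constant_on ball 0 \<delta>"
    then have "H z = 0" if "z \<in> ball 0 \<delta>" for z
      using that \<delta> H0 unfolding constant_on_def by (metis centre_in_ball)
    then have "G z = 0" if "z \<in> ball 0 \<delta>" for z using that by (simp add: GH)
    then have "G z0 = 0"
      using analytic_continuation_open[of "ball 0 \<delta>" UNIV G "\<lambda>_. 0" z0] G \<delta> by auto
    then show False using Gz0 low(1) by simp
  qed
  have "H 0 \<noteq> 0"
  proof (rule Hurwitz_no_zeros[of "ball 0 \<delta>" "h \<circ> r" H])
    show "uniform_limit K (h \<circ> r) H sequentially" if "compact K" "K \<subseteq> ball 0 \<delta>" for K
    proof (rule uniform_limitI)
      fix e :: real assume "e > 0"
      from close[OF this] show "\<forall>\<^sub>F n in sequentially. \<forall>x\<in>K. dist ((h \<circ> r) n x) (H x) < e"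
        by (rule eventually_mono) (use that(2) in \<open>auto simp: dist_norm subset_iff\<close>)
    qed
    show "(h \<circ> r) n z \<noteq> 0" if "z \<in> ball 0 \<delta>" for n z
      using iso[of z "r n"] dne[of "r n"] that by (auto simp: h_def g0)
  qed (use hh HH nc \<delta> in \<open>auto intro: holomorphic_on_subset\<close>)
  then show False using H0 by simp
qed

section \<open>Separation, simplicity and derivatives at the zeros\<close>

locale strict_bvp = bvp +
  assumes strict: "\<exists>m0 \<delta>. \<delta> > 0 \<and> (\<forall>j k. j \<noteq> k \<and> \<bar>j\<bar> > m0 \<and> \<bar>k\<bar> > m0 \<longrightarrow> cmod (lam0 j - lam0 k) > 2 * \<delta>)"
begin

text \<open>Strict regularity separates late zeros from each other. The finitely many early ones are
  bounded by \<open>S\<close>, and late zeros leave every bounded set.\<close>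

lemma lam0_isolated: "\<exists>\<delta>>0. \<forall>\<^sub>F m in cofinite. \<forall>k. k \<noteq> m \<longrightarrow> 2 * \<delta> < cmod (lam0 k - lam0 m)"
proof -
  obtain m0 \<delta> where d: "\<delta> > 0" and s: "\<And>j k. j \<noteq> k \<Longrightarrow> \<bar>j\<bar> > m0 \<Longrightarrow> \<bar>k\<bar> > m0 \<Longrightarrow> cmod (lam0 j - lam0 k) > 2 * \<delta>"
    using strict by blast
  define S where "S = (\<Sum>k\<in>{-m0..m0}. cmod (lam0 k))"
  have Sk: "cmod (lam0 k) \<le> S" if "\<bar>k\<bar> \<le> m0" for k
    unfolding S_def by (rule member_le_sum) (use that in auto)
  have "\<forall>\<^sub>F m in cofinite. m \<notin> {-m0..m0}" by (simp add: eventually_cofinite)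
  with lam0_infinity[of "S + 2 * \<delta>"]
  have "\<forall>\<^sub>F m in cofinite. \<forall>k. k \<noteq> m \<longrightarrow> 2 * \<delta> < cmod (lam0 k - lam0 m)"
  proof eventually_elim
    case (elim m)
    show ?case
    proof (intro allI impI)
      fix k assume km: "k \<noteq> m"
      show "2 * \<delta> < cmod (lam0 k - lam0 m)"
      proof (cases "\<bar>k\<bar> > m0")
        case True
        then show ?thesis using s[of k m] km elim by auto
      next
        case False
        then show ?thesis using Sk[of k] elim norm_triangle_ineq2[of "lam0 m" "lam0 k"] by (simp add: norm_minus_commute)
      qed
    qed
  qed
  with d show ?thesis by blast
qed

lemma lam0_simple: "\<forall>\<^sub>F m in cofinite. card {k. lam0 k = lam0 m} = 1"
proof -
  obtain \<delta> where "\<delta> > 0" and ev: "\<forall>\<^sub>F m in cofinite. \<forall>k. k \<noteq> m \<longrightarrow> 2 * \<delta> < cmod (lam0 k - lam0 m)"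
    using lam0_isolated by blast
  show ?thesis using ev
  proof eventually_elim
    case (elim m)
    then have "{k. lam0 k = lam0 m} = {m}" using \<open>\<delta> > 0\<close> by fastforce
    then show ?case by simp
  qed
qed

text \<open>Zeros within \<open>\<delta>\<close> of points more than \<open>2 * \<delta>\<close>
  apart are distinct. The finitely many indices at which \<open>lam\<close> is not that close to
  \<open>lam0\<close> are excluded by size.\<close>

lemma lam_simple: "\<forall>\<^sub>F m in cofinite. card {k. lam k = lam m} = 1"
proof -
  obtain \<delta> where d: "\<delta> > 0" and ev: "\<forall>\<^sub>F m in cofinite. \<forall>k. k \<noteq> m \<longrightarrow> 2 * \<delta> < cmod (lam0 k - lam0 m)"
    using lam0_isolated by blast
  have fin: "finite {k. \<not> cmod (lam k - lam0 k) < \<delta>}" using lam_close[OF d] by (simp add: eventually_cofinite)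
  define S where "S = (\<Sum>k\<in>{k. \<not> cmod (lam k - lam0 k) < \<delta>}. cmod (lam k))"
  have Sk: "cmod (lam k) \<le> S" if "\<not> cmod (lam k - lam0 k) < \<delta>" for k
    unfolding S_def by (rule member_le_sum) (use that fin in auto)
  show ?thesis using ev lam_close[OF d] lam_infinity[of S]
  proof eventually_elim
    case (elim m)
    have "lam k \<noteq> lam m" if km: "k \<noteq> m" for k
    proof (cases "cmod (lam k - lam0 k) < \<delta>")
      case True
      have "2 * \<delta> < cmod (lam0 k - lam0 m)" using elim km by blast
      also have "lam0 k - lam0 m = (lam m - lam0 m) - (lam k - lam0 k) + (lam k - lam m)" by simp
      finally show ?thesis using norm_triangle_ineq4[of "lam m - lam0 m" "lam k - lam0 k"] True elim(2) by auto
    next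
      case False
      then show ?thesis using Sk[of k] elim by auto
    qed
    then have "{k. lam k = lam m} = {m}" by blast
    then show ?case by simp
  qed
qed

text \<open>\<open>near\<close> of a function to itself is boundedness, so \<open>near_det\<close>
  on the principal filter of the strip bounds the determinant by way of its entries.\<close>

lemma Delta0_bounded_strip: "\<exists>B. \<forall>\<mu>. \<bar>Im \<mu>\<bar> \<le> h \<longrightarrow> cmod (Delta0 n l \<beta> C D \<mu>) \<le> B"
proof -
  define F where "F = principal {\<mu>. \<bar>Im \<mu>\<bar> \<le> h}"
  have e: "cmod (exp (\<i> * \<mu> * complex_of_real (rho \<beta> k l))) \<le> exp (\<bar>h\<bar> * Bl)" if "\<bar>Im \<mu>\<bar> \<le> h" "k < n" for \<mu> k
  proof -
    have "\<bar>Im \<mu> * rho \<beta> k l\<bar> \<le> \<bar>h\<bar> * Bl"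
      unfolding abs_mult using rho_bound[of k l] that l_pos by (intro mult_mono) auto
    then show ?thesis by (auto simp: norm_exp_eq_Re abs_le_iff)
  qed
  have "near F (\<lambda>\<mu>. Determinant.det (A0mat n l \<beta> C D \<mu>)) (\<lambda>\<mu>. Determinant.det (A0mat n l \<beta> C D \<mu>))"
  proof (rule near_det[OF A0mat_carrier A0mat_carrier])
    fix i k assume ik: "i < n" "k < n"
    have "near F (\<lambda>\<mu>. exp (\<i> * \<mu> * complex_of_real (rho \<beta> k l))) (\<lambda>\<mu>. exp (\<i> * \<mu> * complex_of_real (rho \<beta> k l)))"
      by (intro near_refl BfunI[of _ "exp (\<bar>h\<bar> * Bl)"]) (use e ik in \<open>auto simp: F_def eventually_principal\<close>)
    then show "near F (\<lambda>\<mu>. A0mat n l \<beta> C D \<mu> $$ (i, k)) (\<lambda>\<mu>. A0mat n l \<beta> C D \<mu> $$ (i, k))"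
      unfolding A0mat_entry[OF ik] by (intro near_add near_mult near_const)
  qed
  then obtain B where "eventually (\<lambda>\<mu>. cmod (Determinant.det (A0mat n l \<beta> C D \<mu>)) \<le> B) F"
    unfolding near_def Bfun_def by blast
  then show ?thesis by (auto simp: F_def eventually_principal Delta0_def)
qed

text \<open>A singleton fibre means order 1, and the first Taylor coefficient is the
  derivative.\<close>

lemma Delta0_deriv_nonzero:
  assumes "card {k. lam0 k = lam0 m} = 1"
  shows "deriv (\<lambda>z. Delta0 n l \<beta> C D (lam0 m + z)) 0 \<noteq> 0"
proof -
  interpret Z: dirac_bc n l \<beta> "\<lambda>j k x. 0" C D by (rule dirac_bc_zero)
  have en: "enumerates_zeros (DeltaQ n l \<beta> (\<lambda>j k x. 0) C D) lam0" using lam0_zeros by (simp add: DeltaQ_zero_Q)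
  have sd: "subdegree (Z.detA (lam0 m)) = 1" using Z.enumerates_detA(2)[OF en] assms by simp
  have fe: "(\<lambda>z. Delta0 n l \<beta> C D (lam0 m + z)) has_fps_expansion Z.detA (lam0 m)"
    using Z.DeltaQ_fps[of "lam0 m"] by (simp add: DeltaQ_zero_Q)
  have "deriv (\<lambda>z. Delta0 n l \<beta> C D (lam0 m + z)) 0 = fps_nth (fps_deriv (Z.detA (lam0 m))) 0"
    using has_fps_expansion_imp_0_eq_fps_nth_0[OF has_fps_expansion_deriv[OF fe]] .
  also have "\<dots> = fps_nth (Z.detA (lam0 m)) 1" by simp
  also have "\<dots> \<noteq> 0" using sd by (metis nth_subdegree_nonzero Z.enumerates_detA(1)[OF en])
  finally show ?thesis .
qed

text \<open>Zeros with derivatives tending to 0 would contradict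
  \<open>deriv_lower_bound_normal_family\<close> for the translates of \<open>Delta0\<close> to
  these zeros: strips give local bounds, isolation gives a zero-free punctured disc, and regularity
  gives a point at which no translate is small.\<close>

lemma Delta0_deriv_lower:
  "\<exists>c>0. \<forall>\<^sub>F m in cofinite. c \<le> cmod (deriv (\<lambda>z. Delta0 n l \<beta> C D (lam0 m + z)) 0)"
proof (rule ccontr)
  let ?d = "\<lambda>m. deriv (\<lambda>z. Delta0 n l \<beta> C D (lam0 m + z)) 0"
  assume neg: "\<not> ?thesis"
  obtain \<delta> where d: "\<delta> > 0" and ev: "\<forall>\<^sub>F m in cofinite. \<forall>k. k \<noteq> m \<longrightarrow> 2 * \<delta> < cmod (lam0 k - lam0 m)"
    using lam0_isolated by blast
  have "\<exists>m. cmod (?d m) < 1 / real (Suc k) \<and> (\<forall>j. j \<noteq> m \<longrightarrow> 2 * \<delta> < cmod (lam0 j - lam0 m)) \<and> card {j. lam0 j = lam0 m} = 1" for k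
  proof (rule ccontr)
    assume no: "\<not> ?thesis"
    have "\<forall>\<^sub>F m in cofinite. 1 / real (Suc k) \<le> cmod (?d m)"
      using ev lam0_simple
    proof eventually_elim
      case (elim m)
      then show ?case using no by (meson not_le)
    qed
    moreover have "1 / real (Suc k) > 0" by simp
    ultimately show False using neg by blast
  qed
  then obtain mm where mm: "\<And>k. cmod (?d (mm k)) < 1 / real (Suc k)"
    "\<And>k j. j \<noteq> mm k \<Longrightarrow> 2 * \<delta> < cmod (lam0 j - lam0 (mm k))" "\<And>k. card {j. lam0 j = lam0 (mm k)} = 1"
    by metis
  obtain h c where h: "c > 0" "\<And>\<mu>. h \<le> \<bar>Im \<mu>\<bar> \<Longrightarrow> c \<le> cmod (Delta0 n l \<beta> C D \<mu>)"
    using regular_lower[OF regular] by blast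
  show False
  \<comment> \<open>The point \<open>Complex 0 (\<bar>h\<bar> + hh)\<close> lifts every zero, whose
    imaginary part is at least \<open>- hh\<close>, to height at least \<open>\<bar>h\<bar>\<close>,
    where \<open>Delta0\<close> is bounded below.\<close>
  proof (rule deriv_lower_bound_normal_family[of "\<lambda>k z. Delta0 n l \<beta> C D (lam0 (mm k) + z)" "2 * \<delta>" c "Complex 0 (\<bar>h\<bar> + hh)"])
    show "(\<lambda>z. Delta0 n l \<beta> C D (lam0 (mm k) + z)) holomorphic_on UNIV" for k
      using holomorphic_on_compose[of "\<lambda>z. lam0 (mm k) + z" UNIV "Delta0 n l \<beta> C D"] holomorphic_on_subset[OF Delta0_entire]
      by (simp add: o_def holomorphic_on_add)
    show "\<exists>B. \<forall>k. \<forall>z\<in>cball 0 R. cmod (Delta0 n l \<beta> C D (lam0 (mm k) + z)) \<le> B" for R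
    proof -
      obtain B where B: "\<And>\<mu>. \<bar>Im \<mu>\<bar> \<le> hh + R \<Longrightarrow> cmod (Delta0 n l \<beta> C D \<mu>) \<le> B"
        using Delta0_bounded_strip[of "hh + R"] by blast
      have "\<bar>Im (lam0 (mm k) + z)\<bar> \<le> hh + R" if "z \<in> cball 0 R" for k z
        using hh(2)[of "mm k"] abs_Im_le_cmod[of z] that by simp
      then show ?thesis using B by blast
    qed
    show "Delta0 n l \<beta> C D (lam0 (mm k) + 0) = 0" for k using Delta0_lam0 by simp
    show "?d (mm k) \<noteq> 0" for k by (rule Delta0_deriv_nonzero[OF mm(3)])
    show "Delta0 n l \<beta> C D (lam0 (mm k) + z) \<noteq> 0" if "z \<noteq> 0" "cmod z < 2 * \<delta>" for k z
    proof
      assume 0: "Delta0 n l \<beta> C D (lam0 (mm k) + z) = 0"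
      let ?w = "lam0 (mm k) + z"
      interpret Z: dirac_bc n l \<beta> "\<lambda>j k x. 0" C D by (rule dirac_bc_zero)
      have en: "enumerates_zeros (DeltaQ n l \<beta> (\<lambda>j k x. 0) C D) lam0" using lam0_zeros by (simp add: DeltaQ_zero_Q)
      have "fps_nth (Z.detA ?w) 0 = 0"
        using has_fps_expansion_imp_0_eq_fps_nth_0[OF Z.DeltaQ_fps[of ?w]] 0 by (simp add: DeltaQ_zero_Q)
      then have "card {m. lam0 m = ?w} \<noteq> 0"
        using Z.enumerates_detA[OF en, of ?w] by (simp add: subdegree_eq_0_iff)
      then obtain j where j: "lam0 j = ?w" by (metis (mono_tags, lifting) card.empty Collect_empty_eq)
      then have "j \<noteq> mm k" using that(1) by auto
      from mm(2)[OF this] show False using j that(2) by simp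
    qed
    show "c \<le> cmod (Delta0 n l \<beta> C D (lam0 (mm k) + Complex 0 (\<bar>h\<bar> + hh)))" for k
      using hh(2)[of "mm k"] abs_ge_self[of h] by (intro h(2)) auto
    show "(\<lambda>k. ?d (mm k)) \<longlonglongrightarrow> 0"
      by (rule Lim_null_comparison[OF _ lim_1_over_n[THEN LIMSEQ_Suc]])
         (use mm(1) in \<open>auto intro!: always_eventually less_imp_le simp del: of_nat_Suc\<close>)
  qed (use d h in auto)
qed

text \<open>By Jacobi's formula the derivative of \<open>Delta0\<close> is a combination of adjugate
  entries whose coefficients have moduli summing to at most \<open>W\<close>. If all entries were at
  most \<open>c / (W + 1)\<close>, the derivative would fall below \<open>c\<close>.\<close>

lemma adj_lower: "\<exists>c>0. \<forall>\<^sub>F m in cofinite. \<exists>p<n. \<exists>k<n. c \<le> cmod (adj_mat (A0mat n l \<beta> C D (lam0 m)) $$ (k, p))"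
proof -
  obtain c where c: "c > 0" and ev: "\<forall>\<^sub>F m in cofinite. c \<le> cmod (deriv (\<lambda>z. Delta0 n l \<beta> C D (lam0 m + z)) 0)"
    using Delta0_deriv_lower by blast
  define a' where "a' i k z = D $$ (i,k) * (exp (\<i> * z * complex_of_real (rho \<beta> k l)) * (\<i> * complex_of_real (rho \<beta> k l)))" for i k z
  define W where "W = (\<Sum>i<n. \<Sum>k<n. cmod (D $$ (i,k)) * (exp (hh * Bl) * Bl))"
  have dD: "deriv (\<lambda>z. Delta0 n l \<beta> C D (\<mu> + z)) 0 = (\<Sum>i<n. \<Sum>k<n. a' i k \<mu> * cofactor (A0mat n l \<beta> C D \<mu>) i k)" for \<mu>
  proof -
    have "((\<lambda>z. Determinant.det (A0mat n l \<beta> C D z)) has_field_derivative (\<Sum>i<n. \<Sum>k<n. a' i k \<mu> * cofactor (A0mat n l \<beta> C D \<mu>) i k)) (at \<mu>)"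
      by (rule det_has_field_derivative[OF A0mat_carrier A0mat_entry]) (auto simp: a'_def intro!: derivative_eq_intros)
    then have "deriv (Delta0 n l \<beta> C D) \<mu> = (\<Sum>i<n. \<Sum>k<n. a' i k \<mu> * cofactor (A0mat n l \<beta> C D \<mu>) i k)"
      using DERIV_imp_deriv unfolding Delta0_def[abs_def] by blast
    then show ?thesis using deriv_shift_0[of "Delta0 n l \<beta> C D" \<mu>] by (simp add: o_def)
  qed
  have W0: "0 \<le> W" unfolding W_def using Bl_nonneg by (intro sum_nonneg) auto
  define e where "e = c / (W + 1)"
  have e: "e > 0" using c W0 by (simp add: e_def)
  have "\<forall>\<^sub>F m in cofinite. \<exists>p<n. \<exists>k<n. e \<le> cmod (adj_mat (A0mat n l \<beta> C D (lam0 m)) $$ (k, p))"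
    using ev
  proof eventually_elim
    case (elim m)
    show ?case
    proof (rule ccontr)
      assume "\<not> ?case"
      then have sm: "cmod (adj_mat (A0mat n l \<beta> C D (lam0 m)) $$ (k, i)) \<le> e" if "i < n" "k < n" for i k
        using that by (meson less_imp_le not_le)
      have adj: "adj_mat (A0mat n l \<beta> C D (lam0 m)) $$ (k, i) = cofactor (A0mat n l \<beta> C D (lam0 m)) i k" if "i < n" "k < n" for i k
        using that A0mat_carrier[of "lam0 m"] by (simp add: adj_mat_def)
      have "c \<le> cmod (\<Sum>i<n. \<Sum>k<n. a' i k (lam0 m) * cofactor (A0mat n l \<beta> C D (lam0 m)) i k)"
        using elim unfolding dD .
      also have "\<dots> \<le> (\<Sum>i<n. \<Sum>k<n. (cmod (D $$ (i,k)) * (exp (hh * Bl) * Bl)) * e)"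
      proof (intro sum_norm_le)
        fix i k assume ik: "i \<in> {..<n}" "k \<in> {..<n}"
        have "cmod (a' i k (lam0 m)) \<le> cmod (D $$ (i,k)) * (exp (hh * Bl) * Bl)"
          unfolding a'_def norm_mult using ik exp_rho_bound(1)[of l k m] rho_bound[of k l] l_pos
          by (intro mult_left_mono mult_mono) auto
        then show "cmod (a' i k (lam0 m) * cofactor (A0mat n l \<beta> C D (lam0 m)) i k) \<le> (cmod (D $$ (i,k)) * (exp (hh * Bl) * Bl)) * e"
          unfolding norm_mult using sm[of i k] adj[of i k] ik Bl_nonneg by (intro mult_mono) auto
      qed
      also have "\<dots> = W * e" by (simp add: W_def sum_distrib_right)
      also have "\<dots> < c" using c W0 by (simp add: e_def field_simps)
      finally show False by simp
    qed
  qed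
  with e show ?thesis by blast
qed

end

section \<open>Columns of the adjugate as eigenvectors\<close>

context dirac_bc
begin

text \<open>The product of A with its adjugate is det A times the identity, hence 0 at a zero of the
  determinant; so the columns of the adjugate are coefficient vectors satisfying the boundary
  conditions. The result is an eigenvector or 0, which is a chain of length 1.\<close>

lemma root_vec_Yvec:
  assumes z: "DeltaQ n l \<beta> Q C D \<mu> = 0" and p: "p < n"
  shows "root_vec n l \<beta> Q C D \<mu> (\<lambda>x j. a * Yvec n l \<beta> Q C D p \<mu> x j)"
proof -
  let ?A = "Amat n l \<beta> Q C D \<mu>"
  let ?y = "\<lambda>x j. \<Sum>k\<in>{..<n}. (a * adj_mat ?A $$ (k,p)) * fund n l \<beta> Q \<mu> x j k"
  have y: "(\<lambda>x j. a * Yvec n l \<beta> Q C D p \<mu> x j) = ?y"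
    by (intro ext) (simp add: Yvec_def sum_distrib_left mult.assoc)
  have "ac_solves n l \<beta> Q ?y (\<lambda>x j. \<Sum>k\<in>{..<n}. (a * adj_mat ?A $$ (k,p)) * (\<mu> * fund n l \<beta> Q \<mu> x j k))"
    by (rule ac_solves_sum) (auto intro: fund_ac)
  then have ac: "ac_solves n l \<beta> Q ?y (\<lambda>x j. \<mu> * ?y x j + 0)"
    by (rule ac_solves_cong) (auto simp: sum_distrib_left mult_ac)
  have U: "Ubc ?y i = 0" if i: "i < n" for i
  proof -
    have y0: "?y 0 k = a * adj_mat ?A $$ (k,p)" if "k < n" for k
    proof -
      have "?y 0 k = (\<Sum>m<n. if k = m then a * adj_mat ?A $$ (k,p) else 0)"
        by (intro sum.cong) (use that in \<open>auto simp: fund_at_0\<close>)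
      then show ?thesis using that by simp
    qed
    have "(\<Sum>k<n. D $$ (i,k) * ?y l k) = (\<Sum>m<n. (\<Sum>k<n. D $$ (i,k) * fund n l \<beta> Q \<mu> l k m) * (a * adj_mat ?A $$ (m,p)))"
      unfolding sum_distrib_left sum_distrib_right by (subst sum.swap) (simp add: mult_ac)
    moreover have "(\<Sum>k<n. C $$ (i,k) * ?y 0 k) = (\<Sum>m<n. C $$ (i,m) * (a * adj_mat ?A $$ (m,p)))"
      by (intro sum.cong) (auto simp: y0)
    ultimately have "Ubc ?y i = (\<Sum>m<n. ?A $$ (i,m) * (a * adj_mat ?A $$ (m,p)))"
      unfolding Ubc_def sum.distrib by (simp add: Amat_entry[OF i] distrib_right sum.distrib)
    also have "\<dots> = a * (?A * adj_mat ?A) $$ (i,p)"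
      using i p Amat_carrier[of \<mu>] adj_mat(1)[OF Amat_carrier[of \<mu>]]
      by (simp add: scalar_prod_def lessThan_atLeast0 sum_distrib_left mult_ac)
    also have "\<dots> = 0"
      unfolding adj_mat(2)[OF Amat_carrier[of \<mu>]] using z i p by (simp add: DeltaQ_def)
    finally show ?thesis .
  qed
  have op: "op_LU n l \<beta> Q C D ?y (\<lambda>x j. \<mu> * ?y x j + 0)"
    by (rule op_LU_I[OF ac cont_zero U])
  show ?thesis
    unfolding root_vec_def y
  proof (intro exI[of _ 1] conjI exI[of _ "\<lambda>i. if i = 0 then ?y else (\<lambda>x j. 0)"] allI impI)
    fix i :: nat assume "i < 1"
    then show "\<exists>g. op_LU n l \<beta> Q C D (if i = 0 then ?y else (\<lambda>x j. 0)) g \<and>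
       H_eq n l (if Suc i = 0 then ?y else (\<lambda>x j. 0)) (\<lambda>x j. g x j - \<mu> * (if i = 0 then ?y else (\<lambda>x j. 0)) x j)"
      using op by (intro exI[of _ "\<lambda>x j. \<mu> * ?y x j + 0"]) (simp add: H_eq_def)
  qed (auto simp: H_eq_def)
qed

end

section \<open>Bounds for the unperturbed eigenfunctions\<close>

context bvp
begin

lemma Y0vec_component:
  assumes "j < n"
  shows "Y0vec n l \<beta> C D p \<mu> x j = adj_mat (A0mat n l \<beta> C D \<mu>) $$ (j,p) * exp (\<i> * \<mu> * complex_of_real (rho \<beta> j x))"
proof -
  have "Y0vec n l \<beta> C D p \<mu> x j = (\<Sum>k<n. if j = k then adj_mat (A0mat n l \<beta> C D \<mu>) $$ (j,p) * exp (\<i> * \<mu> * complex_of_real (rho \<beta> j x)) else 0)"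
    unfolding Y0vec_def by (intro sum.cong) (auto simp: fund0_def)
  then show ?thesis using assms by simp
qed

text \<open>The adjugate entries are bounded along the zeros as part of \<open>near\<close>, and the
  exponentials are bounded in the strip.\<close>

lemma Y0_bounded: "\<exists>P>0. \<forall>\<^sub>F m in cofinite. \<forall>p<n. \<forall>j<n. \<forall>x\<in>{0..l}. cmod (Y0vec n l \<beta> C D p (lam0 m) x j) \<le> P"
proof -
  have "\<forall>j\<in>{..<n}. \<forall>p\<in>{..<n}. \<exists>B. \<forall>\<^sub>F m in cofinite. cmod (adj_mat (A0mat n l \<beta> C D (lam0 m)) $$ (j,p)) \<le> B"
    using adj_near unfolding near_def Bfun_def by blast
  then obtain B where B: "\<And>j p. j < n \<Longrightarrow> p < n \<Longrightarrow> \<forall>\<^sub>F m in cofinite. cmod (adj_mat (A0mat n l \<beta> C D (lam0 m)) $$ (j,p)) \<le> B j p"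
    by (metis lessThan_iff)
  define P where "P = (\<Sum>j<n. \<Sum>p<n. \<bar>B j p\<bar>) * exp (hh * Bl) + 1"
  have BP: "\<bar>B j p\<bar> * exp (hh * Bl) \<le> P" if "j < n" "p < n" for j p
  proof -
    have "\<bar>B j p\<bar> \<le> (\<Sum>p<n. \<bar>B j p\<bar>)" by (rule member_le_sum) (use that in auto)
    also have "\<dots> \<le> (\<Sum>j<n. \<Sum>p<n. \<bar>B j p\<bar>)"
      by (rule member_le_sum[where f = "\<lambda>j. \<Sum>p<n. \<bar>B j p\<bar>"]) (use that in \<open>auto intro!: sum_nonneg\<close>)
    finally have "\<bar>B j p\<bar> * exp (hh * Bl) \<le> (\<Sum>j<n. \<Sum>p<n. \<bar>B j p\<bar>) * exp (hh * Bl)" by (intro mult_right_mono) auto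
    then show ?thesis unfolding P_def by linarith
  qed
  have "P > 0" unfolding P_def by (intro add_nonneg_pos mult_nonneg_nonneg sum_nonneg) auto
  moreover have "\<forall>\<^sub>F m in cofinite. \<forall>j\<in>{..<n}. \<forall>p\<in>{..<n}. cmod (adj_mat (A0mat n l \<beta> C D (lam0 m)) $$ (j,p)) \<le> B j p"
    by (rule eventually_ball_finite, simp, rule ballI, rule eventually_ball_finite, simp, rule ballI, rule B) auto
  then have "\<forall>\<^sub>F m in cofinite. \<forall>p<n. \<forall>j<n. \<forall>x\<in>{0..l}. cmod (Y0vec n l \<beta> C D p (lam0 m) x j) \<le> P"
  proof eventually_elim
    case (elim m)
    show ?case
    proof (intro allI impI ballI)
      fix p j x assume pj: "p < n" "j < n" and x: "x \<in> {0..l}"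
      have "cmod (Y0vec n l \<beta> C D p (lam0 m) x j) \<le> \<bar>B j p\<bar> * exp (hh * Bl)"
        unfolding Y0vec_component[OF pj(2)] norm_mult using elim pj exp_rho_bound(1)[OF x pj(2)]
        by (intro mult_mono) (auto intro: order_trans[OF _ abs_ge_self])
      also have "\<dots> \<le> P" by (rule BP[OF pj(2,1)])
      finally show "cmod (Y0vec n l \<beta> C D p (lam0 m) x j) \<le> P" .
    qed
  qed
  ultimately show ?thesis by blast
qed

lemma beta_integral_lower: "\<exists>b>0. \<forall>k<n. b \<le> integral {0..l} (\<lambda>t. \<bar>\<beta> k t\<bar>)"
proof (cases "n = 0")
  case False
  let ?S = "(\<lambda>k. integral {0..l} (\<lambda>t. \<bar>\<beta> k t\<bar>)) ` {..<n}"
  have "finite ?S" "?S \<noteq> {}" using False by auto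
  moreover have "\<forall>s\<in>?S. 0 < s" using beta_abs_integral_pos(1)[of _ 0 l] l_pos by auto
  ultimately show ?thesis by (intro exI[of _ "Min ?S"]) (auto simp: Min_gr_iff)
qed (auto intro: exI[of _ 1])

end

section \<open>Comparison of the normalized root systems\<close>

context strict_bvp
begin

text \<open>One large entry \<open>(k, p)\<close> of the adjugate makes component \<open>k\<close>
  of \<open>Y0vec\<close> large at every \<open>x\<close>, because that component is the entry times
  an exponential bounded away from 0 in the strip.\<close>

lemma Y0_norm_lower:
  "\<exists>c>0. \<forall>\<^sub>F m in cofinite. \<exists>p<n. c \<le> H_norm n l \<beta> (Y0vec n l \<beta> C D p (lam0 m))"
proof -
  obtain c where c: "c > 0" and ev: "\<forall>\<^sub>F m in cofinite. \<exists>p<n. \<exists>k<n. c \<le> cmod (adj_mat (A0mat n l \<beta> C D (lam0 m)) $$ (k, p))"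
    using adj_lower by blast
  obtain b where b: "b > 0" "\<And>k. k < n \<Longrightarrow> b \<le> integral {0..l} (\<lambda>t. \<bar>\<beta> k t\<bar>)" using beta_integral_lower by blast
  define q where "q = c * exp (- (hh * Bl))"
  have q: "q > 0" using c by (simp add: q_def)
  have "\<forall>\<^sub>F m in cofinite. \<exists>p<n. sqrt (q\<^sup>2 * b) \<le> H_norm n l \<beta> (Y0vec n l \<beta> C D p (lam0 m))"
    using ev
  proof eventually_elim
    case (elim m)
    then obtain p k where pk: "p < n" "k < n" "c \<le> cmod (adj_mat (A0mat n l \<beta> C D (lam0 m)) $$ (k, p))" by blast
    have low: "q \<le> cmod (Y0vec n l \<beta> C D p (lam0 m) x k)" if "x \<in> {0..l}" for x
      unfolding Y0vec_component[OF pk(2)] norm_mult q_def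
      using pk(3) exp_rho_bound(2)[OF that pk(2)] c by (intro mult_mono) auto
    have "q\<^sup>2 * b \<le> q\<^sup>2 * integral {0..l} (\<lambda>t. \<bar>\<beta> k t\<bar>)" using b(2)[OF pk(2)] by (intro mult_left_mono) auto
    also have "\<dots> \<le> Hsq (Y0vec n l \<beta> C D p (lam0 m))"
      by (rule Hsq_lower[OF Y0vec_cont pk(2)]) (use low q l_pos in auto)
    finally show ?case unfolding H_norm_Hsq using pk(1) by (intro exI[of _ p]) simp
  qed
  moreover have "sqrt (q\<^sup>2 * b) > 0" using q b by simp
  ultimately show ?thesis by blast
qed

text \<open>Both families use the same column \<open>p m\<close>, chosen so that the unperturbed
  norm is at least \<open>c\<close>. The perturbed norm is then at least \<open>c / 2\<close>, and
  dividing by the two norms keeps the uniform convergence. Outside the cofinite set \<open>S\<close>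
  the vectors come from arbitrary normalized bases.\<close>

lemma root_systems:
  "\<exists>f f0 :: int \<Rightarrow> real \<Rightarrow> nat \<Rightarrow> complex.
           normalized_root_system n l \<beta> Q C D lam f \<and>
           normalized_root_system n l \<beta> (\<lambda>j k x. 0) C D lam0 f0 \<and>
           (\<forall>\<epsilon>>0. \<forall>\<^sub>F m in cofinite. \<forall>x\<in>{0..l}. cnorm n (\<lambda>j. f m x j - f0 m x j) < \<epsilon>) \<and>
           (\<forall>\<^sub>F m in cofinite.
              card {k. lam k = lam m} = 1 \<and> card {k. lam0 k = lam0 m} = 1 \<and>
              (\<exists>\<alpha> \<alpha>0 p. \<alpha> \<noteq> 0 \<and> \<alpha>0 \<noteq> 0 \<and> p < n \<and>
                 (\<forall>x\<in>{0..l}. \<forall>j<n.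
                    f m x j = \<alpha> * Yvec n l \<beta> Q C D p (lam m) x j \<and>
                    f0 m x j = \<alpha>0 * Y0vec n l \<beta> C D p (lam0 m) x j)))"
proof -
  interpret Z: dirac_bc n l \<beta> "\<lambda>j k x. 0" C D by (rule dirac_bc_zero)
  obtain c where c: "c > 0" and evc: "\<forall>\<^sub>F m in cofinite. \<exists>p<n. c \<le> H_norm n l \<beta> (Y0vec n l \<beta> C D p (lam0 m))"
    using Y0_norm_lower by blast
  obtain P where P: "P > 0" and evP: "\<forall>\<^sub>F m in cofinite. \<forall>p<n. \<forall>j<n. \<forall>x\<in>{0..l}. cmod (Y0vec n l \<beta> C D p (lam0 m) x j) \<le> P"
    using Y0_bounded by blast
  define Y where "Y p m = Yvec n l \<beta> Q C D p (lam m)" for p m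
  define Y0 where "Y0 p m = Y0vec n l \<beta> C D p (lam0 m)" for p m
  have Yc: "cont (Y p m)" and Y0c: "cont (Y0 p m)" for p m
    unfolding Y_def Y0_def by (rule Yvec_cont, rule Y0vec_cont)
  define good where "good d m \<longleftrightarrow> (\<forall>p<n. \<forall>j<n. \<forall>x\<in>{0..l}. cmod (Y p m x j - Y0 p m x j) < d)" for d m
  have evgood: "\<forall>\<^sub>F m in cofinite. good d m" if "d > 0" for d
    using Y_uniform_all[OF that] by (simp add: good_def Y_def Y0_def)
  define PP where "PP m \<longleftrightarrow> (\<forall>p<n. \<forall>j<n. \<forall>x\<in>{0..l}. cmod (Y0 p m x j) \<le> P)" for m
  have evPP: "\<forall>\<^sub>F m in cofinite. PP m" using evP by (simp add: PP_def Y0_def)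
  have diff: "\<bar>Hsq (Y p m) - Hsq (Y0 p m)\<bar> \<le> 2 * (P + 1) * d * Bl" if "good d m" "d \<le> 1" "PP m" "p < n" for d m p
  proof (rule Hsq_diff[OF Yc Y0c])
    fix x j assume xj: "x \<in> {0..l}" "j < n"
    show 1: "cmod (Y p m x j - Y0 p m x j) \<le> d" using that xj by (simp add: good_def less_imp_le)
    have 2: "cmod (Y0 p m x j) \<le> P" using that xj by (simp add: PP_def)
    then show "cmod (Y0 p m x j) \<le> P + 1" by simp
    show "cmod (Y p m x j) \<le> P + 1"
      using 1 2 that(2) norm_triangle_ineq2[of "Y p m x j" "Y0 p m x j"] by linarith
  qed
  define K where "K = 2 * (P + 1) * (Bl + 1)"
  have K: "K > 0" using P Bl_nonneg by (simp add: K_def)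
  have diffK: "\<bar>Hsq (Y p m) - Hsq (Y0 p m)\<bar> \<le> K * d" if "good d m" "0 < d" "d \<le> 1" "PP m" "p < n" for d m p
  proof -
    have "2 * (P + 1) * d * Bl \<le> K * d" using that P Bl_nonneg by (simp add: K_def)
    then show ?thesis using diff[of d m p] that by linarith
  qed
  \<comment> \<open>With this closeness the squared norms differ by at most three quarters of the
    square of \<open>c\<close>, which leaves one quarter for the perturbed one.\<close>
  define d1 where "d1 = min 1 (3 / 4 * c\<^sup>2 / K)"
  have d1: "d1 > 0" "d1 \<le> 1" "K * d1 \<le> 3 / 4 * c\<^sup>2"
  proof -
    show "d1 > 0" "d1 \<le> 1" using c K by (auto simp: d1_def)
    have "K * d1 \<le> K * (3 / 4 * c\<^sup>2 / K)" using K by (intro mult_left_mono) (auto simp: d1_def)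
    then show "K * d1 \<le> 3 / 4 * c\<^sup>2" using K by simp
  qed
  define S where "S = {m. card {k. lam k = lam m} = 1 \<and> card {k. lam0 k = lam0 m} = 1 \<and> PP m \<and> good d1 m \<and>
     (\<exists>p<n. c \<le> H_norm n l \<beta> (Y0 p m))}"
  have evS: "\<forall>\<^sub>F m in cofinite. m \<in> S"
    using lam_simple lam0_simple evPP evgood[OF d1(1)] evc unfolding S_def Y0_def
    by eventually_elim simp
  define p where "p m = (SOME p. p < n \<and> c \<le> H_norm n l \<beta> (Y0 p m))" for m
  have p: "p m < n" "c \<le> H_norm n l \<beta> (Y0 (p m) m)" if "m \<in> S" for m
  proof -
    have "\<exists>p. p < n \<and> c \<le> H_norm n l \<beta> (Y0 p m)" using that by (auto simp: S_def)
    from someI_ex[OF this] show "p m < n" "c \<le> H_norm n l \<beta> (Y0 (p m) m)" by (auto simp: p_def)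
  qed
  define N N0 where "N m = H_norm n l \<beta> (Y (p m) m)" and "N0 m = H_norm n l \<beta> (Y0 (p m) m)" for m
  have sqN: "(N m)\<^sup>2 = Hsq (Y (p m) m)" "(N0 m)\<^sup>2 = Hsq (Y0 (p m) m)" for m
    using Hsq_nonneg[OF Yc] Hsq_nonneg[OF Y0c] by (auto simp: N_def N0_def H_norm_Hsq)
  have N0c: "c \<le> N0 m" if "m \<in> S" for m using p(2)[OF that] by (simp add: N0_def)
  have Nc: "c / 2 \<le> N m" if m: "m \<in> S" for m
  proof -
    have "\<bar>(N m)\<^sup>2 - (N0 m)\<^sup>2\<bar> \<le> K * d1"
      unfolding sqN using m p(1)[OF m] d1 by (intro diffK) (auto simp: S_def)
    moreover have "c\<^sup>2 \<le> (N0 m)\<^sup>2" using N0c[OF m] c by (intro power_mono) auto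
    ultimately have "(c / 2)\<^sup>2 \<le> (N m)\<^sup>2" using d1(3) by (simp add: power_divide abs_le_iff)
    moreover have "0 \<le> N m" using Hsq_nonneg[OF Yc] by (simp add: N_def H_norm_Hsq)
    ultimately show ?thesis by (rule power2_le_imp_le)
  qed
  define g where "g m = (\<lambda>x j. complex_of_real (1 / N m) * Y (p m) m x j)" for m
  \<comment> \<open>Written with the solution for \<open>Q = 0\<close>, the form in which the
    interpretation \<open>Z\<close> yields a root vector; on \<open>{0..l}\<close> it is a multiple
    of \<open>Y0\<close>.\<close>
  define g0 where "g0 m = (\<lambda>x j. complex_of_real (1 / N0 m) * Yvec n l \<beta> (\<lambda>j k x. 0) C D (p m) (lam0 m) x j)" for m
  have g0Y: "g0 m x j = complex_of_real (1 / N0 m) * Y0 (p m) m x j" if "x \<in> {0..l}" "j < n" for m x j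
    using Yvec_zero_Q[OF that] by (simp add: g0_def Y0_def)
  have posN: "N m > 0" "N0 m > 0" if "m \<in> S" for m using Nc[OF that] N0c[OF that] c by auto
  have "\<exists>f. normalized_root_system n l \<beta> Q C D lam f \<and> (\<forall>m\<in>S. f m = g m)"
  proof (rule root_system_exists[OF lam_zeros])
    fix m assume m: "m \<in> S"
    show "card {k. lam k = lam m} = 1" using m by (simp add: S_def)
    show "root_vec n l \<beta> Q C D (lam m) (g m)"
      unfolding g_def Y_def by (rule root_vec_Yvec[OF DeltaQ_lam p(1)[OF m]])
    show "H_norm n l \<beta> (g m) = 1"
      unfolding g_def H_norm_scale using posN(1)[OF m] by (simp add: N_def norm_divide)
  qed
  then obtain f where f: "normalized_root_system n l \<beta> Q C D lam f" "\<And>m. m \<in> S \<Longrightarrow> f m = g m" by blast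
  have en0: "enumerates_zeros (DeltaQ n l \<beta> (\<lambda>j k x. 0) C D) lam0" using lam0_zeros by (simp add: DeltaQ_zero_Q)
  have "\<exists>f. normalized_root_system n l \<beta> (\<lambda>j k x. 0) C D lam0 f \<and> (\<forall>m\<in>S. f m = g0 m)"
  proof (rule Z.root_system_exists[OF en0])
    fix m assume m: "m \<in> S"
    show "card {k. lam0 k = lam0 m} = 1" using m by (simp add: S_def)
    show "root_vec n l \<beta> (\<lambda>j k x. 0) C D (lam0 m) (g0 m)"
      unfolding g0_def by (rule Z.root_vec_Yvec[OF _ p(1)[OF m]]) (simp add: DeltaQ_zero_Q Delta0_lam0)
    have "Hsq (g0 m) = Hsq (\<lambda>x j. complex_of_real (1 / N0 m) * Y0 (p m) m x j)"
      by (rule Hsq_cong) (rule g0Y)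
    then have "H_norm n l \<beta> (g0 m) = H_norm n l \<beta> (\<lambda>x j. complex_of_real (1 / N0 m) * Y0 (p m) m x j)"
      by (simp only: H_norm_Hsq)
    then show "H_norm n l \<beta> (g0 m) = 1"
      unfolding H_norm_scale using posN(2)[OF m] by (simp add: N0_def norm_divide)
  qed
  then obtain f0 where f0: "normalized_root_system n l \<beta> (\<lambda>j k x. 0) C D lam0 f0" "\<And>m. m \<in> S \<Longrightarrow> f0 m = g0 m" by blast
  have est: "cmod (g m x j - g0 m x j) \<le> (2 / c + P * K * 2 / c ^ 3) * d"
    if m: "m \<in> S" and d: "good d m" "0 < d" "d \<le> 1" and xj: "x \<in> {0..l}" "j < n" for m d x j
  proof -
    let ?a = "1 / N m" and ?b = "1 / N0 m"
    have "g m x j - g0 m x j = complex_of_real ?a * (Y (p m) m x j - Y0 (p m) m x j) + complex_of_real (?a - ?b) * Y0 (p m) m x j"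
    proof -
      have "u * y - v * z = u * (y - z) + (u - v) * z" for u v y z :: complex
        by (simp add: algebra_simps)
      then show ?thesis unfolding g_def g0Y[OF xj] of_real_diff .
    qed
    then have "cmod (g m x j - g0 m x j) \<le> cmod (complex_of_real ?a * (Y (p m) m x j - Y0 (p m) m x j)) + cmod (complex_of_real (?a - ?b) * Y0 (p m) m x j)"
      by (simp only:) (rule norm_triangle_ineq)
    also have "\<dots> = \<bar>?a\<bar> * cmod (Y (p m) m x j - Y0 (p m) m x j) + \<bar>?a - ?b\<bar> * cmod (Y0 (p m) m x j)"
      by (simp only: norm_mult norm_of_real)
    also have "\<dots> \<le> 2 / c * d + (K * d * 2 / c ^ 3) * P"
    proof (rule add_mono)
      have a: "\<bar>?a\<bar> \<le> 2 / c" using Nc[OF m] posN(1)[OF m] c by (simp add: field_simps)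
      show "\<bar>?a\<bar> * cmod (Y (p m) m x j - Y0 (p m) m x j) \<le> 2 / c * d"
        using a d(1) p(1)[OF m] xj c by (intro mult_mono) (auto simp: good_def less_imp_le)
      \<comment> \<open>The difference of the norms is obtained from that of their squares by
        dividing by \<open>N0 m + N m\<close>, which is at least \<open>c\<close>.\<close>
      have "\<bar>N0 m - N m\<bar> * c \<le> \<bar>N0 m - N m\<bar> * (N0 m + N m)"
        using N0c[OF m] posN(1)[OF m] by (intro mult_left_mono) auto
      also have "\<dots> = \<bar>(N m)\<^sup>2 - (N0 m)\<^sup>2\<bar>"
      proof -
        have "(N m)\<^sup>2 - (N0 m)\<^sup>2 = - ((N0 m - N m) * (N0 m + N m))" by (simp add: power2_eq_square algebra_simps)
        then show ?thesis using posN[OF m] by (simp add: abs_mult)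
      qed
      also have "\<dots> \<le> K * d"
        unfolding sqN using m p(1)[OF m] d by (intro diffK) (auto simp: S_def)
      finally have dN: "\<bar>N0 m - N m\<bar> \<le> K * d / c" using c by (simp add: field_simps)
      have NN: "c / 2 * c \<le> N m * N0 m" using Nc[OF m] N0c[OF m] c by (intro mult_mono) auto
      have "\<bar>?a - ?b\<bar> = \<bar>N0 m - N m\<bar> / (N m * N0 m)"
        using posN[OF m] by (simp add: diff_frac_eq abs_mult)
      also have "\<dots> \<le> (K * d / c) / (c / 2 * c)"
        using dN NN c K d(2) by (intro frac_le) auto
      also have "\<dots> = K * d * 2 / c ^ 3" using c by (simp add: field_simps power3_eq_cube)
      finally have "\<bar>?a - ?b\<bar> \<le> K * d * 2 / c ^ 3" .
      moreover have "cmod (Y0 (p m) m x j) \<le> P" using m p(1)[OF m] xj by (simp add: S_def PP_def)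
      ultimately show "\<bar>?a - ?b\<bar> * cmod (Y0 (p m) m x j) \<le> (K * d * 2 / c ^ 3) * P"
        using K d c by (intro mult_mono) auto
    qed
    also have "\<dots> = (2 / c + P * K * 2 / c ^ 3) * d" by (simp add: algebra_simps)
    finally show ?thesis .
  qed
  define L where "L = 2 / c + P * K * 2 / c ^ 3"
  have L: "L > 0" unfolding L_def using c P K by (intro add_pos_pos) auto
  have conv: "\<forall>\<^sub>F m in cofinite. \<forall>x\<in>{0..l}. cmod (f m x j - f0 m x j) < \<epsilon>" if j: "j < n" and e: "\<epsilon> > 0" for j \<epsilon>
  proof -
    define d where "d = min 1 (\<epsilon> / (2 * L))"
    have d: "0 < d" "d \<le> 1" using e L by (auto simp: d_def)
    have "L * d \<le> L * (\<epsilon> / (2 * L))" using L by (intro mult_left_mono) (auto simp: d_def)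
    then have Ld: "L * d < \<epsilon>" using e L by simp
    show ?thesis
      using evS evgood[OF d(1)]
    proof eventually_elim
      case (elim m)
      show ?case
      proof
        fix x assume x: "x \<in> {0..l}"
        have "cmod (f m x j - f0 m x j) \<le> L * d"
          using est[OF elim(1) elim(2) d x j] f(2)[OF elim(1)] f0(2)[OF elim(1)] by (simp add: L_def)
        then show "cmod (f m x j - f0 m x j) < \<epsilon>" using Ld by simp
      qed
    qed
  qed
  have fin: "\<forall>\<^sub>F m in cofinite.
              card {k. lam k = lam m} = 1 \<and> card {k. lam0 k = lam0 m} = 1 \<and>
              (\<exists>\<alpha> \<alpha>0 p. \<alpha> \<noteq> 0 \<and> \<alpha>0 \<noteq> 0 \<and> p < n \<and>
                 (\<forall>x\<in>{0..l}. \<forall>j<n.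
                    f m x j = \<alpha> * Yvec n l \<beta> Q C D p (lam m) x j \<and>
                    f0 m x j = \<alpha>0 * Y0vec n l \<beta> C D p (lam0 m) x j))"
    using evS
  proof eventually_elim
    case (elim m)
    have "\<forall>x\<in>{0..l}. \<forall>j<n. f m x j = complex_of_real (1 / N m) * Yvec n l \<beta> Q C D (p m) (lam m) x j \<and>
       f0 m x j = complex_of_real (1 / N0 m) * Y0vec n l \<beta> C D (p m) (lam0 m) x j"
      using f(2)[OF elim] f0(2)[OF elim] g0Y by (auto simp: g_def Y_def Y0_def)
    moreover have "complex_of_real (1 / N m) \<noteq> 0" "complex_of_real (1 / N0 m) \<noteq> 0"
      using posN[OF elim] by auto
    ultimately show ?case using elim p(1)[OF elim] unfolding S_def by blast
  qed
  have "\<forall>\<^sub>F m in cofinite. \<forall>x\<in>{0..l}. cnorm n (\<lambda>j. f m x j - f0 m x j) < \<epsilon>" if "\<epsilon> > 0" for \<epsilon>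
    using conv that by (intro components_imp_cnorm[where f = "\<lambda>m x j. f m x j - f0 m x j"])
  then show ?thesis
    using f(1) f0(1) fin by (intro exI[of _ f] exI[of _ f0] conjI allI impI)
qed

end

text \<open>The hypothesis speaks of neighbours. Once a gap of \<open>\<theta>\<close> has opened,
  monotonicity preserves it; as long as there is none, equality propagates.\<close>

lemma beta_pairs:
  fixes \<beta> :: "nat \<Rightarrow> real \<Rightarrow> real"
  assumes mono: "\<forall>k. Suc k < n \<longrightarrow> (AE x in M. \<beta> k x \<le> \<beta> (Suc k) x)"
    and sep: "\<forall>k. Suc k < n \<longrightarrow> (AE x in M. \<beta> k x = \<beta> (Suc k) x) \<or> (AE x in M. \<beta> k x + \<theta> < \<beta> (Suc k) x)"
    and jk: "j \<le> k" "k < n"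
  shows "(AE x in M. \<beta> j x = \<beta> k x) \<or> (AE x in M. \<beta> j x + \<theta> \<le> \<beta> k x)"
  using jk
proof (induction k rule: dec_induct)
  case (step k)
  then have IH: "(AE x in M. \<beta> j x = \<beta> k x) \<or> (AE x in M. \<beta> j x + \<theta> \<le> \<beta> k x)" by simp
  have m: "AE x in M. \<beta> k x \<le> \<beta> (Suc k) x" using mono step.prems by blast
  from sep step.prems have "(AE x in M. \<beta> k x = \<beta> (Suc k) x) \<or> (AE x in M. \<beta> k x + \<theta> < \<beta> (Suc k) x)" by blast
  with IH show ?case
  proof (elim disjE)
    assume "AE x in M. \<beta> j x = \<beta> k x" "AE x in M. \<beta> k x = \<beta> (Suc k) x"
    then have "AE x in M. \<beta> j x = \<beta> (Suc k) x" by eventually_elim simp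
    then show ?thesis ..
  next
    assume "AE x in M. \<beta> j x = \<beta> k x" "AE x in M. \<beta> k x + \<theta> < \<beta> (Suc k) x"
    then have "AE x in M. \<beta> j x + \<theta> \<le> \<beta> (Suc k) x" by eventually_elim simp
    then show ?thesis ..
  next
    assume "AE x in M. \<beta> j x + \<theta> \<le> \<beta> k x"
    with m have "AE x in M. \<beta> j x + \<theta> \<le> \<beta> (Suc k) x" by eventually_elim simp
    then show ?thesis ..
  next
    assume "AE x in M. \<beta> j x + \<theta> \<le> \<beta> k x"
    with m have "AE x in M. \<beta> j x + \<theta> \<le> \<beta> (Suc k) x" by eventually_elim simp
    then show ?thesis ..
  qed
qed simp

theorem theorem6p9:
  fixes n :: nat and l :: real and \<beta> :: "nat \<Rightarrow> real \<Rightarrow> real"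
    and Q :: "nat \<Rightarrow> nat \<Rightarrow> real \<Rightarrow> complex"
    and C D :: "complex Matrix.mat"
    and nminus :: nat and \<theta> :: real
    and lam lam0 :: "int \<Rightarrow> complex"
  assumes l_pos: "l > 0"
    and beta_meas: "\<forall>k<n. \<beta> k \<in> borel_measurable (lebesgue_on {0..l})"
    and beta_bdd: "\<forall>k<n. \<exists>M. AE x in lebesgue_on {0..l}. \<bar>\<beta> k x\<bar> \<le> M"
    and beta_inv_bdd: "\<forall>k<n. \<exists>M. AE x in lebesgue_on {0..l}. \<bar>1 / \<beta> k x\<bar> \<le> M"
    and const_sign: "\<forall>k<n. (AE x in lebesgue_on {0..l}. \<beta> k x < 0) \<or> (AE x in lebesgue_on {0..l}. \<beta> k x > 0)"
    and nminus_le: "nminus \<le> n"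
    and beta_neg: "\<forall>k<nminus. AE x in lebesgue_on {0..l}. \<beta> k x < 0"
    and beta_posi: "\<forall>k. nminus \<le> k \<and> k < n \<longrightarrow> (AE x in lebesgue_on {0..l}. \<beta> k x > 0)"
    and beta_mono: "\<forall>k. Suc k < n \<longrightarrow> (AE x in lebesgue_on {0..l}. \<beta> k x \<le> \<beta> (Suc k) x)"
    and theta_pos: "\<theta> > 0"
    and beta_sep: "\<forall>k. Suc k < n \<longrightarrow>
         (AE x in lebesgue_on {0..l}. \<beta> k x = \<beta> (Suc k) x) \<or>
         (AE x in lebesgue_on {0..l}. \<beta> k x + \<theta> < \<beta> (Suc k) x)"
    and Q_L1: "\<forall>j<n. \<forall>k<n. Q j k absolutely_integrable_on {0..l}"
    and Q_zero: "\<forall>j<n. \<forall>k<n. (AE x in lebesgue_on {0..l}. \<beta> j x = \<beta> k x) \<longrightarrow>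
                   (AE x in lebesgue_on {0..l}. Q j k x = 0)"
    and C_dim: "C \<in> carrier_mat n n" and D_dim: "D \<in> carrier_mat n n"
    and CD_rank: "vec_space.rank n (Matrix.mat n (2 * n)
                     (\<lambda>(i,j). if j < n then C $$ (i,j) else D $$ (i, j - n))) = n"
    and regular: "regular_bc n l \<beta> C D"
    and lam_zeros: "enumerates_zeros (DeltaQ n l \<beta> Q C D) lam"
    and lam0_zeros: "enumerates_zeros (Delta0 n l \<beta> C D) lam0"
    and lam_asymp: "((\<lambda>m. lam m - lam0 m) \<longlongrightarrow> 0) cofinite"
  shows
    "(\<forall>p<n.
        (\<forall>\<epsilon>>0. \<forall>\<^sub>F m in cofinite. \<forall>x\<in>{0..l}.
            cnorm n (\<lambda>j. Yvec n l \<beta> Q C D p (lam m) x j - Y0vec n l \<beta> C D p (lam0 m) x j) < \<epsilon>) \<and>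
        ((\<lambda>m. H_norm n l \<beta> (\<lambda>x j. Yvec n l \<beta> Q C D p (lam m) x j - Y0vec n l \<beta> C D p (lam0 m) x j))
            \<longlongrightarrow> 0) cofinite)
     \<and>
     (strictly_regular_bc n l \<beta> C D lam0 \<longrightarrow>
        (\<exists>f f0 :: int \<Rightarrow> real \<Rightarrow> nat \<Rightarrow> complex.
           normalized_root_system n l \<beta> Q C D lam f \<and>
           normalized_root_system n l \<beta> (\<lambda>j k x. 0) C D lam0 f0 \<and>
           (\<forall>\<epsilon>>0. \<forall>\<^sub>F m in cofinite. \<forall>x\<in>{0..l}. cnorm n (\<lambda>j. f m x j - f0 m x j) < \<epsilon>) \<and>
           (\<forall>\<^sub>F m in cofinite.
              card {k. lam k = lam m} = 1 \<and> card {k. lam0 k = lam0 m} = 1 \<and>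
              (\<exists>\<alpha> \<alpha>0 p. \<alpha> \<noteq> 0 \<and> \<alpha>0 \<noteq> 0 \<and> p < n \<and>
                 (\<forall>x\<in>{0..l}. \<forall>j<n.
                    f m x j = \<alpha> * Yvec n l \<beta> Q C D p (lam m) x j \<and>
                    f0 m x j = \<alpha>0 * Y0vec n l \<beta> C D p (lam0 m) x j)))))"
proof -
  have d: "dirac n l \<beta> Q"
    by unfold_locales (fact l_pos beta_meas beta_bdd beta_inv_bdd const_sign Q_L1)+
  \<comment> \<open>Any two weights are equal or separated by \<open>\<theta>\<close>; equal ones,
    in particular the diagonal, are covered by the vanishing of \<open>Q\<close>.\<close>
  have ds: "dirac_sep n l \<beta> Q"
  proof (intro dirac_sep.intro d dirac_sep_axioms.intro)
    fix j k assume jk: "j < n" "k < n"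
    consider "AE x in lebesgue_on {0..l}. \<beta> j x = \<beta> k x" | "AE x in lebesgue_on {0..l}. \<theta> \<le> \<bar>\<beta> j x - \<beta> k x\<bar>"
    proof (cases "j \<le> k")
      case True
      from beta_pairs[OF beta_mono beta_sep True jk(2)] show ?thesis
      proof
        assume "AE x in lebesgue_on {0..l}. \<beta> j x + \<theta> \<le> \<beta> k x"
        then have "AE x in lebesgue_on {0..l}. \<theta> \<le> \<bar>\<beta> j x - \<beta> k x\<bar>" by eventually_elim linarith
        then show ?thesis by (rule that(2))
      qed (rule that(1))
    next
      case False
      then have "k \<le> j" by simp
      from beta_pairs[OF beta_mono beta_sep this jk(1)] show ?thesis
      proof
        assume "AE x in lebesgue_on {0..l}. \<beta> k x = \<beta> j x"
        then have "AE x in lebesgue_on {0..l}. \<beta> j x = \<beta> k x" by eventually_elim simp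
        then show ?thesis by (rule that(1))
      next
        assume "AE x in lebesgue_on {0..l}. \<beta> k x + \<theta> \<le> \<beta> j x"
        then have "AE x in lebesgue_on {0..l}. \<theta> \<le> \<bar>\<beta> j x - \<beta> k x\<bar>" by eventually_elim linarith
        then show ?thesis by (rule that(2))
      qed
    qed
    then show "(AE x in lebesgue_on {0..l}. Q j k x = 0) \<or> (\<exists>\<theta>>0. AE x in lebesgue_on {0..l}. \<theta> \<le> \<bar>\<beta> j x - \<beta> k x\<bar>)"
      using Q_zero jk theta_pos by cases blast+
  qed
  have db: "dirac_bc n l \<beta> Q C D"
    by (intro dirac_bc.intro d dirac_bc_axioms.intro C_dim D_dim)
  interpret bvp n l \<beta> Q C D lam lam0
    by (intro bvp.intro ds db bvp_axioms.intro regular lam_zeros lam0_zeros lam_asymp)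
  have i: "\<forall>\<^sub>F m in cofinite. \<forall>x\<in>{0..l}.
      cnorm n (\<lambda>j. Yvec n l \<beta> Q C D p (lam m) x j - Y0vec n l \<beta> C D p (lam0 m) x j) < \<epsilon>"
    if "p < n" "\<epsilon> > 0" for p \<epsilon>
    using that by (intro components_imp_cnorm Y_uniform)
  show ?thesis
  proof (intro conjI allI impI)
    assume "strictly_regular_bc n l \<beta> C D lam0"
    then interpret strict_bvp n l \<beta> Q C D lam lam0
      by unfold_locales (simp add: strictly_regular_bc_def)
    show "\<exists>f f0 :: int \<Rightarrow> real \<Rightarrow> nat \<Rightarrow> complex.
           normalized_root_system n l \<beta> Q C D lam f \<and>
           normalized_root_system n l \<beta> (\<lambda>j k x. 0) C D lam0 f0 \<and>
           (\<forall>\<epsilon>>0. \<forall>\<^sub>F m in cofinite. \<forall>x\<in>{0..l}. cnorm n (\<lambda>j. f m x j - f0 m x j) < \<epsilon>) \<and>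
           (\<forall>\<^sub>F m in cofinite.
              card {k. lam k = lam m} = 1 \<and> card {k. lam0 k = lam0 m} = 1 \<and>
              (\<exists>\<alpha> \<alpha>0 p. \<alpha> \<noteq> 0 \<and> \<alpha>0 \<noteq> 0 \<and> p < n \<and>
                 (\<forall>x\<in>{0..l}. \<forall>j<n.
                    f m x j = \<alpha> * Yvec n l \<beta> Q C D p (lam m) x j \<and>
                    f0 m x j = \<alpha>0 * Y0vec n l \<beta> C D p (lam0 m) x j)))"
      by (rule root_systems)
  qed (use i Y_H_norm in blast)+
qed

end
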